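(* Consider the parallel-server system described in the context, under either the cancel-on-completion or the cancel-on-start redundancy mechanism, with fixed $(\mu_n)_{n=1}^N$ and $(p_S)_{S\in\mathcal S}$ and with $0<\lambda<\lambda^*$. Let $\boldsymbol{\tau}$ be a random element of $\mathcal N_K$ with $\mathbb P(\boldsymbol\tau=\boldsymbol T)=\mathbb P^*(\boldsymbol T)=\beta(\boldsymbol T)/\beta(\mathcal N_K)$ for $\boldsymbol T\in\mathcal N_K$, and let $U_1,\dots,U_K$ be independent exponential random variables with unit mean, independent of $\boldsymbol\tau$. For $S\in\mathcal S$ and $k=1,\dots,K$ put $$P_{k,S}=\sum_{\boldsymbol T\in\mathcal N_K}\mathbf 1\{\boldsymbol\tau=\boldsymbol T\}\,\frac{p_S}{p(\boldsymbol T,i_k(\boldsymbol T))}\,\mathbf 1\{i_k(\boldsymbol T)\ge j_S(\boldsymbol T)\},\qquad X_S=\sum_{k=1}^K P_{k,S}U_k .$$ Then, as $\lambda\uparrow\lambda^*$, $$\Bigl(1-\frac{\lambda}{\lambda^*}\Bigr)(Q_S)_{S\in\mathcal S}\ \overset{d}{\longrightarrow}\ (X_S)_{S\in\mathcal S}.$$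
   Context: Model. Fix $N\ge 1$, server speeds $\mu_1,\dots,\mu_N>0$, a nonempty collection $\mathcal S$ of nonempty subsets of $\{1,\dots,N\}$ (the job types), and $p_S>0$ ($S\in\mathcal S$) with $\sum_{S}p_S=1$. Type-$S$ jobs arrive according to independent Poisson processes of rates $N\lambda p_S$. Each of the $N$ servers has its own waiting line and processes its copies in order of arrival (FCFS) at speed $\mu_n$. An arriving type-$S$ job places one copy in the line of every server $n\in S$; each copy has an exponential unit-mean service requirement. Cancel-on-completion (c.o.c.): service requirements of copies are independent, and when one copy of a job finishes service, all its other copies are removed immediately. Cancel-on-start (c.o.s.): when one copy of a job starts service, all its other copies are removed; an arriving job that finds several compatible idle servers starts at the one that has been idle longest. $Q_S$ denotes the stationary number of type-$S$ jobs in the system (each job counted once, waiting or in service). Criticality. For nonempty $\mathcal T\subseteq\mathcal S$ let $p(\mathcal T)=\sum_{S\in\mathcal T}p_S$ and $\mu(\mathcal T)=\sum_{n\in\bigcup_{S\in\mathcal T}S}\mu_n$. The critical arrival rate is $\lambda^*=\frac1N\min_{\emptyset\ne\mathcal T\subseteq\mathcal S}\mu(\mathcal T)/p(\mathcal T)$; the system is stable (has a unique stationary distribution) for $\lambda<\lambda^*$. $\mathcal{CR}(\mathcal S)$ is the collection of critical subsets, i.e. nonempty $\mathcal T\subseteq\mathcal S$ attaining this minimum. $K$ is the largest $k$ such that there are $\mathcal T_1\subsetneq\dots\subsetneq\mathcal T_k$ all in $\mathcal{CR}(\mathcal S)$. Ordered vectors. $\mathcal N$ is the set of all finite vectors $\boldsymbol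 T=[T_1,\dots,T_m]$ of distinct elements of $\mathcal S$, $0\le m\le|\mathcal S|$ (including the empty vector); $|\boldsymbol T|=m$. $\mathrm{CR}(\boldsymbol T)=\{i:\{T_1,\dots,T_i\}\in\mathcal{CR}(\mathcal S)\}$, and $\mathcal N_k=\{\boldsymbol T\in\mathcal N:|\mathrm{CR}(\boldsymbol T)|=k\}$. Write $p(\boldsymbol T,i)=\sum_{l\le i}p_{T_l}$, $\mu(\boldsymbol T,i)=\mu(\{T_1,\dots,T_i\})$. For $\boldsymbol T\in\mathcal N_K$ write $\mathrm{CR}(\boldsymbol T)=\{i_1(\boldsymbol T)<\dots<i_K(\boldsymbol T)\}$, and let $j_S(\boldsymbol T)$ be the position of $S$ in $\boldsymbol T$ ($=\infty$ if $S$ does not occur in $\boldsymbol T$). Finally $$\beta(\boldsymbol T)=\prod_{i=1}^{|\boldsymbol T|}\frac{N\lambda^*p_{T_i}}{\mu(\boldsymbol T,i)}\prod_{i\in\{1,\dots,|\boldsymbol T|\}\setminus\mathrm{CR}(\boldsymbol T)}\Bigl(1-\frac{N\lambda^*p(\boldsymbol T,i)}{\mu(\boldsymbol T,i)}\Bigr)^{-1},\qquad \beta(\mathcal N_K)=\sum_{\boldsymbol T\in\mathcal N_K}\beta(\boldsymbol T).$$ *)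

theory Defs
  imports "HOL-Probability.Probability" "HOL-Library.Extended_Nat"
begin

text \<open>
  Servers are the elements of a finite type \<open>'n\<close>, so the number of servers is \<open>CARD('n)\<close>.
  A job type is a set of servers, and \<open>\<S>\<close> is the collection of job types.
\<close>

section \<open>Markov jump processes driven by Poisson events\<close>

text \<open>
  Events of kind \<open>e\<close> occur at the epochs of independent Poisson processes of rates \<open>r e\<close>, and an
  event \<open>e\<close> moves the state from \<open>x\<close> to \<open>step e x\<close>.  By superposition the number of events in
  \<open>[0,t]\<close> is Poisson with mean \<open>t * (\<Sum>e. r e)\<close>, and the kinds of successive events are
  independent, equal to \<open>e\<close> with probability proportional to \<open>r e\<close>.
\<close>

definition event_law :: "('e::finite \<Rightarrow> real) \<Rightarrow> 'e pmf" where
  "event_law r = embed_pmf (\<lambda>e. r e / (\<Sum>e'\<in>UNIV. r e'))"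

definition transition_law ::
    "('e::finite \<Rightarrow> real) \<Rightarrow> ('e \<Rightarrow> 's \<Rightarrow> 's) \<Rightarrow> real \<Rightarrow> 's \<Rightarrow> 's pmf" where
  "transition_law r step t x =
     bind_pmf (poisson_pmf (t * (\<Sum>e\<in>UNIV. r e)))
       (\<lambda>k. map_pmf (\<lambda>es. fold step es x) (replicate_pmf k (event_law r)))"

definition stationary_law ::
    "('e::finite \<Rightarrow> real) \<Rightarrow> ('e \<Rightarrow> 's \<Rightarrow> 's) \<Rightarrow> 's set \<Rightarrow> 's pmf \<Rightarrow> bool" where
  "stationary_law r step states \<pi> \<longleftrightarrow>
     set_pmf \<pi> \<subseteq> states \<and> (\<forall>t>0. bind_pmf \<pi> (transition_law r step t) = \<pi>)"


section \<open>The parallel-server system\<close>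

text \<open>
  \<open>Completion n\<close> is a potential service completion at server \<open>n\<close>: as service requirements are
  exponential with unit mean, the copy in service at \<open>n\<close> (if any) finishes at rate \<open>\<mu> n\<close>,
  whatever the past.  The event has no effect if server \<open>n\<close> is idle.
\<close>

datatype 'n event = Arrival "'n set" | Completion 'n

instance event :: (finite) finite
proof
  have "x \<in> range Arrival \<union> range Completion" for x :: "'a event"
    by (cases x) simp_all
  then have "(UNIV :: 'a event set) \<subseteq> range Arrival \<union> range Completion"
    by (rule subsetI)
  then show "finite (UNIV :: 'a event set)"
    by (rule finite_subset) simp
qed

definition event_rate ::
    "('n::finite \<Rightarrow> real) \<Rightarrow> ('n set \<Rightarrow> real) \<Rightarrow> 'n set set \<Rightarrow> real \<Rightarrow> 'n event \<Rightarrow> real" where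
  "event_rate \<mu> p \<S> lam e =
     (case e of
        Arrival S \<Rightarrow> if S \<in> \<S> then real CARD('n) * lam * p S else 0
      | Completion n \<Rightarrow> \<mu> n)"

subsection \<open>Cancel-on-completion\<close>

text \<open>
  The state lists the types of all jobs in the system in order of arrival.  The line of server \<open>n\<close>
  consists of the copies of the listed jobs \<open>S\<close> with \<open>n \<in> S\<close>, in the same order, and the first
  of these is in service at \<open>n\<close>.  When it finishes, the job leaves with all its copies.
\<close>

primrec coc_step :: "'n event \<Rightarrow> 'n set list \<Rightarrow> 'n set list" where
  "coc_step (Arrival S) c = c @ [S]"
| "coc_step (Completion n) c =
     (case List.extract (\<lambda>S. n \<in> S) c of
        None \<Rightarrow> c
      | Some (before, S, after) \<Rightarrow> before @ after)"

definition coc_number :: "'n set list \<Rightarrow> 'n set \<Rightarrow> nat" where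
  "coc_number c S = count_list c S"

definition coc_stationary ::
    "('n::finite \<Rightarrow> real) \<Rightarrow> ('n set \<Rightarrow> real) \<Rightarrow> 'n set set \<Rightarrow> real \<Rightarrow> 'n set list pmf \<Rightarrow> bool" where
  "coc_stationary \<mu> p \<S> lam = stationary_law (event_rate \<mu> p \<S> lam) coc_step (lists \<S>)"

subsection \<open>Cancel-on-start\<close>

text \<open>
  \<open>waiting\<close>: types of the jobs no copy of which has started, in order of arrival;
  \<open>serving n\<close>: type of the job in service at \<open>n\<close>, \<open>None\<close> if \<open>n\<close> is idle;
  \<open>idle\<close>: the idle servers, the one that has been idle longest first.
  Servers outside \<open>\<Union>\<S>\<close> never receive a copy and are left out of \<open>idle\<close>; otherwise their mutual
  order, which is irrelevant and never changes, would spoil the uniqueness of the stationary law.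
\<close>

record 'n cos_state =
  waiting :: "'n set list"
  serving :: "'n \<Rightarrow> 'n set option"
  idle :: "'n list"

primrec cos_step :: "'n event \<Rightarrow> 'n cos_state \<Rightarrow> 'n cos_state" where
  "cos_step (Arrival S) x =
     (case List.find (\<lambda>n. n \<in> S) (idle x) of
        None \<Rightarrow> x\<lparr>waiting := waiting x @ [S]\<rparr>
      | Some n \<Rightarrow> x\<lparr>serving := (serving x)(n := Some S), idle := remove1 n (idle x)\<rparr>)"
| "cos_step (Completion n) x =
     (if serving x n = None then x
      else case List.extract (\<lambda>S. n \<in> S) (waiting x) of
        None \<Rightarrow> x\<lparr>serving := (serving x)(n := None), idle := idle x @ [n]\<rparr>
      | Some (before, S, after) \<Rightarrow>
          x\<lparr>waiting := before @ after, serving := (serving x)(n := Some S)\<rparr>)"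

definition cos_states :: "'n set set \<Rightarrow> 'n cos_state set" where
  "cos_states \<S> =
     {x. waiting x \<in> lists \<S> \<and>
         (\<forall>n S. serving x n = Some S \<longrightarrow> S \<in> \<S> \<and> n \<in> S) \<and>
         distinct (idle x) \<and> set (idle x) = {n \<in> \<Union>\<S>. serving x n = None} \<and>
         (\<forall>S\<in>set (waiting x). S \<inter> set (idle x) = {})}"

definition cos_number :: "'n cos_state \<Rightarrow> 'n set \<Rightarrow> nat" where
  "cos_number x S = count_list (waiting x) S + card {n. serving x n = Some S}"

definition cos_stationary ::
    "('n::finite \<Rightarrow> real) \<Rightarrow> ('n set \<Rightarrow> real) \<Rightarrow> 'n set set \<Rightarrow> real \<Rightarrow> 'n cos_state pmf \<Rightarrow> bool" where
  "cos_stationary \<mu> p \<S> lam =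
     stationary_law (event_rate \<mu> p \<S> lam) cos_step (cos_states \<S>)"


section \<open>Criticality\<close>

definition load_ratio :: "('n \<Rightarrow> real) \<Rightarrow> ('n set \<Rightarrow> real) \<Rightarrow> 'n set set \<Rightarrow> real" where
  "load_ratio \<mu> p \<T> = (\<Sum>n\<in>\<Union>\<T>. \<mu> n) / (\<Sum>S\<in>\<T>. p S)"

definition critical_rate ::
    "('n::finite \<Rightarrow> real) \<Rightarrow> ('n set \<Rightarrow> real) \<Rightarrow> 'n set set \<Rightarrow> real" where
  "critical_rate \<mu> p \<S> =
     1 / real CARD('n) * Min (load_ratio \<mu> p ` {\<T>. \<T> \<noteq> {} \<and> \<T> \<subseteq> \<S>})"

definition critical_subsets ::
    "('n \<Rightarrow> real) \<Rightarrow> ('n set \<Rightarrow> real) \<Rightarrow> 'n set set \<Rightarrow> 'n set set set" where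
  "critical_subsets \<mu> p \<S> =
     {\<T>. is_arg_min (load_ratio \<mu> p) (\<lambda>\<T>. \<T> \<noteq> {} \<and> \<T> \<subseteq> \<S>) \<T>}"

definition chain_length :: "('n \<Rightarrow> real) \<Rightarrow> ('n set \<Rightarrow> real) \<Rightarrow> 'n set set \<Rightarrow> nat" where
  "chain_length \<mu> p \<S> =
     Max {length Ts | Ts. sorted_wrt (\<subset>) Ts \<and> set Ts \<subseteq> critical_subsets \<mu> p \<S>}"


section \<open>Ordered vectors\<close>

text \<open>Positions in vectors are counted from 1, so the entry at position \<open>i\<close> of \<open>T\<close> is \<open>T ! (i - 1)\<close>.\<close>

definition ordered_vectors :: "'n set set \<Rightarrow> 'n set list set" where
  "ordered_vectors \<S> = {T. distinct T \<and> set T \<subseteq> \<S>}"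

definition critical_positions ::
    "('n \<Rightarrow> real) \<Rightarrow> ('n set \<Rightarrow> real) \<Rightarrow> 'n set set \<Rightarrow> 'n set list \<Rightarrow> nat set" where
  "critical_positions \<mu> p \<S> T =
     {i \<in> {1..length T}. set (take i T) \<in> critical_subsets \<mu> p \<S>}"

definition vectors_with ::
    "('n \<Rightarrow> real) \<Rightarrow> ('n set \<Rightarrow> real) \<Rightarrow> 'n set set \<Rightarrow> nat \<Rightarrow> 'n set list set" where
  "vectors_with \<mu> p \<S> k =
     {T \<in> ordered_vectors \<S>. card (critical_positions \<mu> p \<S> T) = k}"

abbreviation max_vectors ::
    "('n \<Rightarrow> real) \<Rightarrow> ('n set \<Rightarrow> real) \<Rightarrow> 'n set set \<Rightarrow> 'n set list set" where
  "max_vectors \<mu> p \<S> \<equiv> vectors_with \<mu> p \<S> (chain_length \<mu> p \<S>)"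

definition p_upto :: "('n set \<Rightarrow> real) \<Rightarrow> 'n set list \<Rightarrow> nat \<Rightarrow> real" where
  "p_upto p T i = (\<Sum>l\<in>{1..i}. p (T ! (l - 1)))"

definition mu_upto :: "('n \<Rightarrow> real) \<Rightarrow> 'n set list \<Rightarrow> nat \<Rightarrow> real" where
  "mu_upto \<mu> T i = (\<Sum>n\<in>\<Union>(set (take i T)). \<mu> n)"

text \<open>\<open>critical_position \<mu> p \<S> T k\<close> is the \<open>k\<close>-th smallest critical position, \<open>k = 1, 2, \<dots>\<close>\<close>

definition critical_position ::
    "('n \<Rightarrow> real) \<Rightarrow> ('n set \<Rightarrow> real) \<Rightarrow> 'n set set \<Rightarrow> 'n set list \<Rightarrow> nat \<Rightarrow> nat" where
  "critical_position \<mu> p \<S> T k = sorted_list_of_set (critical_positions \<mu> p \<S> T) ! (k - 1)"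

text \<open>The infimum of the empty set of extended naturals is \<open>\<infinity>\<close>.\<close>

definition position :: "'n set \<Rightarrow> 'n set list \<Rightarrow> enat" where
  "position S T = Inf {enat j | j. j \<in> {1..length T} \<and> T ! (j - 1) = S}"

definition vector_weight ::
    "('n::finite \<Rightarrow> real) \<Rightarrow> ('n set \<Rightarrow> real) \<Rightarrow> 'n set set \<Rightarrow> 'n set list \<Rightarrow> real" where
  "vector_weight \<mu> p \<S> T =
     (\<Prod>i\<in>{1..length T}.
        real CARD('n) * critical_rate \<mu> p \<S> * p (T ! (i - 1)) / mu_upto \<mu> T i) *
     (\<Prod>i\<in>{1..length T} - critical_positions \<mu> p \<S> T.
        inverse (1 - real CARD('n) * critical_rate \<mu> p \<S> * p_upto p T i / mu_upto \<mu> T i))"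


section \<open>The limiting random vector\<close>

text \<open>
  Vectors are indexed by all sets of servers; the entries of \<open>limit_vector\<close> at indices outside \<open>\<S>\<close>
  are 0, like the numbers of jobs of such types in the system.
\<close>

definition limit_share ::
    "('n \<Rightarrow> real) \<Rightarrow> ('n set \<Rightarrow> real) \<Rightarrow> 'n set set \<Rightarrow> nat \<Rightarrow> 'n set \<Rightarrow> 'n set list \<Rightarrow> real" where
  "limit_share \<mu> p \<S> k S \<tau> =
     (\<Sum>T\<in>max_vectors \<mu> p \<S>.
        of_bool (\<tau> = T) * (p S / p_upto p T (critical_position \<mu> p \<S> T k)) *
        of_bool (enat (critical_position \<mu> p \<S> T k) \<ge> position S T))"

definition limit_vector ::
    "('n::finite \<Rightarrow> real) \<Rightarrow> ('n set \<Rightarrow> real) \<Rightarrow> 'n set set \<Rightarrow> 'n set list \<Rightarrow> (nat \<Rightarrow> real) \<Rightarrow>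
      real ^ 'n set" where
  "limit_vector \<mu> p \<S> \<tau> u =
     (\<chi> S. \<Sum>k\<in>{1..chain_length \<mu> p \<S>}. limit_share \<mu> p \<S> k S \<tau> * u k)"


section \<open>Independence and convergence in distribution\<close>

text \<open>The library's \<open>indep_var\<close> requires the two random variables to have values in the same type.\<close>

definition independent_variables ::
    "'w measure \<Rightarrow> 'a measure \<Rightarrow> ('w \<Rightarrow> 'a) \<Rightarrow> 'b measure \<Rightarrow> ('w \<Rightarrow> 'b) \<Rightarrow> bool" where
  "independent_variables M A X B Y \<longleftrightarrow>
     X \<in> measurable M A \<and> Y \<in> measurable M B \<and>
     prob_space.indep_set M {X -` E \<inter> space M | E. E \<in> sets A} {Y -` E \<inter> space M | E. E \<in> sets B}"

definition weakly_converges ::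
    "('i \<Rightarrow> ('a::topological_space) measure) \<Rightarrow> 'a measure \<Rightarrow> 'i filter \<Rightarrow> bool" where
  "weakly_converges D D' F \<longleftrightarrow>
     (\<forall>f :: 'a \<Rightarrow> real. continuous_on UNIV f \<and> bounded (range f) \<longrightarrow>
        ((\<lambda>i. \<integral>x. f x \<partial>D i) \<longlongrightarrow> (\<integral>x. f x \<partial>D')) F)"

end

theory Submission
  imports Defs "HOL-Real_Asymp.Real_Asymp"
begin

text \<open>
  A law that is stationary for the process is invariant under the jump chain, and the jump chain has
  at most one invariant law, since some state is reached from all others.  Under cancel-on-completion
  the state is an order-independent queue with weights
  \<open>\<Prod>i. N \<lambda> p(c_i) / \<mu>({c_1, \<dots>, c_i})\<close>; under cancel-on-start the waiting line and the ordered
  list of idle servers form a Markov chain by themselves, whose invariant law is the product of two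
  such weights restricted to compatible pairs.

  Summing over the lines \<open>c\<close> whose types first appear in the order \<open>T\<close> gives a product of geometric
  series.  With arguments \<open>exp (- (1 - \<rho>) s)\<close> and \<open>\<rho> = \<lambda> / \<lambda>\<^sup>* \<rightarrow> 1\<close>, each critical prefix of
  \<open>T\<close> contributes a pole \<open>1 / ((1 - \<rho>) (1 + \<Sum>p s / p(T, i)))\<close>, so that the vectors with the largest
  number of critical prefixes dominate and every such prefix turns into an exponential random variable.
  The compatible idle servers only weight the part of \<open>T\<close> after the last critical prefix, which
  lists the union of all critical sets for every dominating \<open>T\<close>; hence they do not affect the limit.
\<close>

section \<open>Stationary laws of the jump chain\<close>

text \<open>The balance equations are never checked against an exhaustive list of predecessors. Two
  laws, one of which lies pointwise below the other, coincide, so it is enough to exhibit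
  predecessors whose inflow already reaches the outflow.

  That stationary laws exist is a hypothesis; only a candidate proportional to the weights is
  constructed. Its normalizing constant stays implicit, because a Laplace transform is a quotient of
  two sums of the same kind: tilting by the transform argument merely changes the arrival rates.

  Under cancel-on-start the joint law with the types in service is not determined at all. It is
  projected away, and the jobs in service are put back only as a bounded error.

  Laplace transforms are compared at natural arguments only: in the coordinates exp (- x) they are
  moments on a compact cube, where polynomials are dense.\<close>

definition jump_law ::
    "('e::finite \<Rightarrow> real) \<Rightarrow> ('e \<Rightarrow> 's \<Rightarrow> 's) \<Rightarrow> 's pmf \<Rightarrow> 's pmf" where
  "jump_law r step \<pi> = bind_pmf (event_law r) (\<lambda>e. map_pmf (step e) \<pi>)"

text \<open>Both masses total 1, which leaves no room for a strict inequality. This turns one-sided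
  flow bounds into invariance.\<close>

lemma pmf_eq_if_pmf_le:
  assumes "\<And>x. pmf P x \<le> pmf Q x"
  shows "P = Q"
  using pmf_neq_exists_less[of Q P] assms by (auto simp: not_less[symmetric])

lemma measure_pmf_mono_on:
  assumes "\<And>x. x \<in> E \<Longrightarrow> pmf P x \<le> pmf Q x"
  shows "measure_pmf.prob P E \<le> measure_pmf.prob Q E"
proof -
  have "emeasure (measure_pmf P) E \<le> emeasure (measure_pmf Q) E"
    unfolding nn_integral_pmf[symmetric]
    by (rule nn_integral_mono) (use assms in \<open>auto intro: ennreal_leI\<close>)
  then show ?thesis
    by (simp add: measure_pmf.emeasure_eq_measure)
qed

context
  fixes r :: "'e::finite \<Rightarrow> real"
  assumes r_nonneg: "\<And>e. r e \<ge> 0" and r_pos: "(\<Sum>e\<in>UNIV. r e) > 0"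
begin

lemma pmf_event_law: "pmf (event_law r) e = r e / (\<Sum>e\<in>UNIV. r e)"
  unfolding event_law_def
proof (rule pmf_embed_pmf)
  show "0 \<le> r x / sum r UNIV" for x
    using r_nonneg r_pos by simp
  have "(\<Sum>e\<in>UNIV. r e / sum r UNIV) = 1"
    using r_pos by (simp add: sum_divide_distrib[symmetric])
  then show "(\<integral>\<^sup>+ x. ennreal (r x / sum r UNIV) \<partial>count_space UNIV) = 1"
    using r_nonneg r_pos by (simp add: nn_integral_count_space_finite sum_ennreal)
qed

lemma measure_jump_law:
  "measure_pmf.prob (jump_law r step \<pi>) E =
     (\<Sum>e\<in>UNIV. r e * measure_pmf.prob \<pi> (step e -` E)) / (\<Sum>e\<in>UNIV. r e)"
proof -
  have "measure_pmf.prob (jump_law r step \<pi>) E =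
      measure_pmf.expectation (event_law r) (\<lambda>e. measure_pmf.prob \<pi> (step e -` E))"
    unfolding jump_law_def measure_pmf_bind
    by (subst measure_pmf.measure_bind[where N="count_space UNIV"])
       (auto simp: space_subprob_algebra intro: measure_pmf.subprob_space_axioms)
  also have "\<dots> = (\<Sum>e\<in>UNIV. pmf (event_law r) e * measure_pmf.prob \<pi> (step e -` E))"
    by (subst integral_measure_pmf[of UNIV]) auto
  finally show ?thesis
    by (simp add: pmf_event_law sum_divide_distrib)
qed

text \<open>
  In a short time \<open>t\<close> the process makes no jump or one jump up to an event of probability
  \<open>o(t)\<close>; letting \<open>t\<close> tend to 0 gives \<open>jump_law r step \<pi> \<le> \<pi>\<close>, and comparing masses gives equality.
\<close>

lemma stationary_law_imp_jump_law:
  assumes "stationary_law r step states \<pi>"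
  shows "jump_law r step \<pi> = \<pi>"
proof (rule pmf_eq_if_pmf_le)
  fix y
  define R where "R = (\<Sum>e\<in>UNIV. r e)"
  \<comment> \<open>Law of the state after exactly \<open>k\<close> events, started from
    \<pi>.\<close>
  define q where "q k = bind_pmf \<pi> (\<lambda>x. map_pmf (\<lambda>es. fold step es x) (replicate_pmf k (event_law r)))" for k
  have q0: "q 0 = \<pi>"
    by (simp add: q_def bind_return_pmf')
  have q1: "q (Suc 0) = jump_law r step \<pi>"
    unfolding q_def jump_law_def map_pmf_def
    by (subst bind_commute_pmf)
       (simp add: bind_assoc_pmf bind_return_pmf map_pmf_def)
  \<comment> \<open>\<open>s\<close> is the mean number of events up to time \<open>s / R\<close>.
    Dropping the nonnegative terms with two or more events from the Poisson mixture and solving for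
    the one-event term gives the bound; no error estimate is involved.\<close>
  have main: "pmf (jump_law r step \<pi>) y \<le> pmf \<pi> y * ((1 - exp (- s)) / (s * exp (- s)))" if s: "s > 0" for s
  proof -
    have R: "R > 0" using r_pos by (simp add: R_def)
    have "bind_pmf \<pi> (transition_law r step (s / R)) = \<pi>"
      using assms s R unfolding stationary_law_def by simp
    moreover have "bind_pmf \<pi> (transition_law r step (s / R)) = bind_pmf (poisson_pmf s) q"
      using R unfolding transition_law_def q_def R_def[symmetric]
      by (subst bind_commute_pmf) simp
    ultimately have "pmf \<pi> y = measure_pmf.expectation (poisson_pmf s) (\<lambda>k. pmf (q k) y)"
      by (metis pmf_bind)
    also have "\<dots> \<ge> measure_pmf.expectation (poisson_pmf s) (\<lambda>k. if k \<in> {0, Suc 0} then pmf (q k) y else 0)"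
      by (intro integral_mono measure_pmf.integrable_const_bound[where B=1]) (auto simp: pmf_le_1)
    also have "measure_pmf.expectation (poisson_pmf s) (\<lambda>k. if k \<in> {0, Suc 0} then pmf (q k) y else 0)
       = (\<Sum>k\<in>{0, Suc 0}. pmf (poisson_pmf s) k * pmf (q k) y)"
      by (subst integral_measure_pmf[of "{0, Suc 0}"]) (auto split: if_splits)
    also have "\<dots> = exp (- s) * pmf \<pi> y + s * exp (- s) * pmf (jump_law r step \<pi>) y"
      using s by (simp add: q0 q1)
    finally show ?thesis using s by (simp add: field_simps)
  qed
  have "((\<lambda>s. pmf \<pi> y * ((1 - exp (- s)) / (s * exp (- s)))) \<longlongrightarrow> pmf \<pi> y * 1) (at_right (0::real))"
    by (intro tendsto_mult tendsto_const) real_asymp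
  moreover have "\<forall>\<^sub>F s in at_right (0::real). pmf (jump_law r step \<pi>) y \<le> pmf \<pi> y * ((1 - exp (- s)) / (s * exp (- s)))"
    by (rule eventually_mono[OF eventually_at_right_less]) (rule main)
  ultimately have "pmf (jump_law r step \<pi>) y \<le> pmf \<pi> y * 1"
    by (rule tendsto_lowerbound) simp
  then show "pmf (jump_law r step \<pi>) y \<le> pmf \<pi> y" by simp
qed

text \<open>
  The set on which \<open>\<pi>\<close> exceeds \<open>\<rho>\<close> maximizes \<open>\<pi> E - \<rho> E\<close>; invariance forces it to be closed under
  all events of positive rate.
\<close>

lemma jump_law_excess_closed:
  assumes "jump_law r step \<pi> = \<pi>" and "jump_law r step \<rho> = \<rho>"
    and x: "pmf \<rho> x < pmf \<pi> x" and e: "r e > 0"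
  shows "pmf \<rho> (step e x) < pmf \<pi> (step e x)"
proof (rule ccontr)
  assume neg: "\<not> pmf \<rho> (step e x) < pmf \<pi> (step e x)"
  define A where "A = {x. pmf \<rho> x < pmf \<pi> x}"
  define D where "D E = measure_pmf.prob \<pi> E - measure_pmf.prob \<rho> E" for E
  \<comment> \<open>Hahn decomposition: removing from \<open>E\<close> the points outside
    \<open>A\<close> and adding the missing points of \<open>A\<close> can only increase
    \<open>D\<close>.\<close>
  have Dle: "D E \<le> D A" for E
  proof -
    have "D E = D (E \<inter> A) + D (E - A)"
      unfolding D_def by (auto simp: measure_pmf.finite_measure_Diff' Int_commute)
    moreover have "D A = D (E \<inter> A) + D (A - E)"
      unfolding D_def by (auto simp: measure_pmf.finite_measure_Diff' Int_commute)
    moreover have "D (E - A) \<le> 0"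
      unfolding D_def using measure_pmf_mono_on[of "E - A" \<pi> \<rho>] by (auto simp: A_def not_less)
    moreover have "D (A - E) \<ge> 0"
      unfolding D_def using measure_pmf_mono_on[of "A - E" \<rho> \<pi>] by (auto simp: A_def)
    ultimately show ?thesis by simp
  qed
  \<comment> \<open>Invariance makes \<open>D A\<close> the rate-weighted mean of the values of
    \<open>D\<close> at the preimages of \<open>A\<close>. None of them exceeds \<open>D A\<close>,
    so those of positive rate equal it. The point \<open>x\<close>, missing from such a preimage,
    could then be added and would push \<open>D\<close> above its maximum.\<close>
  have "(\<Sum>e\<in>UNIV. r e) * D A = (\<Sum>e\<in>UNIV. r e * D (step e -` A))"
    using measure_jump_law[of step \<pi> A] measure_jump_law[of step \<rho> A] assms(1,2) r_pos
    by (simp add: D_def sum_subtractf right_diff_distrib field_simps)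
  then have "(\<Sum>e\<in>UNIV. r e * (D A - D (step e -` A))) = 0"
    by (simp add: sum_subtractf right_diff_distrib sum_distrib_right)
  then have "r e * (D A - D (step e -` A)) = 0"
    by (subst (asm) sum_nonneg_eq_0_iff) (use Dle r_nonneg in auto)
  then have eq: "D (step e -` A) = D A"
    using e by simp
  have xA: "x \<notin> step e -` A" using neg by (simp add: A_def)
  then have "D (insert x (step e -` A)) = D (step e -` A) + (pmf \<pi> x - pmf \<rho> x)"
    unfolding D_def
    by (subst (1 2) insert_is_Un, subst (1 2) measure_pmf.finite_measure_Union)
       (auto simp: measure_pmf_single)
  with eq x Dle[of "insert x (step e -` A)"] show False by simp
qed

text \<open>Of two distinct laws each exceeds the other somewhere. Both excess sets are closed under
  the events, so both contain \<open>x0\<close>, which is absurd. Accessibility is phrased through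
  closed sets, the form in which the excess sets meet it.\<close>

lemma jump_law_unique:
  assumes inv: "jump_law r step \<pi> = \<pi>" "jump_law r step \<rho> = \<rho>"
    and supp: "set_pmf \<pi> \<subseteq> states" "set_pmf \<rho> \<subseteq> states"
    and reach: "\<And>A x. x \<in> A \<Longrightarrow> x \<in> states \<Longrightarrow> (\<And>e y. y \<in> A \<Longrightarrow> r e > 0 \<Longrightarrow> step e y \<in> A) \<Longrightarrow> x0 \<in> A"
  shows "\<pi> = \<rho>"
proof (rule ccontr)
  have x0: "pmf P x0 < pmf Q x0"
    if "P \<noteq> Q" "jump_law r step P = P" "jump_law r step Q = Q" "set_pmf Q \<subseteq> states" for P Q
  proof -
    from that(1) obtain x where x: "pmf P x < pmf Q x"
      using pmf_neq_exists_less by blast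
    then have "x \<in> set_pmf Q"
      by (metis pmf_nonneg less_le_not_le pmf_positive_iff order_le_less_trans)
    with x that have "x0 \<in> {x. pmf P x < pmf Q x}"
      by (intro reach[of x]) (auto intro: jump_law_excess_closed)
    then show ?thesis by simp
  qed
  assume "\<pi> \<noteq> \<rho>"
  with x0[of \<pi> \<rho>] x0[of \<rho> \<pi>] inv supp show False by fastforce
qed

text \<open>Only lower bounds on the inflow into points of the support are demanded; that no
  predecessor was overlooked follows from the total mass.\<close>

lemma jump_lawI:
  assumes "\<And>y. y \<in> set_pmf \<pi> \<Longrightarrow>
    (\<Sum>e\<in>UNIV. r e) * pmf \<pi> y \<le> (\<Sum>e\<in>UNIV. r e * measure_pmf.prob \<pi> (step e -` {y}))"
  shows "jump_law r step \<pi> = \<pi>"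
proof (rule pmf_eq_if_pmf_le[symmetric])
  fix y
  show "pmf \<pi> y \<le> pmf (jump_law r step \<pi>) y"
  proof (cases "y \<in> set_pmf \<pi>")
    case True
    then show ?thesis
      using assms[OF True] measure_jump_law[of step \<pi> "{y}"] r_pos
      by (simp add: measure_pmf_single pos_le_divide_eq mult.commute)
  qed (simp add: set_pmf_iff)
qed

end

text \<open>Lumping. The intertwining is asked on the support only, since the projection of the
  cancel-on-start state commutes with the steps on valid states.\<close>

lemma jump_law_map:
  assumes "jump_law r step \<pi> = \<pi>"
    and "\<And>e x. x \<in> set_pmf \<pi> \<Longrightarrow> e \<in> set_pmf (event_law r) \<Longrightarrow> f (step e x) = step' e (f x)"
  shows "jump_law r step' (map_pmf f \<pi>) = map_pmf f \<pi>"
proof -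
  have "map_pmf f \<pi> = bind_pmf (event_law r) (\<lambda>e. map_pmf f (map_pmf (step e) \<pi>))"
    by (subst (1) assms(1)[symmetric]) (simp add: jump_law_def map_bind_pmf)
  also have "\<dots> = jump_law r step' (map_pmf f \<pi>)"
    unfolding jump_law_def map_pmf_comp
    by (intro bind_pmf_cong map_pmf_cong refl) (use assms(2) in simp)
  finally show ?thesis by simp
qed

section \<open>Order-independent queues\<close>

primrec prefix_prod :: "('x set \<Rightarrow> 'x \<Rightarrow> real) \<Rightarrow> 'x set \<Rightarrow> 'x list \<Rightarrow> real" where
  "prefix_prod f A [] = 1"
| "prefix_prod f A (x # xs) = f A x * prefix_prod f (insert x A) xs"

lemma prefix_prod_append:
  "prefix_prod f A (xs @ ys) = prefix_prod f A xs * prefix_prod f (A \<union> set xs) ys"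
  by (induction xs arbitrary: A) simp_all

lemma prefix_prod_mult:
  "prefix_prod (\<lambda>A x. f A x * g A x) A xs = prefix_prod f A xs * prefix_prod g A xs"
  by (induction xs arbitrary: A) simp_all

lemma prefix_prod_cong:
  assumes "\<And>B x. A \<subseteq> B \<Longrightarrow> B \<subseteq> A \<union> set xs \<Longrightarrow> x \<in> set xs \<Longrightarrow> f B x = g B x"
  shows "prefix_prod f A xs = prefix_prod g A xs"
  using assms
proof (induction xs arbitrary: A)
  case (Cons y ys)
  have "f A y = g A y" by (intro Cons.prems) auto
  moreover have "prefix_prod f (insert y A) ys = prefix_prod g (insert y A) ys"
    by (intro Cons.IH Cons.prems) auto
  ultimately show ?case by simp
qed simp

lemma prefix_prod_pos:
  assumes "\<And>B x. A \<subseteq> B \<Longrightarrow> B \<subseteq> A \<union> set xs \<Longrightarrow> x \<in> set xs \<Longrightarrow> f B x > 0"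
  shows "prefix_prod f A xs > 0"
  using assms
proof (induction xs arbitrary: A)
  case (Cons y ys)
  have "f A y > 0" by (intro Cons.prems) auto
  moreover have "prefix_prod f (insert y A) ys > 0"
    by (intro Cons.IH Cons.prems) auto
  ultimately show ?case by simp
qed simp

lemma tendsto_prefix_prod:
  assumes "\<And>B x. A \<subseteq> B \<Longrightarrow> B \<subseteq> A \<union> set xs \<Longrightarrow> x \<in> set xs \<Longrightarrow> ((\<lambda>i. f i B x) \<longlongrightarrow> g B x) F"
  shows "((\<lambda>i. prefix_prod (f i) A xs) \<longlongrightarrow> prefix_prod g A xs) F"
  using assms
proof (induction xs arbitrary: A)
  case (Cons y ys)
  have "((\<lambda>i. f i A y) \<longlongrightarrow> g A y) F" by (intro Cons.prems) auto
  moreover have "((\<lambda>i. prefix_prod (f i) (insert y A) ys) \<longlongrightarrow> prefix_prod g (insert y A) ys) F"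
    by (intro Cons.IH Cons.prems) auto
  ultimately show ?case by (auto intro: tendsto_mult)
qed simp

text \<open>Position \<open>i\<close>, counted from 1 as in the ordered vectors, is preceded by the
  entries of \<open>take (i - 1) T\<close>.\<close>

lemma prefix_prod_conv_prod:
  "prefix_prod f {} T = (\<Prod>i\<in>{1..length T}. f (set (take (i - 1) T)) (T ! (i - 1)))"
proof (induction T rule: rev_induct)
  case (snoc x T)
  have "{1..length (T @ [x])} = insert (Suc (length T)) {1..length T}" by auto
  then have "(\<Prod>i\<in>{1..length (T @ [x])}. f (set (take (i - 1) (T @ [x]))) ((T @ [x]) ! (i - 1)))
     = f (set T) x * (\<Prod>i\<in>{1..length T}. f (set (take (i - 1) (T @ [x]))) ((T @ [x]) ! (i - 1)))"
    by simp
  also have "(\<Prod>i\<in>{1..length T}. f (set (take (i - 1) (T @ [x]))) ((T @ [x]) ! (i - 1)))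
     = (\<Prod>i\<in>{1..length T}. f (set (take (i - 1) T)) (T ! (i - 1)))"
    by (intro prod.cong) (auto simp: nth_append)
  also have "f (set T) x * (\<Prod>i\<in>{1..length T}. f (set (take (i - 1) T)) (T ! (i - 1))) = prefix_prod f {} T * f (set T) x"
    unfolding snoc.IH by (rule mult.commute)
  also have "\<dots> = prefix_prod f {} (T @ [x])" by (simp add: prefix_prod_append)
  finally show ?case by (rule sym)
qed simp

lemma insert_nth_set_take:
  assumes "i \<in> {1..length T}"
  shows "insert (T ! (i - 1)) (set (take (i - 1) T)) = set (take i T)"
proof -
  have "take i T = take (i - 1) T @ [T ! (i - 1)]"
    using assms take_Suc_conv_app_nth[of "i - 1" T] by auto
  then show ?thesis by simp
qed

section \<open>Weights of order-independent queues and their partial balance\<close>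

definition oi_weight :: "('x \<Rightarrow> real) \<Rightarrow> ('x set \<Rightarrow> real) \<Rightarrow> 'x list \<Rightarrow> real" where
  "oi_weight a m c = prefix_prod (\<lambda>A x. a x / m (insert x A)) {} c"

lemma oi_weight_Nil [simp]: "oi_weight a m [] = 1"
  by (simp add: oi_weight_def)

lemma oi_weight_snoc: "oi_weight a m (c @ [x]) = oi_weight a m c * (a x / m (insert x (set c)))"
  by (simp add: oi_weight_def prefix_prod_append)

lemma oi_weight_nonneg:
  "(\<And>x. x \<in> set c \<Longrightarrow> a x \<ge> 0) \<Longrightarrow> (\<And>A. A \<subseteq> set c \<Longrightarrow> m A \<ge> 0) \<Longrightarrow> oi_weight a m c \<ge> 0"
proof (induction c rule: rev_induct)
  case (snoc x c)
  have "oi_weight a m c \<ge> 0" by (rule snoc.IH) (use snoc.prems in auto)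
  moreover have "m (insert x (set c)) \<ge> 0" "a x \<ge> 0" by (intro snoc.prems; auto)+
  ultimately show ?case by (simp add: oi_weight_snoc)
qed simp

lemma set_take_insert_drop: "set (take i c @ x # drop i c) = insert x (set c)"
proof -
  have "set (take i c) \<union> set (drop i c) = set c"
    by (metis append_take_drop_id set_append)
  then show ?thesis by auto
qed

text \<open>Order independence in one identity: the insertions of \<open>y\<close>, each weighted by
  the increase in service rate that \<open>y\<close> causes at its position, balance an arrival of
  \<open>y\<close>. In the induction, the insertions before the last entry \<open>z\<close> share
  the factor \<open>a z / ?Myz\<close>, and the increment \<open>?Myz - ?Mz\<close> of the insertion
  after \<open>z\<close> supplies exactly what turns \<open>?Myz\<close> into
  \<open>?Mz\<close>.\<close>

lemma oi_weight_insert_sum: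
  assumes "m {} = 0" and "\<And>x A. x \<in> insert y (set c) \<Longrightarrow> m (insert x A) \<noteq> 0"
  shows "(\<Sum>i\<le>length c. oi_weight a m (take i c @ y # drop i c) *
           (m (insert y (set (take i c))) - m (set (take i c)))) = a y * oi_weight a m c"
  using assms(2)
proof (induction c rule: rev_induct)
  case Nil
  then show ?case using assms(1) by (simp add: oi_weight_def)
next
  case (snoc z c)
  let ?Mz = "m (insert z (set c))" and ?Myz = "m (insert y (insert z (set c)))"
  let ?D = "\<lambda>i. m (insert y (set (take i c))) - m (set (take i c))"
  have nz: "?Mz \<noteq> 0" "?Myz \<noteq> 0" using snoc.prems by auto
  have ins: "oi_weight a m (take i c @ y # drop i c @ [z]) = oi_weight a m (take i c @ y # drop i c) * (a z / ?Myz)" for i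
    using oi_weight_snoc[of a m "take i c @ y # drop i c" z]
    unfolding set_take_insert_drop by (simp add: insert_commute)
  have "(\<Sum>i\<le>length (c @ [z]). oi_weight a m (take i (c @ [z]) @ y # drop i (c @ [z])) *
           (m (insert y (set (take i (c @ [z])))) - m (set (take i (c @ [z]))))) =
        (\<Sum>i\<le>length c. oi_weight a m (take i c @ y # drop i c) * ?D i) * (a z / ?Myz)
        + oi_weight a m ((c @ [z]) @ [y]) * (?Myz - ?Mz)"
    by (simp add: ins sum_distrib_left sum_divide_distrib mult.commute mult.left_commute)
  also have "\<dots> = a y * oi_weight a m c * (a z / ?Myz)
        + oi_weight a m c * (a z / ?Mz) * (a y / ?Myz) * (?Myz - ?Mz)"
  proof -
    have "(\<Sum>i\<le>length c. oi_weight a m (take i c @ y # drop i c) * ?D i) = a y * oi_weight a m c"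
      by (rule snoc.IH) (rule snoc.prems, auto)
    moreover have "oi_weight a m ((c @ [z]) @ [y]) = oi_weight a m c * (a z / ?Mz) * (a y / ?Myz)"
      unfolding oi_weight_snoc by simp
    ultimately show ?thesis by (simp only:)
  qed
  also have "\<dots> = a y * oi_weight a m (c @ [z])"
    using nz by (simp add: oi_weight_snoc field_simps)
  finally show ?case .
qed

text \<open>
  Server \<open>j\<close> of speed \<open>w j\<close> serves the first customer \<open>x\<close> with \<open>P j x\<close>; the sum runs over the states
  from which a service by \<open>j\<close> leads to \<open>c\<close>, so that this is the partial balance of the departures.
\<close>

lemma oi_weight_service_balance:
  fixes P :: "'j \<Rightarrow> 'x \<Rightarrow> bool"
  assumes m: "\<And>A. m A = (\<Sum>j\<in>J. w j * of_bool (\<exists>y\<in>A. P j y))"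
    and nz: "\<And>x A. x \<in> Y \<union> set c \<Longrightarrow> m (insert x A) \<noteq> 0"
  shows "(\<Sum>j\<in>J. w j * (\<Sum>x\<in>Y. \<Sum>i\<le>length c.
            of_bool (P j x \<and> (\<forall>y\<in>set (take i c). \<not> P j y)) * oi_weight a m (take i c @ x # drop i c)))
         = (\<Sum>x\<in>Y. a x) * oi_weight a m c"
proof -
  \<comment> \<open>The servers that would take the inserted \<open>x\<close> first are those
    compatible with \<open>x\<close> and with nobody ahead of it; their speeds add up to the
    increase of \<open>m\<close> caused by \<open>x\<close>.\<close>
  have diff: "(\<Sum>j\<in>J. w j * of_bool (P j x \<and> (\<forall>y\<in>A. \<not> P j y))) = m (insert x A) - m A" for x A
    unfolding m by (simp flip: sum_subtractf right_diff_distrib) (intro sum.cong refl, auto)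
  have "(\<Sum>j\<in>J. w j * (\<Sum>x\<in>Y. \<Sum>i\<le>length c.
            of_bool (P j x \<and> (\<forall>y\<in>set (take i c). \<not> P j y)) * oi_weight a m (take i c @ x # drop i c)))
      = (\<Sum>j\<in>J. \<Sum>x\<in>Y. \<Sum>i\<le>length c.
            oi_weight a m (take i c @ x # drop i c) * (w j * of_bool (P j x \<and> (\<forall>y\<in>set (take i c). \<not> P j y))))"
    by (simp only: sum_distrib_left mult_ac)
  also have "\<dots> = (\<Sum>x\<in>Y. \<Sum>i\<le>length c. \<Sum>j\<in>J.
            oi_weight a m (take i c @ x # drop i c) * (w j * of_bool (P j x \<and> (\<forall>y\<in>set (take i c). \<not> P j y))))"
    by (subst sum.swap, intro sum.cong refl, rule sum.swap)
  also have "\<dots> = (\<Sum>x\<in>Y. a x * oi_weight a m c)"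
    unfolding sum_distrib_left[symmetric] diff
    by (intro sum.cong refl oi_weight_insert_sum) (use nz in \<open>auto simp: m\<close>)
  finally show ?thesis by (simp add: sum_distrib_right)
qed

lemma sum_pmf_le_prob:
  assumes "finite F" "F \<subseteq> E"
  shows "(\<Sum>x\<in>F. pmf \<nu> x) \<le> measure_pmf.prob \<nu> E"
  using measure_pmf.finite_measure_mono[OF assms(2), of \<nu>] measure_measure_pmf_finite[OF assms(1), of \<nu>]
  by simp

text \<open>Distinct insertions give distinct lists: the entries before the first one satisfying
  \<open>P\<close> recover the position. The masses therefore add up inside any event that contains
  all these lists.\<close>

lemma sum_first_insert_le_prob:
  fixes Y :: "'x set"
  assumes Y: "finite Y" and g: "inj g"
    and E: "\<And>i x. i \<le> length c \<Longrightarrow> x \<in> Y \<Longrightarrow> P x \<Longrightarrow> \<forall>y\<in>set (take i c). \<not> P y \<Longrightarrow>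
              g (take i c @ x # drop i c) \<in> E"
  shows "(\<Sum>x\<in>Y. \<Sum>i\<le>length c. of_bool (P x \<and> (\<forall>y\<in>set (take i c). \<not> P y)) * pmf \<nu> (g (take i c @ x # drop i c)))
         \<le> measure_pmf.prob \<nu> E"
proof -
  define I where "I = {z \<in> Y \<times> {..length c}. P (fst z) \<and> (\<forall>y\<in>set (take (snd z) c). \<not> P y)}"
  define h where "h = (\<lambda>(x, i). g (take i c @ x # drop i c))"
  have fin: "finite I" using Y by (simp add: I_def)
  have inj: "inj_on h I"
  proof (rule inj_onI)
    fix z z' assume *: "z \<in> I" "z' \<in> I" "h z = h z'"
    have tw: "takeWhile (\<lambda>y. \<not> P y) (take (snd z) c @ fst z # drop (snd z) c) = take (snd z) c" if "z \<in> I" for z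
      using that by (auto simp: I_def takeWhile_append2)
    from * g have eq: "take (snd z) c @ fst z # drop (snd z) c = take (snd z') c @ fst z' # drop (snd z') c"
      by (auto simp: h_def split_beta dest: injD)
    with tw[OF *(1)] tw[OF *(2)] have t: "take (snd z) c = take (snd z') c" by simp
    moreover have "snd z \<le> length c" "snd z' \<le> length c"
      using * by (auto simp: I_def)
    ultimately have "snd z = snd z'" by (metis length_take min.absorb2)
    with t eq show "z = z'" by (auto simp: prod_eq_iff)
  qed
  have "(\<Sum>x\<in>Y. \<Sum>i\<le>length c. of_bool (P x \<and> (\<forall>y\<in>set (take i c). \<not> P y)) * pmf \<nu> (g (take i c @ x # drop i c)))
      = (\<Sum>z\<in>Y \<times> {..length c}. if P (fst z) \<and> (\<forall>y\<in>set (take (snd z) c). \<not> P y) then pmf \<nu> (h z) else 0)"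
    unfolding sum.cartesian_product by (intro sum.cong) (auto simp: h_def)
  also have "\<dots> = (\<Sum>z\<in>I. pmf \<nu> (h z))"
    unfolding I_def using Y by (subst sum.inter_filter) auto
  also have "\<dots> = (\<Sum>x\<in>h ` I. pmf \<nu> x)"
    by (simp add: sum.reindex[OF inj])
  also have "\<dots> \<le> measure_pmf.prob \<nu> E"
    by (intro sum_pmf_le_prob) (use fin E in \<open>auto simp: I_def h_def\<close>)
  finally show ?thesis .
qed

section \<open>Product forms of the two systems\<close>

text \<open>Written with an indicator over all servers, the form in which
  \<open>oi_weight_service_balance\<close> takes its rate function; \<open>covered_rate_eq\<close>
  gives the usual reading.\<close>

definition covered_rate :: "('n::finite \<Rightarrow> real) \<Rightarrow> 'n set set \<Rightarrow> real" where
  "covered_rate \<mu> A = (\<Sum>n\<in>UNIV. \<mu> n * of_bool (\<exists>S\<in>A. n \<in> S))"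

lemma covered_rate_eq: "covered_rate \<mu> A = (\<Sum>n\<in>\<Union>A. \<mu> n)"
  unfolding covered_rate_def
  by (intro sum.mono_neutral_cong_right) auto

lemma covered_rate_empty [simp]: "covered_rate \<mu> {} = 0"
  by (simp add: covered_rate_eq)

lemma sum_event:
  "(\<Sum>e\<in>UNIV. f e) = (\<Sum>S\<in>UNIV. f (Arrival S)) + (\<Sum>n\<in>UNIV. f (Completion n))"
  for f :: "'n::finite event \<Rightarrow> real"
proof -
  have "(UNIV :: 'n event set) = range Arrival \<union> range Completion"
    by (auto, metis event.exhaust rangeI)
  then have "(\<Sum>e\<in>UNIV. f e) = (\<Sum>e\<in>range Arrival. f e) + (\<Sum>e\<in>range Completion. f e)"
    by (metis (no_types, lifting) sum.union_disjoint finite disjoint_iff event.distinct(1) rangeE)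
  then show ?thesis
    by (simp add: sum.reindex inj_on_def)
qed

text \<open>Adds up bounds on disjoint kinds of predecessors of one state.\<close>

lemma prob_vimage_sum:
  assumes "finite F" "\<And>x y. x \<in> F \<Longrightarrow> y \<in> F \<Longrightarrow> x \<noteq> y \<Longrightarrow> D x \<inter> D y = {}"
  shows "(\<Sum>x\<in>F. measure_pmf.prob \<nu> (E \<inter> D x)) \<le> measure_pmf.prob \<nu> E"
proof -
  have "(\<Sum>x\<in>F. measure_pmf.prob \<nu> (E \<inter> D x)) = measure_pmf.prob \<nu> (\<Union>x\<in>F. E \<inter> D x)"
    using assms by (intro measure_pmf.finite_measure_finite_Union[symmetric])
      (auto simp: disjoint_family_on_def)
  also have "\<dots> \<le> measure_pmf.prob \<nu> E"
    by (intro measure_pmf.finite_measure_mono) auto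
  finally show ?thesis .
qed

text \<open>
  Under cancel-on-start the waiting jobs and the idle servers form a Markov chain by themselves, since
  every busy server completes at its own speed.  The idle servers are an order-independent queue too,
  in which the job types play the role of the servers.
\<close>

primrec waiting_idle_step ::
    "'n set set \<Rightarrow> 'n event \<Rightarrow> 'n set list \<times> 'n list \<Rightarrow> 'n set list \<times> 'n list" where
  "waiting_idle_step \<S> (Arrival S) x =
     (case List.find (\<lambda>n. n \<in> S) (snd x) of
        None \<Rightarrow> (fst x @ [S], snd x)
      | Some n \<Rightarrow> (fst x, remove1 n (snd x)))"
| "waiting_idle_step \<S> (Completion n) x =
     (if n \<notin> \<Union>\<S> \<or> n \<in> set (snd x) then x
      else case List.extract (\<lambda>S. n \<in> S) (fst x) of
        None \<Rightarrow> (fst x, snd x @ [n])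
      | Some (before, S, after) \<Rightarrow> (before @ after, snd x))"

definition waiting_idle_states :: "'n set set \<Rightarrow> ('n set list \<times> 'n list) set" where
  "waiting_idle_states \<S> =
     {(c, u). c \<in> lists \<S> \<and> distinct u \<and> set u \<subseteq> \<Union>\<S> \<and> (\<forall>S\<in>set c. S \<inter> set u = {})}"

definition idle_rate :: "('n set \<Rightarrow> real) \<Rightarrow> 'n set set \<Rightarrow> 'n set \<Rightarrow> real" where
  "idle_rate a \<S> B = (\<Sum>S\<in>\<S>. a S * of_bool (\<exists>n\<in>B. n \<in> S))"

lemma find_first: "\<forall>y\<in>set xs. \<not> P y \<Longrightarrow> P x \<Longrightarrow> List.find P (xs @ x # ys) = Some x"
  by (induction xs) auto

context
  fixes \<mu> :: "'n::finite \<Rightarrow> real" and p :: "'n set \<Rightarrow> real" and \<S> :: "'n set set" and lam :: real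
  assumes \<mu>_pos: "\<And>n. \<mu> n > 0" and S_nonempty: "{} \<notin> \<S>" and p_pos: "\<And>S. S \<in> \<S> \<Longrightarrow> p S > 0"
    and lam_pos: "lam > 0"
begin

abbreviation arrival_rate :: "'n set \<Rightarrow> real" where
  "arrival_rate S \<equiv> real CARD('n) * lam * p S"

lemma covered_rate_pos: "S \<in> \<S> \<Longrightarrow> covered_rate \<mu> (insert S A) > 0"
  unfolding covered_rate_eq using S_nonempty \<mu>_pos
  by (intro sum_pos) (fastforce simp: Union_empty_conv)+

lemma arrival_rate_pos: "S \<in> \<S> \<Longrightarrow> arrival_rate S > 0"
  using p_pos lam_pos by simp

lemma event_rate_nonneg: "event_rate \<mu> p \<S> lam e \<ge> 0"
  using \<mu>_pos[THEN less_imp_le] arrival_rate_pos[THEN less_imp_le]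
  by (auto simp: event_rate_def split: event.split)

lemma sum_event_rate:
  "(\<Sum>e\<in>UNIV. event_rate \<mu> p \<S> lam e * f e) =
     (\<Sum>S\<in>\<S>. arrival_rate S * f (Arrival S)) + (\<Sum>n\<in>UNIV. \<mu> n * f (Completion n))"
proof -
  have "(\<Sum>S\<in>UNIV. event_rate \<mu> p \<S> lam (Arrival S) * f (Arrival S)) = (\<Sum>S\<in>\<S>. arrival_rate S * f (Arrival S))"
    by (rule sum.mono_neutral_cong_right) (auto simp: event_rate_def)
  then show ?thesis
    by (simp add: sum_event event_rate_def)
qed

lemma sum_event_rate_pos: "(\<Sum>e\<in>UNIV. event_rate \<mu> p \<S> lam e) > 0"
proof -
  have "(\<Sum>n\<in>UNIV. \<mu> n) > 0" by (intro sum_pos) (auto simp: \<mu>_pos)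
  moreover have "(\<Sum>S\<in>\<S>. arrival_rate S) \<ge> 0"
    using arrival_rate_pos[THEN less_imp_le] by (intro sum_nonneg)
  ultimately show ?thesis using sum_event_rate[of "\<lambda>_. 1"] by simp
qed

text \<open>The flows match in pairs. Arrivals enter \<open>c\<close> from the line without its last
  job, and the last factor of the weight turns this inflow into the outflow by effective
  completions. Effective completions enter \<open>c\<close> by the service balance and match the
  outflow by arrivals. Ineffective completions leave \<open>c\<close> fixed and account for the
  servers that no job in \<open>c\<close> can use.\<close>

lemma coc_product_form:
  fixes \<nu> :: "'n set list pmf"
  assumes \<nu>: "\<And>c. pmf \<nu> c = of_bool (c \<in> lists \<S>) * C * oi_weight arrival_rate (covered_rate \<mu>) c"
  shows "jump_law (event_rate \<mu> p \<S> lam) coc_step \<nu> = \<nu>"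
proof (rule jump_lawI[OF event_rate_nonneg sum_event_rate_pos])
  fix c assume "c \<in> set_pmf \<nu>"
  then have c: "c \<in> lists \<S>" using \<nu>[of c] by (auto simp: set_pmf_iff split: if_splits)
  let ?W = "oi_weight arrival_rate (covered_rate \<mu>)"
  let ?E = "\<lambda>e. coc_step e -` {c}"
  have nz: "S \<in> \<S> \<Longrightarrow> covered_rate \<mu> (insert S A) \<noteq> 0" for S A
    using covered_rate_pos[of S A] by simp
  have arr: "covered_rate \<mu> (set c) * pmf \<nu> c \<le> (\<Sum>S\<in>\<S>. arrival_rate S * measure_pmf.prob \<nu> (?E (Arrival S)))"
  proof (cases c rule: rev_cases)
    case Nil
    then show ?thesis
      using arrival_rate_pos[THEN less_imp_le] by (simp add: sum_nonneg mult_nonneg_nonneg[OF _ measure_nonneg] del: coc_step.simps)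
  next
    case (snoc d S)
    with c have S: "S \<in> \<S>" "d \<in> lists \<S>" by auto
    have "covered_rate \<mu> (set c) * pmf \<nu> c = arrival_rate S * pmf \<nu> d"
      using S nz[of S "set d"] by (simp add: snoc \<nu> oi_weight_snoc)
    also have "\<dots> \<le> arrival_rate S * measure_pmf.prob \<nu> (?E (Arrival S))"
      using sum_pmf_le_prob[of "{d}" "?E (Arrival S)" \<nu>] arrival_rate_pos[OF S(1)] snoc
      by (intro mult_left_mono) auto
    also have "\<dots> \<le> (\<Sum>S\<in>\<S>. arrival_rate S * measure_pmf.prob \<nu> (?E (Arrival S)))"
      using S arrival_rate_pos[THEN less_imp_le] by (intro member_le_sum) (auto intro: mult_nonneg_nonneg)
    finally show ?thesis .
  qed
  have "measure_pmf.prob \<nu> (?E (Completion n)) \<ge> of_bool (\<not> (\<exists>S\<in>set c. n \<in> S)) * pmf \<nu> c +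
      (\<Sum>S\<in>\<S>. \<Sum>i\<le>length c. of_bool (n \<in> S \<and> (\<forall>S\<in>set (take i c). n \<notin> S)) * pmf \<nu> (id (take i c @ S # drop i c)))"
    (is "_ \<ge> ?A + ?B") for n
  proof -
    \<comment> \<open>Self-loops and genuine predecessors are kept apart by whether the earlier
      state equals \<open>c\<close>; a genuine one is longer by one job.\<close>
    have "?A \<le> measure_pmf.prob \<nu> (?E (Completion n) \<inter> {c})"
    proof (cases "\<exists>S\<in>set c. n \<in> S")
      case False
      then have "List.extract (\<lambda>S. n \<in> S) c = None" by (simp add: extract_None_iff)
      then have "c \<in> ?E (Completion n)" by simp
      then show ?thesis
        using sum_pmf_le_prob[of "{c}" "?E (Completion n) \<inter> {c}" \<nu>] False by simp
    qed auto
    moreover have "?B \<le> measure_pmf.prob \<nu> (?E (Completion n) \<inter> - {c})"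
    proof (rule sum_first_insert_le_prob)
      fix i S assume *: "i \<le> length c" "S \<in> \<S>" "n \<in> S" "\<forall>S\<in>set (take i c). n \<notin> S"
      then have "List.extract (\<lambda>S. n \<in> S) (take i c @ S # drop i c) = Some (take i c, S, drop i c)"
        by (auto simp: extract_Some_iff)
      moreover have "length (take i c @ S # drop i c) \<noteq> length c" by simp
      ultimately show "id (take i c @ S # drop i c) \<in> ?E (Completion n) \<inter> - {c}"
        by (auto simp del: length_append)
    qed auto
    moreover have "measure_pmf.prob \<nu> (?E (Completion n) \<inter> {c}) + measure_pmf.prob \<nu> (?E (Completion n) \<inter> - {c})
        \<le> measure_pmf.prob \<nu> (?E (Completion n))"
      using prob_vimage_sum[of "{True, False}" "\<lambda>b. if b then {c} else - {c}" \<nu> "?E (Completion n)"]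
      by (simp split: if_splits)
    ultimately show ?thesis by linarith
  qed
  then have "(\<Sum>n\<in>UNIV. \<mu> n * measure_pmf.prob \<nu> (?E (Completion n))) \<ge>
      (\<Sum>n\<in>UNIV. \<mu> n * (of_bool (\<not> (\<exists>S\<in>set c. n \<in> S)) * pmf \<nu> c +
      (\<Sum>S\<in>\<S>. \<Sum>i\<le>length c. of_bool (n \<in> S \<and> (\<forall>S\<in>set (take i c). n \<notin> S)) * pmf \<nu> (id (take i c @ S # drop i c)))))"
    using \<mu>_pos[THEN less_imp_le] by (intro sum_mono mult_left_mono) auto
  also have "(\<Sum>n\<in>UNIV. \<mu> n * (of_bool (\<not> (\<exists>S\<in>set c. n \<in> S)) * pmf \<nu> c +
      (\<Sum>S\<in>\<S>. \<Sum>i\<le>length c. of_bool (n \<in> S \<and> (\<forall>S\<in>set (take i c). n \<notin> S)) * pmf \<nu> (id (take i c @ S # drop i c)))))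
     = (\<Sum>n\<in>UNIV. \<mu> n * of_bool (\<not> (\<exists>S\<in>set c. n \<in> S))) * pmf \<nu> c + C *
       (\<Sum>n\<in>UNIV. \<mu> n * (\<Sum>S\<in>\<S>. \<Sum>i\<le>length c.
          of_bool (n \<in> S \<and> (\<forall>S\<in>set (take i c). n \<notin> S)) * ?W (take i c @ S # drop i c)))"
  proof -
    have "pmf \<nu> (id (take i c @ S # drop i c)) = C * ?W (take i c @ S # drop i c)" if "S \<in> \<S>" for i S
      using that c \<nu>[of "take i c @ S # drop i c"] by (auto dest: in_set_takeD in_set_dropD)
    then have "(\<Sum>S\<in>\<S>. \<Sum>i\<le>length c. of_bool (n \<in> S \<and> (\<forall>S\<in>set (take i c). n \<notin> S)) * pmf \<nu> (id (take i c @ S # drop i c)))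
      = C * (\<Sum>S\<in>\<S>. \<Sum>i\<le>length c. of_bool (n \<in> S \<and> (\<forall>S\<in>set (take i c). n \<notin> S)) * ?W (take i c @ S # drop i c))" for n
      by (simp add: sum_distrib_left mult_ac del: sum_of_bool_mult_eq sum_mult_of_bool_eq)
    then show ?thesis
      by (simp add: distrib_left sum.distrib sum_distrib_left sum_distrib_right mult_ac del: sum_of_bool_mult_eq sum_mult_of_bool_eq)
  qed
  also have "(\<Sum>n\<in>UNIV. \<mu> n * of_bool (\<not> (\<exists>S\<in>set c. n \<in> S))) = (\<Sum>n\<in>UNIV. \<mu> n) - covered_rate \<mu> (set c)"
    unfolding covered_rate_def sum_subtractf[symmetric] by (intro sum.cong) auto
  also have "(\<Sum>n\<in>UNIV. \<mu> n * (\<Sum>S\<in>\<S>. \<Sum>i\<le>length c.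
          of_bool (n \<in> S \<and> (\<forall>S\<in>set (take i c). n \<notin> S)) * ?W (take i c @ S # drop i c))) = (\<Sum>S\<in>\<S>. arrival_rate S) * ?W c"
    by (rule oi_weight_service_balance[OF covered_rate_def]) (use nz c in auto)
  finally show "(\<Sum>e\<in>UNIV. event_rate \<mu> p \<S> lam e) * pmf \<nu> c
      \<le> (\<Sum>e\<in>UNIV. event_rate \<mu> p \<S> lam e * measure_pmf.prob \<nu> (?E e))"
    using arr c sum_event_rate[of "\<lambda>_. 1"] sum_event_rate[of "\<lambda>e. measure_pmf.prob \<nu> (?E e)"]
    by (simp add: \<nu> algebra_simps del: coc_step.simps)
qed

lemma idle_rate_pos:
  assumes "n \<in> \<Union>\<S>"
  shows "idle_rate arrival_rate \<S> (insert n B) > 0"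
proof -
  from assms obtain S where "S \<in> \<S>" "n \<in> S" by auto
  then show ?thesis
    unfolding idle_rate_def using arrival_rate_pos
    by (intro sum_pos2[of _ S]) (auto simp: less_imp_le simp del: mult_pos_pos)
qed

text \<open>Four kinds of moves balance in pairs: joining the line against starting a waiting job,
  and taking an idle server against becoming idle. \<open>oi_weight_service_balance\<close> is used
  twice, once with servers serving types and once with types serving idle servers.\<close>

lemma waiting_idle_product_form:
  fixes \<nu> :: "('n set list \<times> 'n list) pmf"
  assumes \<nu>: "\<And>c u. pmf \<nu> (c, u) = of_bool ((c, u) \<in> waiting_idle_states \<S>) * C *
                oi_weight arrival_rate (covered_rate \<mu>) c * oi_weight \<mu> (idle_rate arrival_rate \<S>) u"
  shows "jump_law (event_rate \<mu> p \<S> lam) (waiting_idle_step \<S>) \<nu> = \<nu>"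
proof (rule jump_lawI[OF event_rate_nonneg sum_event_rate_pos])
  fix y assume y: "y \<in> set_pmf \<nu>"
  obtain c u where cu: "y = (c, u)" by fastforce
  with y have valid: "(c, u) \<in> waiting_idle_states \<S>" using \<nu>[of c u] by (auto simp: set_pmf_iff split: if_splits)
  then have c: "c \<in> lists \<S>" and u: "distinct u" "set u \<subseteq> \<Union>\<S>" and disj: "\<And>S. S \<in> set c \<Longrightarrow> S \<inter> set u = {}"
    by (auto simp: waiting_idle_states_def)
  let ?W = "oi_weight arrival_rate (covered_rate \<mu>)" and ?G = "oi_weight \<mu> (idle_rate arrival_rate \<S>)"
  let ?E = "\<lambda>e. waiting_idle_step \<S> e -` {(c, u)}"
  define V where "V = C * ?W c * ?G u"
  have \<nu>V: "pmf \<nu> (c, u) = V" using valid by (simp add: \<nu> V_def)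
  \<comment> \<open>\<open>Y\<close> collects the servers that would become idle at their next
    completion, \<open>Z\<close> the types whose arrivals would join the line. Inserting a server of
    \<open>Y\<close> into \<open>u\<close> or a type of \<open>Z\<close> into \<open>c\<close> keeps
    the state valid.\<close>
  define Y where "Y = \<Union>\<S> - set u - \<Union>(set c)"
  define Z where "Z = {S \<in> \<S>. S \<inter> set u = {}}"
  have nz: "S \<in> \<S> \<Longrightarrow> covered_rate \<mu> (insert S A) \<noteq> 0" for S A
    using covered_rate_pos[of S A] by simp
  have nz': "n \<in> \<Union>\<S> \<Longrightarrow> idle_rate arrival_rate \<S> (insert n A) \<noteq> 0" for n A
    using idle_rate_pos[of n A] by simp

  \<comment> \<open>Inflow by an arrival that joins the line: its source is the line without its
    last job.\<close>
  define h where "h S = of_bool (c \<noteq> [] \<and> S = last c) * pmf \<nu> (butlast c, u)" for S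
  have "measure_pmf.prob \<nu> (?E (Arrival S)) \<ge> h S +
      (\<Sum>n\<in>Y. \<Sum>i\<le>length u. of_bool (n \<in> S \<and> (\<forall>n\<in>set (take i u). n \<notin> S)) * pmf \<nu> (Pair c (take i u @ n # drop i u)))"
    (is "_ \<ge> _ + ?B") if S: "S \<in> \<S>" for S
  proof -
    have "h S \<le> measure_pmf.prob \<nu> (?E (Arrival S) \<inter> {z. snd z = u})"
    proof (cases "c \<noteq> [] \<and> S = last c")
      case True
      then have "S \<inter> set u = {}" using disj by auto
      then have "List.find (\<lambda>n. n \<in> S) u = None" by (auto simp: find_None_iff)
      then show ?thesis
        using True sum_pmf_le_prob[of "{(butlast c, u)}" "?E (Arrival S) \<inter> {z. snd z = u}" \<nu>]
        by (auto simp: h_def)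
    qed (auto simp: h_def)
    moreover have "?B \<le> measure_pmf.prob \<nu> (?E (Arrival S) \<inter> {z. snd z \<noteq> u})"
    proof (rule sum_first_insert_le_prob)
      fix i n assume *: "i \<le> length u" "n \<in> Y" "n \<in> S" "\<forall>n\<in>set (take i u). n \<notin> S"
      then have "List.find (\<lambda>n. n \<in> S) (take i u @ n # drop i u) = Some n"
        by (intro find_first) auto
      moreover have "remove1 n (take i u @ n # drop i u) = u"
        using * by (auto simp: remove1_append)
      moreover have "take i u @ n # drop i u \<noteq> u"
        by (metis set_take_insert_drop insertI1 \<open>n \<in> Y\<close> Y_def Diff_iff)
      ultimately show "Pair c (take i u @ n # drop i u) \<in> ?E (Arrival S) \<inter> {z. snd z \<noteq> u}"
        by simp
    qed (auto simp: inj_def)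
    ultimately show ?thesis
      using prob_vimage_sum[of "{True, False}" "\<lambda>b. {z. (snd z = u) = b}" \<nu> "?E (Arrival S)"]
      by fastforce
  qed
  then have "(\<Sum>S\<in>\<S>. arrival_rate S * measure_pmf.prob \<nu> (?E (Arrival S))) \<ge> (\<Sum>S\<in>\<S>. arrival_rate S * (h S +
      (\<Sum>n\<in>Y. \<Sum>i\<le>length u. of_bool (n \<in> S \<and> (\<forall>n\<in>set (take i u). n \<notin> S)) * pmf \<nu> (Pair c (take i u @ n # drop i u)))))"
    using arrival_rate_pos[THEN less_imp_le] by (intro sum_mono mult_left_mono) auto
  also have "(\<Sum>S\<in>\<S>. arrival_rate S * (h S +
      (\<Sum>n\<in>Y. \<Sum>i\<le>length u. of_bool (n \<in> S \<and> (\<forall>n\<in>set (take i u). n \<notin> S)) * pmf \<nu> (Pair c (take i u @ n # drop i u)))))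
    = (\<Sum>S\<in>\<S>. arrival_rate S * h S) + C * ?W c * (\<Sum>S\<in>\<S>. arrival_rate S *
      (\<Sum>n\<in>Y. \<Sum>i\<le>length u. of_bool (n \<in> S \<and> (\<forall>n\<in>set (take i u). n \<notin> S)) * ?G (take i u @ n # drop i u)))"
  proof -
    have "pmf \<nu> (c, take i u @ n # drop i u) = C * ?W c * ?G (take i u @ n # drop i u)" if "n \<in> Y" for i n
    proof -
      have "distinct (take i u @ n # drop i u)"
        using u that by (auto simp: Y_def set_take_disj_set_drop_if_distinct dest: in_set_takeD in_set_dropD)
      then have "(c, take i u @ n # drop i u) \<in> waiting_idle_states \<S>"
        using that valid unfolding waiting_idle_states_def by (auto simp: Y_def set_take_insert_drop simp del: set_append)
      then show ?thesis by (simp add: \<nu>)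
    qed
    then show ?thesis
      by (simp add: distrib_left sum.distrib sum_distrib_left mult_ac del: sum_of_bool_mult_eq sum_mult_of_bool_eq)
  qed
  also have "(\<Sum>S\<in>\<S>. arrival_rate S *
      (\<Sum>n\<in>Y. \<Sum>i\<le>length u. of_bool (n \<in> S \<and> (\<forall>n\<in>set (take i u). n \<notin> S)) * ?G (take i u @ n # drop i u)))
      = (\<Sum>n\<in>Y. \<mu> n) * ?G u"
    by (rule oi_weight_service_balance[OF idle_rate_def]) (use u in \<open>intro nz', auto simp: Y_def\<close>)
  also have "(\<Sum>S\<in>\<S>. arrival_rate S * h S) = covered_rate \<mu> (set c) * V"
  proof (cases c rule: rev_cases)
    case (snoc d S)
    with c valid have S: "S \<in> \<S>" "(d, u) \<in> waiting_idle_states \<S>" by (auto simp: waiting_idle_states_def)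
    have "(\<Sum>S\<in>\<S>. arrival_rate S * h S) = arrival_rate S * h S"
      using S by (subst sum.mono_neutral_right[of _ "{S}"]) (auto simp: h_def snoc)
    also have "\<dots> = covered_rate \<mu> (set c) * V"
      using S nz[of S "set d"] by (simp add: snoc h_def V_def \<nu> oi_weight_snoc)
    finally show ?thesis .
  qed (simp add: h_def)
  finally have arr: "(\<Sum>S\<in>\<S>. arrival_rate S * measure_pmf.prob \<nu> (?E (Arrival S))) \<ge>
      covered_rate \<mu> (set c) * V + (\<Sum>n\<in>Y. \<mu> n) * V"
    by (simp add: V_def mult_ac del: waiting_idle_step.simps)

  \<comment> \<open>A server that becomes idle is put last in \<open>u\<close>, so the source of
    this inflow is \<open>butlast u\<close>.\<close>
  define k where "k n = of_bool (u \<noteq> [] \<and> n = last u) * pmf \<nu> (c, butlast u)" for n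
  have "measure_pmf.prob \<nu> (?E (Completion n)) \<ge> of_bool (n \<notin> \<Union>\<S> \<or> n \<in> set u) * pmf \<nu> (c, u) + k n +
      (\<Sum>S\<in>Z. \<Sum>i\<le>length c. of_bool (n \<in> S \<and> (\<forall>S\<in>set (take i c). n \<notin> S)) * pmf \<nu> ((\<lambda>c. (c, u)) (take i c @ S # drop i c)))"
    (is "_ \<ge> ?A + _ + ?B") for n
  proof -
    \<comment> \<open>Disjoint kinds of sources: 0 for self-loops, 1 for a changed list of idle
      servers, 2 for a changed line.\<close>
    let ?D = "\<lambda>i::nat. if i = 0 then {(c, u)} else if i = 1 then {z. snd z \<noteq> u} else {z. snd z = u \<and> fst z \<noteq> c}"
    have "?A \<le> measure_pmf.prob \<nu> (?E (Completion n) \<inter> ?D 0)"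
      using sum_pmf_le_prob[of "{(c, u)}" "?E (Completion n) \<inter> ?D 0" \<nu>] by auto
    moreover have "k n \<le> measure_pmf.prob \<nu> (?E (Completion n) \<inter> ?D (Suc 0))"
    proof (cases "u \<noteq> [] \<and> n = last u")
      case True
      then have un: "u = butlast u @ [n]" by simp
      then have "n \<notin> set (butlast u)" using u(1) by (metis distinct_append disjoint_iff list.set_intros(1))
      moreover have "n \<in> \<Union>\<S>" "\<forall>S\<in>set c. n \<notin> S" using True u(2) disj by (auto dest: last_in_set)
      moreover have "butlast u \<noteq> u" using un by (metis append_self_conv not_Cons_self2)
      ultimately have "(c, butlast u) \<in> ?E (Completion n) \<inter> ?D (Suc 0)"
        using un by (auto simp: extract_None_iff[THEN iffD2])
      then show ?thesis
        using True sum_pmf_le_prob[of "{(c, butlast u)}" "?E (Completion n) \<inter> ?D (Suc 0)" \<nu>]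
        by (auto simp: k_def)
    qed (auto simp: k_def)
    moreover have "?B \<le> measure_pmf.prob \<nu> (?E (Completion n) \<inter> ?D 2)"
    proof (rule sum_first_insert_le_prob)
      fix i S assume *: "i \<le> length c" "S \<in> Z" "n \<in> S" "\<forall>S\<in>set (take i c). n \<notin> S"
      then have "List.extract (\<lambda>S. n \<in> S) (take i c @ S # drop i c) = Some (take i c, S, drop i c)"
        by (auto simp: extract_Some_iff)
      moreover have "take i c @ S # drop i c \<noteq> c"
        by (metis append_take_drop_id same_append_eq not_Cons_self)
      moreover have "n \<in> \<Union>\<S>" "n \<notin> set u" using * by (auto simp: Z_def)
      ultimately show "(take i c @ S # drop i c, u) \<in> ?E (Completion n) \<inter> ?D 2"
        by (auto simp del: length_append)
    qed (auto simp: inj_def)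
    moreover have "(\<Sum>i\<in>{0, Suc 0, 2}. measure_pmf.prob \<nu> (?E (Completion n) \<inter> ?D i)) \<le> measure_pmf.prob \<nu> (?E (Completion n))"
      by (rule prob_vimage_sum) auto
    ultimately show ?thesis
      by simp
  qed
  then have "(\<Sum>n\<in>UNIV. \<mu> n * measure_pmf.prob \<nu> (?E (Completion n))) \<ge> (\<Sum>n\<in>UNIV. \<mu> n * (
      of_bool (n \<notin> \<Union>\<S> \<or> n \<in> set u) * pmf \<nu> (c, u) + k n +
      (\<Sum>S\<in>Z. \<Sum>i\<le>length c. of_bool (n \<in> S \<and> (\<forall>S\<in>set (take i c). n \<notin> S)) * pmf \<nu> ((\<lambda>c. (c, u)) (take i c @ S # drop i c)))))"
    using \<mu>_pos[THEN less_imp_le] by (intro sum_mono mult_left_mono) auto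
  also have "(\<Sum>n\<in>UNIV. \<mu> n * (of_bool (n \<notin> \<Union>\<S> \<or> n \<in> set u) * pmf \<nu> (c, u) + k n +
      (\<Sum>S\<in>Z. \<Sum>i\<le>length c. of_bool (n \<in> S \<and> (\<forall>S\<in>set (take i c). n \<notin> S)) * pmf \<nu> ((\<lambda>c. (c, u)) (take i c @ S # drop i c)))))
     = (\<Sum>n\<in>UNIV. \<mu> n * of_bool (n \<notin> \<Union>\<S> \<or> n \<in> set u)) * V + (\<Sum>n\<in>UNIV. \<mu> n * k n) + C * ?G u *
       (\<Sum>n\<in>UNIV. \<mu> n * (\<Sum>S\<in>Z. \<Sum>i\<le>length c.
          of_bool (n \<in> S \<and> (\<forall>S\<in>set (take i c). n \<notin> S)) * ?W (take i c @ S # drop i c)))"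
  proof -
    have "pmf \<nu> (take i c @ S # drop i c, u) = C * ?G u * ?W (take i c @ S # drop i c)" if "S \<in> Z" for i S
    proof -
      have "(take i c @ S # drop i c, u) \<in> waiting_idle_states \<S>"
        using that valid unfolding waiting_idle_states_def in_lists_conv_set case_prod_conv mem_Collect_eq set_take_insert_drop
        by (auto simp: Z_def)
      then show ?thesis by (simp add: \<nu>)
    qed
    then show ?thesis
      by (simp add: distrib_left sum.distrib sum_distrib_left sum_distrib_right \<nu>V mult_ac del: sum_of_bool_mult_eq sum_mult_of_bool_eq)
  qed
  also have "(\<Sum>n\<in>UNIV. \<mu> n * k n) = idle_rate arrival_rate \<S> (set u) * V"
  proof (cases u rule: rev_cases)
    case (snoc v n)
    with u valid have n: "n \<in> \<Union>\<S>" "(c, v) \<in> waiting_idle_states \<S>" by (auto simp: waiting_idle_states_def)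
    have "(\<Sum>n\<in>UNIV. \<mu> n * k n) = \<mu> n * k n"
      by (subst sum.mono_neutral_right[of _ "{n}"]) (auto simp: k_def snoc)
    also have "\<dots> = idle_rate arrival_rate \<S> (set u) * V"
      using n nz'[OF n(1), of "set v"] by (simp add: snoc k_def V_def \<nu> oi_weight_snoc)
    finally show ?thesis .
  qed (simp add: k_def idle_rate_def)
  also have "(\<Sum>n\<in>UNIV. \<mu> n * (\<Sum>S\<in>Z. \<Sum>i\<le>length c.
          of_bool (n \<in> S \<and> (\<forall>S\<in>set (take i c). n \<notin> S)) * ?W (take i c @ S # drop i c))) = (\<Sum>S\<in>Z. arrival_rate S) * ?W c"
    by (rule oi_weight_service_balance[OF covered_rate_def]) (use nz c in \<open>auto simp: Z_def\<close>)
  finally have comp: "(\<Sum>n\<in>UNIV. \<mu> n * measure_pmf.prob \<nu> (?E (Completion n))) \<ge>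
      (\<Sum>n\<in>UNIV. \<mu> n * of_bool (n \<notin> \<Union>\<S> \<or> n \<in> set u)) * V + idle_rate arrival_rate \<S> (set u) * V + (\<Sum>S\<in>Z. arrival_rate S) * V"
    by (simp add: V_def mult_ac del: waiting_idle_step.simps)

  \<comment> \<open>Compatibility of \<open>c\<close> and \<open>u\<close> makes this a partition: a
    server is usable by a waiting job, or belongs to \<open>Y\<close>, or is idle or outside
    \<open>\<Union>\<S>\<close>.\<close>
  have "(\<Sum>n\<in>Y. \<mu> n) = (\<Sum>n\<in>UNIV. \<mu> n * of_bool (n \<in> Y))"
    by (rule sum.mono_neutral_cong_left) auto
  then have \<mu>_split: "covered_rate \<mu> (set c) + (\<Sum>n\<in>Y. \<mu> n) + (\<Sum>n\<in>UNIV. \<mu> n * of_bool (n \<notin> \<Union>\<S> \<or> n \<in> set u)) = (\<Sum>n\<in>UNIV. \<mu> n)"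
    unfolding covered_rate_def using c disj
    by (simp only: sum.distrib[symmetric]) (intro sum.cong refl, auto simp: Y_def)
  have "(\<Sum>S\<in>Z. arrival_rate S) = (\<Sum>S\<in>\<S>. arrival_rate S * of_bool (S \<in> Z))"
    by (rule sum.mono_neutral_cong_left) (auto simp: Z_def)
  then have a_split: "idle_rate arrival_rate \<S> (set u) + (\<Sum>S\<in>Z. arrival_rate S) = (\<Sum>S\<in>\<S>. arrival_rate S)"
    unfolding idle_rate_def
    by (simp only: sum.distrib[symmetric]) (intro sum.cong refl, auto simp: Z_def)
  have "(\<Sum>e\<in>UNIV. event_rate \<mu> p \<S> lam e) * pmf \<nu> y = ((\<Sum>S\<in>\<S>. arrival_rate S) + (\<Sum>n\<in>UNIV. \<mu> n)) * V"
    using sum_event_rate[of "\<lambda>_. 1"] by (simp add: cu \<nu>V)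
  also have "\<dots> \<le> (\<Sum>S\<in>\<S>. arrival_rate S * measure_pmf.prob \<nu> (?E (Arrival S)))
      + (\<Sum>n\<in>UNIV. \<mu> n * measure_pmf.prob \<nu> (?E (Completion n)))"
    using arr comp unfolding \<mu>_split[symmetric] a_split[symmetric] by (simp only: distrib_right)
  also have "\<dots> = (\<Sum>e\<in>UNIV. event_rate \<mu> p \<S> lam e * measure_pmf.prob \<nu> (?E e))"
    by (simp add: sum_event_rate)
  finally show "(\<Sum>e\<in>UNIV. event_rate \<mu> p \<S> lam e) * pmf \<nu> y
      \<le> (\<Sum>e\<in>UNIV. event_rate \<mu> p \<S> lam e * measure_pmf.prob \<nu> (waiting_idle_step \<S> e -` {y}))"
    by (simp add: cu)
qed

end

section \<open>Identification of the stationary laws\<close>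

context
  fixes \<mu> :: "'n::finite \<Rightarrow> real" and p :: "'n set \<Rightarrow> real" and \<S> :: "'n set set" and lam :: real
  assumes \<mu>_pos: "\<And>n. \<mu> n > 0" and S_nonempty: "{} \<notin> \<S>" and p_pos: "\<And>S. S \<in> \<S> \<Longrightarrow> p S > 0"
    and lam_pos: "lam > 0"
begin

lemma event_rate_facts:
  "event_rate \<mu> p \<S> lam e \<ge> 0" "(\<Sum>e\<in>UNIV. event_rate \<mu> p \<S> lam e) > 0"
  by (rule event_rate_nonneg[where \<mu>=\<mu> and p=p and \<S>=\<S> and lam=lam] sum_event_rate_pos[where \<mu>=\<mu> and p=p and \<S>=\<S> and lam=lam],
      fact+)+

lemma event_rate_positive:
  "event_rate \<mu> p \<S> lam (Completion n) > 0"
  "S \<in> \<S> \<Longrightarrow> event_rate \<mu> p \<S> lam (Arrival S) > 0"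
  using \<mu>_pos p_pos lam_pos by (auto simp: event_rate_def)

text \<open>A completion at any server of the first job removes exactly that job, so potential
  completions empty the system.\<close>

lemma coc_reaches_empty:
  assumes "c \<in> A" "c \<in> lists \<S>"
    and closed: "\<And>e y. y \<in> A \<Longrightarrow> event_rate \<mu> p \<S> lam e > 0 \<Longrightarrow> coc_step e y \<in> A"
  shows "[] \<in> A"
  using assms(1,2)
proof (induction c)
  case (Cons S c)
  with S_nonempty obtain n where "n \<in> S" by (cases "S = {}") auto
  then have "coc_step (Completion n) (S # c) = c" by (simp add: extract_Cons_code)
  with closed[OF Cons.prems(1) event_rate_positive(1)[of n]] Cons show ?case by simp
qed

text \<open>\<open>C\<close> is left free: any law proportional to the weights is the stationary
  one, whatever its normalizing constant.\<close>

lemma coc_stationary_eq: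
  assumes "coc_stationary \<mu> p \<S> lam \<pi>"
    and \<nu>: "\<And>c. pmf \<nu> c = of_bool (c \<in> lists \<S>) * C *
              oi_weight (\<lambda>S. real CARD('n) * lam * p S) (covered_rate \<mu>) c"
  shows "\<pi> = \<nu>"
proof (rule jump_law_unique[OF event_rate_facts, where states = "lists \<S>" and ?x0.0 = "[]"])
  show "jump_law (event_rate \<mu> p \<S> lam) coc_step \<pi> = \<pi>"
    using stationary_law_imp_jump_law[OF event_rate_facts] assms(1) unfolding coc_stationary_def by blast
  show "jump_law (event_rate \<mu> p \<S> lam) coc_step \<nu> = \<nu>"
    by (rule coc_product_form[OF \<mu>_pos S_nonempty p_pos lam_pos \<nu>])
  show "set_pmf \<pi> \<subseteq> lists \<S>"
    using assms(1) by (simp add: coc_stationary_def stationary_law_def)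
  show "set_pmf \<nu> \<subseteq> lists \<S>"
    by (auto simp only: set_pmf_iff \<nu> split: if_splits) auto
qed (use coc_reaches_empty in blast)

abbreviation wi_step where "wi_step \<equiv> waiting_idle_step \<S>"

text \<open>In a valid state a server has no job exactly when it is listed as idle or lies outside
  \<open>\<Union>\<S>\<close>; this lets \<open>waiting_idle_step\<close> recognize busy servers
  without looking at \<open>serving\<close>.\<close>

lemma waiting_idle_step_eq:
  assumes x: "x \<in> cos_states \<S>"
  shows "(waiting (cos_step e x), idle (cos_step e x)) = wi_step e (waiting x, idle x)"
proof (cases e)
  case (Arrival S)
  then show ?thesis by (auto split: option.split)
next
  case (Completion n)
  have "serving x n = None \<longleftrightarrow> n \<notin> \<Union>\<S> \<or> n \<in> set (idle x)"
  proof (cases "serving x n")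
    case (Some S)
    then have "S \<in> \<S> \<and> n \<in> S" "n \<notin> set (idle x)" using x by (auto simp: cos_states_def)
    with Some show ?thesis by auto
  qed (use x in \<open>auto simp: cos_states_def\<close>)
  then show ?thesis using Completion by (auto split: option.split)
qed

text \<open>
  Completions empty the waiting line, arrivals then make every server busy, and completing at the
  servers one after the other makes them idle in a prescribed order.
\<close>

lemma waiting_idle_reaches:
  assumes "(c, u) \<in> A" "(c, u) \<in> waiting_idle_states \<S>"
    and closed: "\<And>e y. y \<in> A \<Longrightarrow> event_rate \<mu> p \<S> lam e > 0 \<Longrightarrow> wi_step e y \<in> A"
    and ord: "distinct us" "set us = \<Union>\<S>"
  shows "([], us) \<in> A"
proof -
  have "([], u) \<in> A"
    using assms(1,2)
  proof (induction c)
    case (Cons S c)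
    then have "S \<noteq> {}" using S_nonempty by (auto simp: waiting_idle_states_def)
    then obtain n where n: "n \<in> S" by auto
    with Cons.prems have "n \<in> \<Union>\<S>" "n \<notin> set u" by (auto simp: waiting_idle_states_def)
    with n have "wi_step (Completion n) (S # c, u) = (c, u)" by (simp add: extract_Cons_code)
    with closed[OF Cons.prems(1) event_rate_positive(1)[of n]] Cons show ?case
      by (simp add: waiting_idle_states_def)
  qed
  moreover have "set u \<subseteq> \<Union>\<S>" using assms(2) by (simp add: waiting_idle_states_def)
  ultimately have "([], []) \<in> A"
  proof (induction u)
    case (Cons n u)
    then obtain S where "S \<in> \<S>" "n \<in> S" by auto
    then have "wi_step (Arrival S) ([], n # u) = ([], u)" by simp
    with closed[OF Cons.prems(1) event_rate_positive(2)[OF \<open>S \<in> \<S>\<close>]] Cons show ?case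
      by (simp del: waiting_idle_step.simps)
  qed
  then have "distinct v \<Longrightarrow> set v \<subseteq> \<Union>\<S> \<Longrightarrow> ([], v) \<in> A" for v
  proof (induction v rule: rev_induct)
    case (snoc n v)
    then have "wi_step (Completion n) ([], v) = ([], v @ [n])" by (auto simp: extract_Nil_code)
    with closed[OF _ event_rate_positive(1)[of n], of "([], v)"] snoc show ?case
      by (simp del: waiting_idle_step.simps)
  qed
  with ord show ?thesis by simp
qed

text \<open>The reference state is the empty line with all servers of \<open>\<Union>\<S>\<close>
  idle in an order \<open>us\<close>, arbitrary but fixed: different orders of idle servers are
  different states.\<close>

lemma cos_stationary_map_eq:
  assumes st: "cos_stationary \<mu> p \<S> lam \<pi>"
    and \<nu>: "\<And>c u. pmf \<nu> (c, u) = of_bool ((c, u) \<in> waiting_idle_states \<S>) * C *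
                oi_weight (\<lambda>S. real CARD('n) * lam * p S) (covered_rate \<mu>) c * oi_weight \<mu> (idle_rate (\<lambda>S. real CARD('n) * lam * p S) \<S>) u"
  shows "map_pmf (\<lambda>x. (waiting x, idle x)) \<pi> = \<nu>"
proof -
  have supp: "set_pmf \<pi> \<subseteq> cos_states \<S>"
    using st by (simp add: cos_stationary_def stationary_law_def)
  obtain us where ord: "distinct us" "set us = \<Union>\<S>"
    using finite_distinct_list[of "\<Union>\<S>"] by auto
  have "jump_law (event_rate \<mu> p \<S> lam) cos_step \<pi> = \<pi>"
    using stationary_law_imp_jump_law[OF event_rate_facts] st unfolding cos_stationary_def by blast
  then have "jump_law (event_rate \<mu> p \<S> lam) wi_step (map_pmf (\<lambda>x. (waiting x, idle x)) \<pi>)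
      = map_pmf (\<lambda>x. (waiting x, idle x)) \<pi>"
    by (rule jump_law_map) (use supp waiting_idle_step_eq in auto)
  then show ?thesis
  proof (rule jump_law_unique[OF event_rate_facts, where states = "waiting_idle_states \<S>" and ?x0.0 = "([], us)"])
    show "jump_law (event_rate \<mu> p \<S> lam) wi_step \<nu> = \<nu>"
      by (rule waiting_idle_product_form[OF \<mu>_pos S_nonempty p_pos lam_pos \<nu>])
    show "set_pmf (map_pmf (\<lambda>x. (waiting x, idle x)) \<pi>) \<subseteq> waiting_idle_states \<S>"
      using supp by (auto simp: cos_states_def waiting_idle_states_def)
    show "set_pmf \<nu> \<subseteq> waiting_idle_states \<S>"
      by (auto simp only: set_pmf_iff \<nu> split: if_splits) auto
  qed (use waiting_idle_reaches ord in auto)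
qed

end

section \<open>Summation over the orders of first appearance\<close>

lemma sum_prod_list_length:
  fixes f :: "'a \<Rightarrow> real"
  assumes "finite B"
  shows "(\<Sum>w | set w \<subseteq> B \<and> length w = n. prod_list (map f w)) = (\<Sum>x\<in>B. f x) ^ n"
proof (induction n)
  case 0
  have "{w. set w \<subseteq> B \<and> w = []} = {[]}" by auto
  then show ?case by simp
next
  case (Suc n)
  let ?L = "{w. set w \<subseteq> B \<and> length w = n}"
  have "{w. set w \<subseteq> B \<and> length w = Suc n} = (\<lambda>(x, w). x # w) ` (B \<times> ?L)"
    by (auto simp: length_Suc_conv image_iff)
  moreover have "inj_on (\<lambda>(x, w). x # w) (B \<times> ?L)" by (auto simp: inj_on_def)
  ultimately have "(\<Sum>w | set w \<subseteq> B \<and> length w = Suc n. prod_list (map f w))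
      = (\<Sum>(x, w)\<in>B \<times> ?L. f x * prod_list (map f w))"
    by (simp only: sum.reindex) (auto intro: sum.cong)
  also have "\<dots> = (\<Sum>x\<in>B. f x) * (\<Sum>w\<in>?L. prod_list (map f w))"
    by (simp add: sum_product sum.cartesian_product)
  finally show ?case using Suc by simp
qed

text \<open>Grouping the words by length turns the sum into a geometric series.\<close>

lemma has_sum_prod_list:
  fixes f :: "'a \<Rightarrow> real"
  assumes "finite B" and nn: "\<And>x. x \<in> B \<Longrightarrow> f x \<ge> 0" and less: "(\<Sum>x\<in>B. f x) < 1"
  shows "((\<lambda>w. prod_list (map f w)) has_sum (1 / (1 - (\<Sum>x\<in>B. f x)))) (lists B)"
proof -
  let ?L = "\<lambda>n. {w. set w \<subseteq> B \<and> length w = n}" and ?q = "\<Sum>x\<in>B. f x"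
  have q: "0 \<le> ?q" using nn by (intro sum_nonneg)
  have inner: "((\<lambda>w. prod_list (map f (snd (n, w)))) has_sum ?q ^ n) (?L n)" for n
    using has_sum_finiteI[OF finite_lists_length_eq[OF assms(1), of n], of "?q ^ n" "\<lambda>w. prod_list (map f w)"]
      sum_prod_list_length[OF assms(1), of f n] by simp
  have outer: "((\<lambda>n. ?q ^ n) has_sum (1 / (1 - ?q))) UNIV"
    using geometric_sums[of ?q] q less by (intro norm_summable_imp_has_sum) (auto simp: summable_geometric)
  have pl: "prod_list (map f w) \<ge> 0" if "set w \<subseteq> B" for w
    using that nn by (intro prod_list_nonneg) auto
  have "((\<lambda>z. prod_list (map f (snd z))) has_sum (1 / (1 - ?q))) (Sigma UNIV ?L)"
    by (intro has_sum_SigmaI[OF inner outer] summable_on_SigmaI[OF inner])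
       (use outer pl in \<open>auto dest: has_sum_imp_summable\<close>)
  also have "?this \<longleftrightarrow> ?thesis"
    by (rule has_sum_reindex_bij_witness[of _ "\<lambda>w. (length w, w)" snd]) auto
  finally show ?thesis .
qed

lemma has_sum_times_nonneg:
  fixes f :: "'a \<Rightarrow> real" and g :: "'b \<Rightarrow> real"
  assumes f: "(f has_sum a) A" and g: "(g has_sum b) B"
    and nn: "\<And>x. x \<in> A \<Longrightarrow> f x \<ge> 0" "\<And>y. y \<in> B \<Longrightarrow> g y \<ge> 0"
  shows "((\<lambda>(x, y). f x * g y) has_sum (a * b)) (A \<times> B)"
proof -
  have inner: "((\<lambda>y. (\<lambda>(x, y). f x * g y) (x, y)) has_sum f x * b) B" for x
    using has_sum_cmult_right[OF g] by simp
  have outer: "((\<lambda>x. f x * b) has_sum (a * b)) A"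
    using has_sum_cmult_left[OF f] by simp
  show ?thesis
    by (intro has_sum_SigmaI[OF inner outer] summable_on_SigmaI[OF inner])
       (use outer nn in \<open>auto dest: has_sum_imp_summable\<close>)
qed

text \<open>\<open>remdups\<close> keeps the last copy of every entry; the two reversals make it the
  first.\<close>

definition first_order :: "'a list \<Rightarrow> 'a list" where
  "first_order c = rev (remdups (rev c))"

lemma first_order_simps [simp]:
  "first_order [] = []"
  "first_order (c @ [x]) = (if x \<in> set c then first_order c else first_order c @ [x])"
  by (simp_all add: first_order_def)

lemma set_first_order [simp]: "set (first_order c) = set c"
  and distinct_first_order [simp]: "distinct (first_order c)"
  by (simp_all add: first_order_def)

lemma first_order_append_subset: "set w \<subseteq> set c \<Longrightarrow> first_order (c @ w) = first_order c"
  by (induction w rule: rev_induct) (auto simp flip: append_assoc)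

text \<open>The line is cut at the first occurrence of the last new type \<open>t\<close>: before it
  stands a line with order \<open>T\<close>, after it an arbitrary word over the types already
  seen.\<close>

lemma first_order_eq_snoc:
  "{c. first_order c = T @ [t]} =
     (\<lambda>(d, w). d @ t # w) ` ({d. first_order d = T} \<times> lists (insert t (set T)))"
  if "t \<notin> set T"
proof (intro equalityI subsetI)
  fix c assume "c \<in> {c. first_order c = T @ [t]}"
  then have "first_order c = T @ [t]" by simp
  then show "c \<in> (\<lambda>(d, w). d @ t # w) ` ({d. first_order d = T} \<times> lists (insert t (set T)))"
  proof (induction c rule: rev_induct)
    case (snoc x c)
    show ?case
    proof (cases "x \<in> set c")
      case True
      with snoc obtain d w where "c = d @ t # w" "first_order d = T" "w \<in> lists (insert t (set T))" by auto
      moreover have "x \<in> insert t (set T)"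
        using True snoc.prems set_first_order[of c] by (auto simp del: set_first_order)
      ultimately show ?thesis by (intro image_eqI[of _ _ "(d, w @ [x])"]) auto
    next
      case False
      with snoc.prems show ?thesis by (intro image_eqI[of _ _ "(c, [])"]) auto
    qed
  qed simp
next
  have "first_order (d @ t # w) = T @ [t]" if d: "first_order d = T" and w: "set w \<subseteq> insert t (set T)" for d w
  proof -
    have "set d = set T" using d by auto
    then show ?thesis
      using first_order_append_subset[of w "d @ [t]"] d w \<open>t \<notin> set T\<close> by simp
  qed
  then show "c \<in> {c. first_order c = T @ [t]}"
    if "c \<in> (\<lambda>(d, w). d @ t # w) ` ({d. first_order d = T} \<times> lists (insert t (set T)))" for c
    using that by (auto simp: subset_iff)
qed

text \<open>No new type appears in \<open>w\<close>, so the service rate stays at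
  \<open>m (set d)\<close> and the order of \<open>w\<close> is immaterial.\<close>

lemma oi_weight_append:
  assumes "set w \<subseteq> set d"
  shows "oi_weight a m (d @ w) = oi_weight a m d * prod_list (map (\<lambda>x. a x / m (set d)) w)"
  using assms
proof (induction w rule: rev_induct)
  case (snoc x w)
  then have "insert x (set (d @ w)) = set d" by auto
  with snoc show ?case
    using oi_weight_snoc[of a m "d @ w" x] by simp
qed simp

text \<open>Geometric series: between two first appearances the types seen so far occur in any order.\<close>

definition order_factor :: "('x \<Rightarrow> real) \<Rightarrow> ('x set \<Rightarrow> real) \<Rightarrow> 'x set \<Rightarrow> 'x \<Rightarrow> real" where
  "order_factor a m A x =
     a x / m (insert x A) * (1 / (1 - (\<Sum>y\<in>insert x A. a y) / m (insert x A)))"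

lemma oi_weight_has_sum_first_order:
  assumes "distinct T"
    and nn: "\<And>x. x \<in> set T \<Longrightarrow> a x \<ge> 0"
    and m0: "m {} = 0" and less: "\<And>A. A \<noteq> {} \<Longrightarrow> A \<subseteq> set T \<Longrightarrow> m A > 0 \<and> (\<Sum>y\<in>A. a y) < m A"
  shows "(oi_weight a m has_sum prefix_prod (order_factor a m) {} T) {c. first_order c = T}"
  using assms
proof (induction T rule: rev_induct)
  case Nil
  have "{c. first_order c = []} = {[] :: 'a list}"
    by (auto simp: first_order_def)
  then show ?case by (simp add: has_sum_finite_iff)
next
  case (snoc t T)
  define B where "B = insert t (set T)"
  have B: "finite B" "B \<noteq> {}" "B \<subseteq> set (T @ [t])" by (auto simp: B_def)
  have mB: "m B > 0" "(\<Sum>y\<in>B. a y) < m B" using snoc.prems(4)[OF B(2,3)] by auto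
  let ?f = "\<lambda>x. a x / m B"
  have q: "(\<Sum>x\<in>B. ?f x) < 1" using mB by (simp add: sum_divide_distrib[symmetric])
  have nn': "x \<in> B \<Longrightarrow> ?f x \<ge> 0" for x using snoc.prems(2) mB B by (auto intro!: divide_nonneg_pos)
  have IH: "(oi_weight a m has_sum prefix_prod (order_factor a m) {} T) {c. first_order c = T}"
    using snoc by auto
  have nnw: "oi_weight a m d \<ge> 0" if "first_order d = T" for d
  proof (rule oi_weight_nonneg)
    have d: "set d = set T" using that by auto
    then show "a x \<ge> 0" if "x \<in> set d" for x using that snoc.prems(2) by simp
    show "m A \<ge> 0" if "A \<subseteq> set d" for A
      using snoc.prems(4)[of A] that d m0 by (cases "A = {}") fastforce+
  qed
  have "((\<lambda>(d, w). (oi_weight a m d * ?f t) * prod_list (map ?f w)) has_sum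
      ((prefix_prod (order_factor a m) {} T * ?f t) * (1 / (1 - (\<Sum>x\<in>B. ?f x))))) ({c. first_order c = T} \<times> lists B)"
  proof (intro has_sum_times_nonneg has_sum_cmult_left IH has_sum_prod_list nn' q B)
    show "oi_weight a m d * ?f t \<ge> 0" if "d \<in> {c. first_order c = T}" for d
      using that nnw[of d] nn'[of t] by (intro mult_nonneg_nonneg) (auto simp: B_def)
    show "prod_list (map ?f w) \<ge> 0" if "w \<in> lists B" for w
      using that nn' by (intro prod_list_nonneg) (auto simp: in_lists_conv_set)
  qed auto
  also have "?this \<longleftrightarrow> ((\<lambda>z. oi_weight a m (case z of (d, w) \<Rightarrow> d @ t # w)) has_sum
      ((prefix_prod (order_factor a m) {} T * ?f t) * (1 / (1 - (\<Sum>x\<in>B. ?f x))))) ({c. first_order c = T} \<times> lists B)"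
  proof (rule has_sum_cong)
    fix z assume "z \<in> {c. first_order c = T} \<times> lists B"
    then obtain d w where z: "z = (d, w)" "first_order d = T" "set w \<subseteq> B" by auto
    then have "set (d @ [t]) = B" by (auto simp: B_def)
    with z show "(case z of (d, w) \<Rightarrow> (oi_weight a m d * ?f t) * prod_list (map ?f w))
        = oi_weight a m (case z of (d, w) \<Rightarrow> d @ t # w)"
      using oi_weight_append[of w "d @ [t]" a m] oi_weight_snoc[of a m d t] by simp
  qed
  also have "\<dots> \<longleftrightarrow> (oi_weight a m has_sum
      ((prefix_prod (order_factor a m) {} T * ?f t) * (1 / (1 - (\<Sum>x\<in>B. ?f x))))) {c. first_order c = T @ [t]}"
  proof -
    have "t \<notin> set T" using snoc.prems(1) by simp
    \<comment> \<open>The first occurrence of \<open>t\<close> marks the cut, so \<open>d\<close> is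
      recovered as what precedes it.\<close>
    moreover have "inj_on (\<lambda>(d, w). d @ t # w) ({d. first_order d = T} \<times> lists B)"
    proof (rule inj_onI, clarsimp)
      fix d w d' w' assume *: "T = first_order d" "first_order d' = first_order d" "d @ t # w = d' @ t # w'"
      then have t: "t \<notin> set d" "t \<notin> set d'" using \<open>t \<notin> set T\<close> by (metis set_first_order)+
      have "takeWhile (\<lambda>x. x \<noteq> t) (e @ t # v) = e" if "t \<notin> set e" for e v
        using that by (induction e) auto
      from this[OF t(1), of w] this[OF t(2), of w'] *(3) show "d = d' \<and> w = w'" by simp
    qed
    ultimately show ?thesis
      unfolding first_order_eq_snoc[OF \<open>t \<notin> set T\<close>] B_def[symmetric]
      by (subst has_sum_reindex) (simp_all add: o_def)
  qed
  finally have "(oi_weight a m has_sum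
      ((prefix_prod (order_factor a m) {} T * ?f t) * (1 / (1 - (\<Sum>x\<in>B. ?f x))))) {c. first_order c = T @ [t]}" .
  moreover have "order_factor a m (set T) t = ?f t * (1 / (1 - (\<Sum>x\<in>B. ?f x)))"
    by (simp add: order_factor_def B_def sum_divide_distrib)
  ultimately show ?case
    by (simp add: prefix_prod_append mult.assoc)
qed

text \<open>\<open>h\<close> sees only the set of types, which is the same for all lines with a
  common order of first appearance, so it factors out of each of the finitely many classes.\<close>

lemma oi_weight_has_sum:
  assumes fin: "finite \<S>"
    and nn: "\<And>x. x \<in> \<S> \<Longrightarrow> a x \<ge> 0"
    and m0: "m {} = 0" and less: "\<And>A. A \<noteq> {} \<Longrightarrow> A \<subseteq> \<S> \<Longrightarrow> m A > 0 \<and> (\<Sum>y\<in>A. a y) < m A"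
  shows "((\<lambda>c. h (set c) * oi_weight a m c) has_sum
            (\<Sum>T | distinct T \<and> set T \<subseteq> \<S>. h (set T) * prefix_prod (order_factor a m) {} T)) (lists \<S>)"
proof -
  let ?N = "{T. distinct T \<and> set T \<subseteq> \<S>}"
  have finN: "finite ?N"
    by (rule finite_subset[OF _ finite_subset_distinct[OF fin]]) auto
  have one: "((\<lambda>c. h (set c) * oi_weight a m c) has_sum h (set T) * prefix_prod (order_factor a m) {} T) {c. first_order c = T}"
    if T: "T \<in> ?N" for T
  proof -
    have "(oi_weight a m has_sum prefix_prod (order_factor a m) {} T) {c. first_order c = T}"
      using T nn m0 less by (intro oi_weight_has_sum_first_order) auto
    from has_sum_cmult_right[OF this, of "h (set T)"] show ?thesis
      by (rule has_sum_cong[THEN iffD1, rotated]) auto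
  qed
  have U: "lists \<S> = (\<Union>T\<in>?N. {c. first_order c = T})" by (auto simp: in_lists_conv_set)
  have "((\<lambda>c. h (set c) * oi_weight a m c) has_sum
      (\<Sum>T\<in>F. h (set T) * prefix_prod (order_factor a m) {} T)) (\<Union>T\<in>F. {c. first_order c = T})"
    if "finite F" "F \<subseteq> ?N" for F
    using that
  proof (induction F rule: finite_induct)
    case (insert T F)
    then show ?case
      unfolding UN_insert using insert.hyps
      by (subst sum.insert) (auto intro!: has_sum_Un_disjoint one)
  qed simp
  from this[OF finN subset_refl] show ?thesis unfolding U .
qed

section \<open>Laws and expectations from sums of weights\<close>

lemma pmf_of_has_sum:
  fixes f :: "'a \<Rightarrow> real"
  assumes f: "(f has_sum Z) A" and nn: "\<And>x. x \<in> A \<Longrightarrow> f x \<ge> 0" and Z: "Z > 0"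
  obtains \<nu> where "\<And>x. pmf \<nu> x = of_bool (x \<in> A) * f x / Z"
proof -
  let ?g = "\<lambda>x. of_bool (x \<in> A) * f x / Z"
  have g: "(?g has_sum 1) UNIV"
  proof -
    have "((\<lambda>x. f x * (1 / Z)) has_sum (Z * (1 / Z))) A" by (rule has_sum_cmult_left[OF f])
    also have "?this \<longleftrightarrow> (?g has_sum (Z * (1 / Z))) UNIV"
      by (rule has_sum_cong_neutral) auto
    finally show ?thesis using Z by simp
  qed
  have nng: "?g x \<ge> 0" for x using nn Z by simp
  have "?g summable_on UNIV" using g by (rule has_sum_imp_summable)
  moreover have "norm (?g x) = ?g x" for x using nng[of x] by (simp only: real_norm_def abs_of_nonneg)
  ultimately have "(\<lambda>x. norm (?g x)) summable_on UNIV" by (simp only:)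
  then have abs: "Infinite_Set_Sum.abs_summable_on ?g UNIV" by (simp only: abs_summable_equivalent)
  have "(\<integral>\<^sup>+x. ?g x \<partial>count_space UNIV) = 1"
    using nn_integral_conv_infsetsum[OF abs] nng infsetsum_infsum[OF abs] infsumI[OF g] by simp
  then have "pmf (embed_pmf ?g) x = ?g x" for x by (intro pmf_embed_pmf nng)
  then show thesis using that by blast
qed

lemma expectation_has_sum:
  fixes f :: "'a \<Rightarrow> real"
  assumes nn: "\<And>x. f x \<ge> 0" and f: "((\<lambda>x. pmf \<nu> x * f x) has_sum I) UNIV"
  shows "measure_pmf.expectation \<nu> f = I"
proof -
  have "(\<lambda>x. pmf \<nu> x * f x) summable_on UNIV" using f by (rule has_sum_imp_summable)
  then have "(\<lambda>x. norm (pmf \<nu> x * f x)) summable_on UNIV" using nn by simp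
  then have abs: "Infinite_Set_Sum.abs_summable_on (\<lambda>x. pmf \<nu> x * f x) UNIV" by (simp only: abs_summable_equivalent)
  show ?thesis
    unfolding pmf_expectation_eq_infsetsum infsetsum_infsum[OF abs] using f by (rule infsumI)
qed

section \<open>Critical sets\<close>

locale parallel_servers =
  fixes \<mu> :: "'n::finite \<Rightarrow> real" and p :: "'n set \<Rightarrow> real" and \<S> :: "'n set set"
  assumes \<mu>_pos: "\<And>n. \<mu> n > 0" and S_ne: "\<S> \<noteq> {}" and S_nonempty: "{} \<notin> \<S>"
    and p_pos: "\<And>S. S \<in> \<S> \<Longrightarrow> p S > 0"
begin

abbreviation (input) "crit \<equiv> critical_subsets \<mu> p \<S>"
abbreviation (input) "cr \<equiv> covered_rate \<mu>"
abbreviation (input) "\<kappa> \<equiv> real CARD('n) * critical_rate \<mu> p \<S>"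
abbreviation (input) "K \<equiv> chain_length \<mu> p \<S>"

lemma sum_p_pos: "A \<noteq> {} \<Longrightarrow> A \<subseteq> \<S> \<Longrightarrow> sum p A > 0"
  using p_pos by (intro sum_pos) auto

lemma covered_rate_nonempty_pos: "A \<noteq> {} \<Longrightarrow> A \<subseteq> \<S> \<Longrightarrow> cr A > 0"
  unfolding covered_rate_eq using S_nonempty \<mu>_pos by (intro sum_pos) (fastforce simp: Union_empty_conv)+

lemma load_ratio_eq: "load_ratio \<mu> p A = cr A / sum p A"
  by (simp add: load_ratio_def covered_rate_eq)

lemma \<kappa>_eq: "\<kappa> = Min (load_ratio \<mu> p ` {A. A \<noteq> {} \<and> A \<subseteq> \<S>})"
  by (simp add: critical_rate_def)

text \<open>Minimality in multiplied-out form. With \<kappa> the minimal load ratio,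
  \<open>\<kappa> * sum p A \<le> cr A\<close> holds for all sets of types; equality singles out
  those whose geometric series diverges as the load tends to 1.\<close>

lemma critical_iff: "A \<in> crit \<longleftrightarrow> A \<noteq> {} \<and> A \<subseteq> \<S> \<and> cr A = \<kappa> * sum p A"
proof -
  let ?P = "{A. A \<noteq> {} \<and> A \<subseteq> \<S>}"
  have "A \<in> crit \<longleftrightarrow> A \<in> ?P \<and> (\<forall>B\<in>?P. load_ratio \<mu> p A \<le> load_ratio \<mu> p B)"
    by (auto simp: critical_subsets_def is_arg_min_linorder)
  also have "\<dots> \<longleftrightarrow> A \<in> ?P \<and> load_ratio \<mu> p A = \<kappa>"
  proof (rule conj_cong[OF refl])
    assume A: "A \<in> ?P"
    then have ne: "load_ratio \<mu> p ` ?P \<noteq> {}" by blast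
    have fin: "finite (load_ratio \<mu> p ` ?P)" by simp
    show "(\<forall>B\<in>?P. load_ratio \<mu> p A \<le> load_ratio \<mu> p B) \<longleftrightarrow> load_ratio \<mu> p A = \<kappa>"
      unfolding \<kappa>_eq eq_Min_iff[OF fin ne] using A by blast
  qed
  also have "\<dots> \<longleftrightarrow> A \<noteq> {} \<and> A \<subseteq> \<S> \<and> cr A = \<kappa> * sum p A"
  proof -
    have "cr A / sum p A = \<kappa> \<longleftrightarrow> cr A = \<kappa> * sum p A" if "A \<noteq> {}" "A \<subseteq> \<S>"
      using sum_p_pos[OF that] by (simp add: divide_eq_eq)
    then show ?thesis by (auto simp only: load_ratio_eq mem_Collect_eq)
  qed
  finally show ?thesis .
qed

lemma \<kappa>_le: "A \<subseteq> \<S> \<Longrightarrow> \<kappa> * sum p A \<le> cr A"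
proof (cases "A = {}")
  case False
  assume A: "A \<subseteq> \<S>"
  with False have "\<kappa> \<le> load_ratio \<mu> p A" unfolding \<kappa>_eq by (intro Min_le) auto
  with sum_p_pos[OF False A] show ?thesis by (simp add: load_ratio_eq pos_le_divide_eq)
qed simp

lemma critical_nonempty: "crit \<noteq> {}"
proof -
  let ?P = "{A. A \<noteq> {} \<and> A \<subseteq> \<S>}"
  have "\<kappa> \<in> load_ratio \<mu> p ` ?P"
    unfolding \<kappa>_eq using S_ne by (intro Min_in) auto
  then obtain A where "A \<in> ?P" "\<kappa> = load_ratio \<mu> p A" by auto
  then have "A \<in> crit" using sum_p_pos[of A] by (auto simp: critical_iff load_ratio_eq)
  then show ?thesis by auto
qed

lemma \<kappa>_pos: "\<kappa> > 0"
proof -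
  obtain A where "A \<in> crit" using critical_nonempty by auto
  then show ?thesis
    using covered_rate_nonempty_pos[of A] sum_p_pos[of A] by (auto simp: critical_iff zero_less_mult_iff)
qed

lemma critical_rate_pos: "critical_rate \<mu> p \<S> > 0"
  using \<kappa>_pos by (simp add: zero_less_mult_iff)

text \<open>\<open>cr\<close> is submodular, so \<open>A \<mapsto> cr A - \<kappa> p(A) \<ge> 0\<close> is, and its zeros are closed under union.\<close>

lemma critical_Un:
  assumes "A \<in> crit" "B \<in> crit"
  shows "A \<union> B \<in> crit"
proof -
  have "cr (A \<inter> B) \<le> (\<Sum>n\<in>\<Union>A \<inter> \<Union>B. \<mu> n)"
    unfolding covered_rate_eq using \<mu>_pos[THEN less_imp_le] by (intro sum_mono2) auto
  moreover have "cr (A \<union> B) + (\<Sum>n\<in>\<Union>A \<inter> \<Union>B. \<mu> n) = cr A + cr B"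
    unfolding covered_rate_eq by (simp add: sum.union_inter)
  moreover have "sum p (A \<union> B) + sum p (A \<inter> B) = sum p A + sum p B"
    by (simp add: sum.union_inter)
  moreover have "\<kappa> * sum p (A \<inter> B) \<le> cr (A \<inter> B)" "\<kappa> * sum p (A \<union> B) \<le> cr (A \<union> B)"
    by (intro \<kappa>_le; use assms in \<open>auto simp: critical_iff\<close>)+
  moreover have "cr A = \<kappa> * sum p A" "cr B = \<kappa> * sum p B"
    using assms by (simp_all add: critical_iff)
  moreover have "\<kappa> * sum p (A \<union> B) + \<kappa> * sum p (A \<inter> B) = \<kappa> * sum p A + \<kappa> * sum p B"
    by (simp only: calculation(3) distrib_left[symmetric])
  ultimately have "cr (A \<union> B) = \<kappa> * sum p (A \<union> B)"
    by linarith
  then show ?thesis using assms by (auto simp: critical_iff)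
qed

lemma Union_critical: "\<Union>crit \<in> crit"
proof -
  have "\<Union>F \<in> crit" if "finite F" "F \<noteq> {}" "F \<subseteq> crit" for F
    using that by (induction F rule: finite_ne_induct) (auto intro: critical_Un)
  from this[OF _ critical_nonempty] show ?thesis by simp
qed

text \<open>A strict chain has no repetitions and lies in a finite collection, so the lengths in the
  definition form a finite set and \<open>Max\<close> bounds its members.\<close>

lemma chain_length_ge:
  assumes "sorted_wrt (\<subset>) Ts" "set Ts \<subseteq> crit"
  shows "length Ts \<le> K"
proof -
  let ?L = "{length Ts | Ts. sorted_wrt (\<subset>) Ts \<and> set Ts \<subseteq> crit}"
  have dist: "sorted_wrt (\<subset>) Us \<Longrightarrow> distinct Us" for Us :: "'n set set list"
  proof (induction Us)
    case (Cons A Us)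
    then have "A \<notin> set Us" by fastforce
    with Cons show ?case by simp
  qed simp
  have "?L \<subseteq> {..card crit}"
  proof
    fix k assume "k \<in> ?L"
    then obtain Us where Us: "k = length Us" "sorted_wrt (\<subset>) Us" "set Us \<subseteq> crit" by blast
    have "length Us = card (set Us)" by (rule distinct_card[OF dist[OF Us(2)], symmetric])
    also have "\<dots> \<le> card crit" by (rule card_mono[OF finite Us(3)])
    finally show "k \<in> {..card crit}" using Us(1) by simp
  qed
  then have "finite ?L" by (rule finite_subset) simp
  moreover have "length Ts \<in> ?L" using assms by blast
  ultimately show ?thesis unfolding chain_length_def by (rule Max_ge)
qed

text \<open>A vector has no repetitions, so longer prefixes have strictly larger sets and the
  critical ones form a chain.\<close>

lemma critical_chain_of_vector:
  assumes "T \<in> ordered_vectors \<S>"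
  shows "sorted_wrt (\<subset>) (map (\<lambda>i. set (take i T)) (sorted_list_of_set (critical_positions \<mu> p \<S> T)))"
    and "set (map (\<lambda>i. set (take i T)) (sorted_list_of_set (critical_positions \<mu> p \<S> T))) \<subseteq> crit"
proof -
  let ?C = "critical_positions \<mu> p \<S> T"
  have fin: "finite ?C" by (simp add: critical_positions_def)
  have psub: "set (take i T) \<subset> set (take j T)" if "i < j" "j \<le> length T" for i j
  proof
    show "set (take i T) \<subseteq> set (take j T)" using that by (intro set_take_subset_set_take) simp
    have "card (set (take k T)) = min k (length T)" for k
      using assms by (simp add: ordered_vectors_def distinct_card)
    from this[of i] this[of j] that show "set (take i T) \<noteq> set (take j T)" by auto
  qed
  have "sorted_wrt (<) (sorted_list_of_set ?C)" by (rule strict_sorted_list_of_set)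
  then show "sorted_wrt (\<subset>) (map (\<lambda>i. set (take i T)) (sorted_list_of_set ?C))"
    unfolding sorted_wrt_map
    by (rule sorted_wrt_mono_rel[rotated]) (use fin in \<open>auto simp: critical_positions_def intro!: psub\<close>)
  show "set (map (\<lambda>i. set (take i T)) (sorted_list_of_set ?C)) \<subseteq> crit"
    using fin by (auto simp: critical_positions_def)
qed

text \<open>Bounds the number of poles of every order of first appearance, so that the scaling
  \<open>(1 - \<rho>) ^ K\<close> is never too weak.\<close>

lemma card_critical_positions_le:
  assumes "T \<in> ordered_vectors \<S>"
  shows "card (critical_positions \<mu> p \<S> T) \<le> K"
  using chain_length_ge[OF critical_chain_of_vector[OF assms]] by simp

text \<open>Otherwise the chain of critical prefixes could be prolonged by the union of all critical sets.\<close>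

lemma max_vector_prefix:
  assumes "T \<in> max_vectors \<mu> p \<S>"
  shows "\<exists>i. set (take i T) = \<Union>crit"
proof (rule ccontr)
  let ?C = "critical_positions \<mu> p \<S> T"
  let ?Ts = "map (\<lambda>i. set (take i T)) (sorted_list_of_set ?C)"
  assume neg: "\<nexists>i. set (take i T) = \<Union>crit"
  have T: "T \<in> ordered_vectors \<S>" "card ?C = K" using assms by (auto simp: vectors_with_def)
  note ch = critical_chain_of_vector[OF T(1)]
  have fin: "finite ?C" by (simp add: critical_positions_def)
  have "A \<subset> \<Union>crit" if "A \<in> set ?Ts" for A
  proof -
    have "A \<subseteq> \<Union>crit" using that ch(2) by blast
    moreover have "A \<noteq> \<Union>crit" using that neg by auto
    ultimately show ?thesis by blast
  qed
  then have "sorted_wrt (\<subset>) (?Ts @ [\<Union>crit])" using ch(1) by (simp add: sorted_wrt_append)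
  moreover have "set (?Ts @ [\<Union>crit]) \<subseteq> crit" using ch(2) Union_critical by auto
  ultimately have "length (?Ts @ [\<Union>crit]) \<le> K" by (rule chain_length_ge)
  then show False using T(2) by simp
qed

lemma finite_ordered_vectors: "finite (ordered_vectors \<S>)"
  unfolding ordered_vectors_def
  by (rule finite_subset[OF _ finite_subset_distinct[of \<S>]]) auto

lemma finite_max_vectors: "finite (max_vectors \<mu> p \<S>)"
  using finite_ordered_vectors by (rule rev_finite_subset) (auto simp: vectors_with_def)

end

section \<open>Heavy-traffic limit of the generating function\<close>

lemma p_upto_eq:
  assumes "distinct T" "i \<le> length T"
  shows "p_upto p T i = sum p (set (take i T))"
proof -
  have "p_upto p T i = (\<Sum>l<i. p (T ! l))"
    unfolding p_upto_def by (rule sum.reindex_bij_witness[of _ Suc "\<lambda>l. l - 1"]) auto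
  also have "\<dots> = (\<Sum>l<length (take i T). p (take i T ! l))"
    using assms by (intro sum.cong) auto
  also have "\<dots> = sum p (set (take i T))"
    using assms by (simp add: sum.distinct_set_conv_list sum_list_sum_nth atLeast0LessThan)
  finally show ?thesis .
qed

context parallel_servers
begin

text \<open>Share of \<open>x\<close>, placed after the types in \<open>A\<close>, in the vector
  weight. At a critical prefix the singular geometric factor is replaced by 1, its pole being taken
  up by a power of \<open>1 - \<rho>\<close>.\<close>

definition weight_factor :: "'n set set \<Rightarrow> 'n set \<Rightarrow> real" where
  "weight_factor A x = \<kappa> * p x / cr (insert x A) *
     (if insert x A \<in> crit then 1 else 1 / (1 - \<kappa> * sum p (insert x A) / cr (insert x A)))"

text \<open>At a critical prefix this is the Laplace transform of a unit exponential variable, at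
  the \<open>p\<close>-weighted mean of \<open>s\<close> over the prefix.\<close>

definition share_factor :: "('n set \<Rightarrow> real) \<Rightarrow> 'n set set \<Rightarrow> 'n set \<Rightarrow> real" where
  "share_factor s A x =
     (if insert x A \<in> crit then 1 / (1 + (\<Sum>S\<in>insert x A. s S * p S) / sum p (insert x A)) else 1)"

lemma vector_weight_eq:
  assumes T: "T \<in> ordered_vectors \<S>"
  shows "vector_weight \<mu> p \<S> T = prefix_prod weight_factor {} T"
proof -
  let ?C = "critical_positions \<mu> p \<S> T"
  have mu: "mu_upto \<mu> T i = cr (set (take i T))" for i
    by (simp add: mu_upto_def covered_rate_eq)
  have dist: "distinct T" using T by (simp add: ordered_vectors_def)
  have "(\<Prod>i\<in>{1..length T} - ?C. inverse (1 - \<kappa> * p_upto p T i / mu_upto \<mu> T i))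
     = (\<Prod>i\<in>{1..length T}. if i \<in> ?C then 1 else inverse (1 - \<kappa> * p_upto p T i / mu_upto \<mu> T i))"
    by (rule prod.mono_neutral_cong_left) auto
  then have "vector_weight \<mu> p \<S> T = (\<Prod>i\<in>{1..length T}. \<kappa> * p (T ! (i - 1)) / mu_upto \<mu> T i *
      (if i \<in> ?C then 1 else inverse (1 - \<kappa> * p_upto p T i / mu_upto \<mu> T i)))"
    by (simp only: vector_weight_def prod.distrib)
  also have "\<dots> = (\<Prod>i\<in>{1..length T}. weight_factor (set (take (i - 1) T)) (T ! (i - 1)))"
  proof (intro prod.cong refl)
    fix i assume i: "i \<in> {1..length T}"
    then show "\<kappa> * p (T ! (i - 1)) / mu_upto \<mu> T i *
      (if i \<in> ?C then 1 else inverse (1 - \<kappa> * p_upto p T i / mu_upto \<mu> T i)) = weight_factor (set (take (i - 1) T)) (T ! (i - 1))"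
      unfolding weight_factor_def insert_nth_set_take[OF i] mu
      using p_upto_eq[OF dist, of i p] i by (simp add: critical_positions_def inverse_eq_divide)
  qed
  finally show ?thesis by (simp only: prefix_prod_conv_prod)
qed

text \<open>Brings powers of \<open>1 - \<rho>\<close> and transforms, which live on critical
  positions, into the same prefix form as the weights, so that limits can be taken factor by
  factor.\<close>

lemma prod_critical_positions:
  "(\<Prod>i\<in>critical_positions \<mu> p \<S> T. f (set (take i T)))
     = prefix_prod (\<lambda>A x. if insert x A \<in> crit then f (insert x A) else 1) {} T"
proof -
  have "(\<Prod>i\<in>critical_positions \<mu> p \<S> T. f (set (take i T)))
      = (\<Prod>i\<in>{1..length T}. if set (take i T) \<in> crit then f (set (take i T)) else 1)"
    by (rule prod.mono_neutral_cong_left) (auto simp: critical_positions_def)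
  also have "\<dots> = prefix_prod (\<lambda>A x. if insert x A \<in> crit then f (insert x A) else 1) {} T"
    unfolding prefix_prod_conv_prod by (intro prod.cong refl) (simp only: insert_nth_set_take)
  finally show ?thesis .
qed

lemma weight_factor_pos:
  assumes "A \<subseteq> \<S>" "x \<in> \<S>"
  shows "weight_factor A x > 0"
proof -
  have B: "insert x A \<noteq> {}" "insert x A \<subseteq> \<S>" using assms by auto
  have "\<kappa> * sum p (insert x A) \<le> cr (insert x A)" by (rule \<kappa>_le[OF B(2)])
  moreover have "cr (insert x A) > 0" by (rule covered_rate_nonempty_pos[OF B])
  ultimately show ?thesis
    using \<kappa>_pos p_pos[OF assms(2)] critical_iff[of "insert x A"] B
    by (auto simp: weight_factor_def less_le intro!: mult_pos_pos divide_pos_pos simp del: mult_pos_pos)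
qed

lemma vector_weight_pos: "T \<in> ordered_vectors \<S> \<Longrightarrow> vector_weight \<mu> p \<S> T > 0"
  by (subst vector_weight_eq, assumption, intro prefix_prod_pos weight_factor_pos)
     (auto simp: ordered_vectors_def)

text \<open>With \<open>e = 1 - \<rho>\<close> the numerator is \<open>e * (1 + s)\<close> up to
  order \<open>e^2\<close>: one \<open>e\<close> from the load, \<open>e * s\<close> from the
  transform argument.\<close>

lemma geometric_factor_limit:
  fixes s :: real
  shows "((\<lambda>\<rho>. (1 - \<rho> * exp (- ((1 - \<rho>) * s))) / (1 - \<rho>)) \<longlongrightarrow> 1 + s) (at_left 1)"
proof -
  have "((\<lambda>e. (1 - (1 - e) * exp (- (e * s))) / e) \<longlongrightarrow> 1 + s) (at_right 0)"
    by real_asymp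
  moreover have "filterlim (\<lambda>\<rho>::real. 1 - \<rho>) (at_right 0) (at_left 1)"
    by real_asymp
  ultimately show ?thesis by (auto dest: filterlim_compose)
qed

text \<open>A non-critical set keeps its geometric series bounded. For a critical one
  \<open>cr B = \<kappa> * sum p B\<close>, so one minus the load of \<open>B\<close> is the mean,
  with weights \<open>p S / sum p B\<close>, of the numerators in
  \<open>geometric_factor_limit\<close>; divided by \<open>1 - \<rho>\<close> it tends to one plus
  the mean of \<open>s\<close>.\<close>

lemma order_factor_limit:
  assumes A: "A \<subseteq> \<S>" "x \<in> \<S>" and s: "\<And>S. s S \<ge> 0"
  shows "((\<lambda>\<rho>. order_factor (\<lambda>S. \<rho> * \<kappa> * p S * exp (- ((1 - \<rho>) * s S))) cr A x *
            (if insert x A \<in> crit then 1 - \<rho> else 1)) \<longlongrightarrow> weight_factor A x * share_factor s A x) (at_left 1)"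
proof -
  define B where "B = insert x A"
  have B: "B \<noteq> {}" "B \<subseteq> \<S>" "finite B" using A by (auto simp: B_def)
  have crB: "cr B > 0" by (rule covered_rate_nonempty_pos[OF B(1,2)])
  have pB: "sum p B > 0" by (rule sum_p_pos[OF B(1,2)])
  let ?a = "\<lambda>\<rho> S. \<rho> * \<kappa> * p S * exp (- ((1 - \<rho>) * s S))"
  have a: "((\<lambda>\<rho>. ?a \<rho> S) \<longlongrightarrow> \<kappa> * p S) (at_left 1)" for S
  proof -
    have "((\<lambda>\<rho>. ?a \<rho> S) \<longlongrightarrow> 1 * \<kappa> * p S * exp (- ((1 - 1) * s S))) (at_left 1)"
      by (intro tendsto_intros)
    then show ?thesis by simp
  qed
  show ?thesis
  proof (cases "B \<in> crit")
    case False
    have "\<kappa> * sum p B < cr B"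
      using \<kappa>_le[OF B(2)] critical_iff[of B] False B by auto
    then have "1 - (\<Sum>S\<in>B. \<kappa> * p S) / cr B \<noteq> 0"
      using crB by (simp add: sum_distrib_left[symmetric])
    then have "((\<lambda>\<rho>. ?a \<rho> x / cr B * (1 / (1 - (\<Sum>S\<in>B. ?a \<rho> S) / cr B)))
        \<longlongrightarrow> \<kappa> * p x / cr B * (1 / (1 - (\<Sum>S\<in>B. \<kappa> * p S) / cr B))) (at_left 1)"
      using crB by (intro tendsto_intros a) auto
    then show ?thesis
      using False by (simp add: order_factor_def weight_factor_def share_factor_def B_def sum_distrib_left)
  next
    case True
    then have eq: "cr B = \<kappa> * sum p B" using critical_iff[of B] by simp
    have k: "\<kappa> > 0" by (rule \<kappa>_pos)
    let ?g = "\<lambda>\<rho>. \<Sum>S\<in>B. p S / sum p B * ((1 - \<rho> * exp (- ((1 - \<rho>) * s S))) / (1 - \<rho>))"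
    have g: "(?g \<longlongrightarrow> (\<Sum>S\<in>B. p S / sum p B * (1 + s S))) (at_left 1)"
      by (intro tendsto_intros geometric_factor_limit)
    have gl: "(\<Sum>S\<in>B. p S / sum p B * (1 + s S)) = 1 + (\<Sum>S\<in>B. s S * p S) / sum p B"
      using pB by (simp add: distrib_left sum.distrib sum_divide_distrib[symmetric] mult.commute add_divide_distrib)
    \<comment> \<open>Non-negativity of \<open>s\<close> keeps the limit of the denominator away
      from 0.\<close>
    have "(\<Sum>S\<in>B. s S * p S) \<ge> 0"
      using s p_pos B(2) by (intro sum_nonneg mult_nonneg_nonneg) (auto intro: less_imp_le)
    then have nz: "1 + (\<Sum>S\<in>B. s S * p S) / sum p B \<noteq> 0"
      using pB by (smt (verit) divide_nonneg_pos)
    have "((\<lambda>\<rho>. ?a \<rho> x / cr B * (1 / ?g \<rho>)) \<longlongrightarrow> \<kappa> * p x / cr B * (1 / (1 + (\<Sum>S\<in>B. s S * p S) / sum p B))) (at_left 1)"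
      using g[unfolded gl] nz crB by (intro tendsto_intros a) auto
    moreover have "?a \<rho> x / cr B * (1 / ?g \<rho>) = order_factor (?a \<rho>) cr A x * (1 - \<rho>)" if "\<rho> < 1" for \<rho>
    proof -
      have one: "(\<Sum>S\<in>B. p S / sum p B) = 1" using pB by (simp add: sum_divide_distrib[symmetric])
      have "?g \<rho> = (\<Sum>S\<in>B. p S / sum p B - ?a \<rho> S / cr B) / (1 - \<rho>)"
        unfolding sum_divide_distrib eq
      proof (intro sum.cong refl)
        have alg: "x / y * ((1 - \<rho> * e) / (1 - \<rho>)) = (x / y - \<rho> * c * x * e / (c * y)) / (1 - \<rho>)"
          if "c > 0" for x y e c :: real
        proof -
          have "\<rho> * c * x * e / (c * y) = x / y * (\<rho> * e)" using that by simp
          then show ?thesis by (simp only: right_diff_distrib mult_1_right times_divide_eq_right)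
        qed
        show "p S / sum p B * ((1 - \<rho> * exp (- ((1 - \<rho>) * s S))) / (1 - \<rho>))
            = (p S / sum p B - ?a \<rho> S / (\<kappa> * sum p B)) / (1 - \<rho>)" for S
          by (rule alg[OF k])
      qed
      also have "\<dots> = (1 - (\<Sum>S\<in>B. ?a \<rho> S) / cr B) / (1 - \<rho>)"
        unfolding sum_subtractf one by (simp add: sum_divide_distrib)
      finally show ?thesis unfolding order_factor_def B_def[symmetric] by simp
    qed
    then have "\<forall>\<^sub>F \<rho> in at_left 1. ?a \<rho> x / cr B * (1 / ?g \<rho>) = order_factor (?a \<rho>) cr A x * (1 - \<rho>)"
      by (auto simp: eventually_at_filter)
    ultimately have "((\<lambda>\<rho>. order_factor (?a \<rho>) cr A x * (1 - \<rho>)) \<longlongrightarrow> \<kappa> * p x / cr B * (1 / (1 + (\<Sum>S\<in>B. s S * p S) / sum p B))) (at_left 1)"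
      by (simp only: tendsto_cong)
    then show ?thesis
      using True by (simp add: weight_factor_def share_factor_def B_def)
  qed
qed

text \<open>One factor \<open>1 - \<rho>\<close> is spent on each critical prefix. The surplus
  power, with exponent \<open>K - ?k\<close>, tends to 0 unless the number of critical prefixes is
  maximal, when it is constantly 1.\<close>

lemma prefix_prod_limit:
  assumes T: "T \<in> ordered_vectors \<S>" and s: "\<And>S. s S \<ge> 0"
  shows "((\<lambda>\<rho>. (1 - \<rho>) ^ K * prefix_prod (order_factor (\<lambda>S. \<rho> * \<kappa> * p S * exp (- ((1 - \<rho>) * s S))) cr) {} T)
     \<longlongrightarrow> of_bool (T \<in> max_vectors \<mu> p \<S>) * (vector_weight \<mu> p \<S> T * prefix_prod (share_factor s) {} T)) (at_left 1)"
proof -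
  let ?k = "card (critical_positions \<mu> p \<S> T)"
  let ?P = "\<lambda>\<rho>. prefix_prod (order_factor (\<lambda>S. \<rho> * \<kappa> * p S * exp (- ((1 - \<rho>) * s S))) cr) {} T"
  have le: "?k \<le> K" by (rule card_critical_positions_le[OF T])
  have "((\<lambda>\<rho>. prefix_prod (\<lambda>A x. order_factor (\<lambda>S. \<rho> * \<kappa> * p S * exp (- ((1 - \<rho>) * s S))) cr A x *
            (if insert x A \<in> crit then 1 - \<rho> else 1)) {} T)
      \<longlongrightarrow> prefix_prod (\<lambda>A x. weight_factor A x * share_factor s A x) {} T) (at_left 1)"
    by (intro tendsto_prefix_prod order_factor_limit s) (use T in \<open>auto simp: ordered_vectors_def\<close>)
  then have lim: "((\<lambda>\<rho>. ?P \<rho> * (1 - \<rho>) ^ ?k)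
      \<longlongrightarrow> vector_weight \<mu> p \<S> T * prefix_prod (share_factor s) {} T) (at_left 1)"
    unfolding prefix_prod_mult prod_critical_positions[where f="\<lambda>_. _", symmetric]
    by (simp add: vector_weight_eq[OF T])
  have "((\<lambda>\<rho>::real. (1 - \<rho>) ^ (K - ?k)) \<longlongrightarrow> (1 - 1) ^ (K - ?k)) (at_left 1)"
    by (intro tendsto_intros)
  then have "((\<lambda>\<rho>::real. (1 - \<rho>) ^ (K - ?k)) \<longlongrightarrow> of_bool (T \<in> max_vectors \<mu> p \<S>)) (at_left 1)"
    using le T by (auto simp: vectors_with_def power_0_left split: if_splits)
  from tendsto_mult[OF this lim] show ?thesis
  proof (rule tendsto_cong[THEN iffD1, rotated], intro always_eventually allI)
    fix \<rho> :: real
    have "(1 - \<rho>) ^ K = (1 - \<rho>) ^ (K - ?k) * (1 - \<rho>) ^ ?k"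
      using le by (simp add: power_add[symmetric])
    then show "(1 - \<rho>) ^ (K - ?k) * (?P \<rho> * (1 - \<rho>) ^ ?k) = (1 - \<rho>) ^ K * ?P \<rho>"
      by (simp add: mult_ac)
  qed
qed

text \<open>
  A maximal vector is an ordering of the union of all critical sets followed by types that
  contribute to no critical prefix, so that \<open>h\<close> affects the second part only and cancels.
\<close>

lemma max_vectors_factor:
  assumes h: "\<And>A. A \<subseteq> \<S> \<Longrightarrow> h A > 0" and ne: "max_vectors \<mu> p \<S> \<noteq> {}"
  shows "(\<Sum>T\<in>max_vectors \<mu> p \<S>. h (set T) * (vector_weight \<mu> p \<S> T * prefix_prod (share_factor s) {} T))
           / (\<Sum>T\<in>max_vectors \<mu> p \<S>. h (set T) * vector_weight \<mu> p \<S> T)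
       = (\<Sum>T\<in>max_vectors \<mu> p \<S>. vector_weight \<mu> p \<S> T * prefix_prod (share_factor s) {} T)
           / (\<Sum>T\<in>max_vectors \<mu> p \<S>. vector_weight \<mu> p \<S> T)"
proof -
  define C where "C = \<Union>crit"
  have C: "C \<in> crit" unfolding C_def by (rule Union_critical)
  have CS: "C \<subseteq> \<S>" using C critical_iff by blast
  have sub: "A \<subseteq> C" if "A \<in> crit" for A using that by (auto simp: C_def)
  define V where "V = {V \<in> max_vectors \<mu> p \<S>. set V = C}"
  define R where "R = {R. distinct R \<and> set R \<subseteq> \<S> - C}"
  let ?app = "\<lambda>(v, r). v @ r"
  \<comment> \<open>A prefix reaching beyond \<open>v\<close> contains a type outside
    \<open>C\<close>, while every critical set lies in \<open>C\<close>; hence \<open>r\<close> adds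
    no critical positions.\<close>
  have pos: "critical_positions \<mu> p \<S> (v @ r) = critical_positions \<mu> p \<S> v"
    if v: "set v = C" and r: "r \<in> R" for v r
  proof -
    have key: "i \<le> length v" if i: "i \<in> {1..length (v @ r)}" "set (take i (v @ r)) \<in> crit" for i
    proof (rule ccontr)
      assume "\<not> i \<le> length v"
      then have l: "i - length v > 0" "r \<noteq> []" using i(1) by auto
      then obtain t r' where tr: "r = t # r'" by (cases r) auto
      have "t \<in> set (take (i - length v) r)" using l(1) by (simp add: tr take_Cons')
      also have "set (take (i - length v) r) \<subseteq> C"
        using sub[OF i(2)] by (simp only: take_append set_append Un_subset_iff)
      finally have "t \<in> C" .
      moreover have "t \<in> set r" by (simp add: tr)
      ultimately show False using r unfolding R_def by blast
    qed
    show ?thesis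
    proof (intro set_eqI iffI)
      fix i assume "i \<in> critical_positions \<mu> p \<S> (v @ r)"
      then have i: "i \<in> {1..length (v @ r)}" "set (take i (v @ r)) \<in> crit"
        by (simp_all only: critical_positions_def mem_Collect_eq)
      have "i \<le> length v" by (rule key[OF i])
      with i show "i \<in> critical_positions \<mu> p \<S> v"
        by (simp add: critical_positions_def)
    next
      fix i assume "i \<in> critical_positions \<mu> p \<S> v"
      then show "i \<in> critical_positions \<mu> p \<S> (v @ r)"
        by (simp add: critical_positions_def)
    qed
  qed
  have img: "max_vectors \<mu> p \<S> = ?app ` (V \<times> R)"
  proof (intro equalityI subsetI)
    fix T assume T: "T \<in> max_vectors \<mu> p \<S>"
    then obtain i where i: "set (take i T) = C"
      using max_vector_prefix[OF T] by (auto simp: C_def)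
    have dist: "distinct (take i T @ drop i T)" "set (take i T @ drop i T) \<subseteq> \<S>"
      using T by (simp_all add: vectors_with_def ordered_vectors_def)
    then have r: "drop i T \<in> R" unfolding distinct_append R_def set_append i by blast
    have "take i T \<in> V"
    proof -
      have "card (critical_positions \<mu> p \<S> (take i T)) = K"
        using pos[OF i r] T by (simp add: vectors_with_def)
      then show ?thesis using dist i CS by (simp add: V_def vectors_with_def ordered_vectors_def)
    qed
    with r show "T \<in> ?app ` (V \<times> R)" by (intro image_eqI[of _ _ "(take i T, drop i T)"]) auto
  next
    fix T assume "T \<in> ?app ` (V \<times> R)"
    then obtain v r where vr: "T = v @ r" "v \<in> V" "r \<in> R" by auto
    then show "T \<in> max_vectors \<mu> p \<S>"
      using pos[of v r] by (auto simp: V_def R_def vectors_with_def ordered_vectors_def)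
  qed
  \<comment> \<open>In every pair the cut comes after \<open>card C\<close> entries.\<close>
  have inj: "inj_on ?app (V \<times> R)"
  proof (rule inj_onI)
    fix x y assume xy: "x \<in> V \<times> R" "y \<in> V \<times> R" "?app x = ?app y"
    have "length (fst z) = card C" if "z \<in> V \<times> R" for z
    proof -
      have "fst z \<in> V" using that by auto
      then have "distinct (fst z)" "set (fst z) = C"
        by (simp_all add: V_def vectors_with_def ordered_vectors_def)
      then show ?thesis using distinct_card[of "fst z"] by simp
    qed
    from this[OF xy(1)] this[OF xy(2)] have "length (fst x) = length (fst y)" by (simp only:)
    moreover have "fst x @ snd x = fst y @ snd y" using xy(3) by (simp add: split_beta)
    ultimately have "fst x = fst y \<and> snd x = snd y" by (rule append_eq_append_conv[THEN iffD1, OF disjI1])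
    then show "x = y" by (simp add: prod_eq_iff)
  qed
  have fin: "finite V" "finite R"
  proof -
    show "finite V" using finite_max_vectors by (simp add: V_def)
    show "finite R" unfolding R_def by (rule finite_subset[OF _ finite_subset_distinct[of "\<S> - C"]]) auto
  qed
  have w: "vector_weight \<mu> p \<S> (v @ r) = vector_weight \<mu> p \<S> v * prefix_prod weight_factor C r"
    if "v \<in> V" "r \<in> R" for v r
  proof -
    have "v @ r \<in> max_vectors \<mu> p \<S>" using that img by auto
    then have "v @ r \<in> ordered_vectors \<S>" "v \<in> ordered_vectors \<S>"
      using that(1) by (auto simp: vectors_with_def V_def)
    then show ?thesis
      using that(1) by (simp only: vector_weight_eq prefix_prod_append) (simp add: V_def)
  qed
  have sh: "prefix_prod (share_factor s) {} (v @ r) = prefix_prod (share_factor s) {} v"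
    if "v \<in> V" "r \<in> R" for v r
  proof -
    have "prefix_prod (share_factor s) C r = prefix_prod (\<lambda>_ _. 1) C r"
    proof (rule prefix_prod_cong)
      fix B x assume "C \<subseteq> B" "x \<in> set r"
      then have "x \<notin> C" using that(2) by (auto simp: R_def)
      then have "insert x B \<notin> crit" using sub by blast
      then show "share_factor s B x = 1" by (simp add: share_factor_def)
    qed
    also have "prefix_prod (\<lambda>_ _. 1) A r = 1" for A
      by (induction r arbitrary: A) simp_all
    finally show ?thesis using that(1) by (simp add: prefix_prod_append V_def)
  qed
  \<comment> \<open>Generic in \<open>g\<close> and \<open>t\<close> because all four sums of the
    claim are instances: \<open>g\<close> is \<open>h\<close> or constantly 1, and \<open>t\<close>
    is \<open>s\<close> or 0, where the share factors are 1.\<close>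
  have sums: "(\<Sum>T\<in>max_vectors \<mu> p \<S>. g (set T) * (vector_weight \<mu> p \<S> T * prefix_prod (share_factor t) {} T))
     = (\<Sum>v\<in>V. vector_weight \<mu> p \<S> v * prefix_prod (share_factor t) {} v) *
       (\<Sum>r\<in>R. g (C \<union> set r) * prefix_prod weight_factor C r)" (is "?L = ?M")
    if "\<And>v r. v \<in> V \<Longrightarrow> r \<in> R \<Longrightarrow> prefix_prod (share_factor t) {} (v @ r) = prefix_prod (share_factor t) {} v" for g t
  proof -
    have "?L = (\<Sum>z\<in>V \<times> R. g (set (?app z)) * (vector_weight \<mu> p \<S> (?app z) * prefix_prod (share_factor t) {} (?app z)))"
      unfolding img by (simp add: sum.reindex[OF inj])
    also have "\<dots> = (\<Sum>(v, r)\<in>V \<times> R. (vector_weight \<mu> p \<S> v * prefix_prod (share_factor t) {} v) *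
        (g (C \<union> set r) * prefix_prod weight_factor C r))"
    proof (intro sum.cong refl, clarify)
      fix v r assume vr: "v \<in> V" "r \<in> R"
      then have "set (v @ r) = C \<union> set r" by (simp add: V_def)
      then show "g (set (v @ r)) * (vector_weight \<mu> p \<S> (v @ r) * prefix_prod (share_factor t) {} (v @ r))
          = vector_weight \<mu> p \<S> v * prefix_prod (share_factor t) {} v * (g (C \<union> set r) * prefix_prod weight_factor C r)"
        unfolding that[OF vr] w[OF vr] by (simp only: mult_ac)
    qed
    also have "\<dots> = ?M" by (simp add: sum_product sum.cartesian_product)
    finally show ?thesis .
  qed
  have sh0: "prefix_prod (share_factor (\<lambda>_. 0)) {} v = 1" for v
  proof -
    have "prefix_prod (share_factor (\<lambda>_. 0)) A v = 1" for A
      by (induction v arbitrary: A) (simp_all add: share_factor_def)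
    then show ?thesis .
  qed
  \<comment> \<open>The empty list belongs to \<open>R\<close>, so the common factor is a nonempty
    sum of positive terms and cancels from the quotients.\<close>
  have Rpos: "(\<Sum>r\<in>R. g (C \<union> set r) * prefix_prod weight_factor C r) > 0" if g: "\<And>A. A \<subseteq> \<S> \<Longrightarrow> g A > 0" for g
  proof (rule sum_pos[OF fin(2)])
    have "[] \<in> R" by (simp add: R_def)
    then show "R \<noteq> {}" by blast
    fix r assume r: "r \<in> R"
    then have "prefix_prod weight_factor C r > 0"
      using CS by (intro prefix_prod_pos weight_factor_pos) (auto simp: R_def)
    then show "g (C \<union> set r) * prefix_prod weight_factor C r > 0"
      using r CS by (intro mult_pos_pos g) (auto simp: R_def)
  qed
  show ?thesis
  proof -
    let ?VL = "\<Sum>v\<in>V. vector_weight \<mu> p \<S> v * prefix_prod (share_factor s) {} v"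
      and ?V = "\<Sum>v\<in>V. vector_weight \<mu> p \<S> v"
      and ?R = "\<lambda>g. \<Sum>r\<in>R. g (C \<union> set r) * prefix_prod weight_factor C r"
    have 1: "(\<Sum>T\<in>max_vectors \<mu> p \<S>. g (set T) * (vector_weight \<mu> p \<S> T * prefix_prod (share_factor s) {} T)) = ?VL * ?R g" for g
      by (rule sums) (rule sh)
    have 2: "(\<Sum>T\<in>max_vectors \<mu> p \<S>. g (set T) * vector_weight \<mu> p \<S> T) = ?V * ?R g" for g
      using sums[of "\<lambda>_. 0" g] by (simp only: sh0 mult_1_right)
    have R: "?R h > 0" "?R (\<lambda>_. 1) > 0" by (rule Rpos, erule h) (rule Rpos[of "\<lambda>_. 1"], simp)
    have r: "(\<Sum>T\<in>max_vectors \<mu> p \<S>. vector_weight \<mu> p \<S> T * prefix_prod (share_factor s) {} T) = ?VL * ?R (\<lambda>_. 1)"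
      "(\<Sum>T\<in>max_vectors \<mu> p \<S>. vector_weight \<mu> p \<S> T) = ?V * ?R (\<lambda>_. 1)"
      using 1[of "\<lambda>_. 1"] 2[of "\<lambda>_. 1"] by (simp_all only: mult_1_left)
    have cancel: "x * c / (y * c) = x * d / (y * d)" if "c > 0" "d > 0" for x y c d :: real
      using that by simp
    show ?thesis
      unfolding 1[of h] 2[of h] r by (rule cancel[OF R])
  qed
qed

text \<open>
  The law of the waiting line under either mechanism is proportional to \<open>h (set c) * oi_weight a cr c\<close>,
  with \<open>h = 1\<close> under cancel-on-completion; under cancel-on-start \<open>h\<close> is the weight of the orders of
  idle servers that are compatible with the types present.
\<close>

definition line_mass :: "('n set set \<Rightarrow> real) \<Rightarrow> real \<Rightarrow> ('n set \<Rightarrow> real) \<Rightarrow> real" where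
  "line_mass h \<rho> s = (\<Sum>T\<in>ordered_vectors \<S>.
     h (set T) * prefix_prod (order_factor (\<lambda>S. \<rho> * \<kappa> * p S * exp (- ((1 - \<rho>) * s S))) cr) {} T)"

text \<open>The exponential factors only lower the arrival rates, so for non-negative
  \<open>s\<close> the geometric series converge whenever \<open>\<rho> < 1\<close>.\<close>

lemma subcritical:
  assumes \<rho>: "0 < \<rho>" "\<rho> < 1" and s: "\<And>S. s S \<ge> 0" and A: "A \<noteq> {}" "A \<subseteq> \<S>"
  shows "cr A > 0 \<and> (\<Sum>S\<in>A. \<rho> * \<kappa> * p S * exp (- ((1 - \<rho>) * s S))) < cr A"
proof
  show "cr A > 0" by (rule covered_rate_nonempty_pos[OF A])
  have "(\<Sum>S\<in>A. \<rho> * \<kappa> * p S * exp (- ((1 - \<rho>) * s S))) \<le> (\<Sum>S\<in>A. \<rho> * \<kappa> * p S)"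
  proof (rule sum_mono)
    fix S assume "S \<in> A"
    then have "p S > 0" using A p_pos by blast
    then have "\<rho> * \<kappa> * p S \<ge> 0" using \<rho> critical_rate_pos by (intro mult_nonneg_nonneg) auto
    moreover have "exp (- ((1 - \<rho>) * s S)) \<le> 1" using \<rho> s by simp
    ultimately show "\<rho> * \<kappa> * p S * exp (- ((1 - \<rho>) * s S)) \<le> \<rho> * \<kappa> * p S"
      using mult_left_le by blast
  qed
  also have "\<dots> = \<rho> * (\<kappa> * sum p A)" by (simp add: sum_distrib_left mult.assoc)
  also have "\<dots> < 1 * (\<kappa> * sum p A)"
    using \<rho>(2) mult_pos_pos[OF \<kappa>_pos sum_p_pos[OF A]] by (rule mult_strict_right_mono)
  also have "\<dots> \<le> cr A" using \<kappa>_le[OF A(2)] by simp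
  finally show "(\<Sum>S\<in>A. \<rho> * \<kappa> * p S * exp (- ((1 - \<rho>) * s S))) < cr A" .
qed

lemma order_factor_pos:
  assumes "0 < \<rho>" "\<rho> < 1" "\<And>S. s S \<ge> 0" and A: "A \<subseteq> \<S>" "x \<in> \<S>"
  shows "order_factor (\<lambda>S. \<rho> * \<kappa> * p S * exp (- ((1 - \<rho>) * s S))) cr A x > 0"
proof -
  have B: "insert x A \<noteq> {}" "insert x A \<subseteq> \<S>" using A by auto
  have "\<rho> * \<kappa> * p x * exp (- ((1 - \<rho>) * s x)) > 0"
    using assms(1) critical_rate_pos p_pos[OF A(2)] by (intro mult_pos_pos) auto
  moreover have sc: "cr (insert x A) > 0 \<and>
      (\<Sum>S\<in>insert x A. \<rho> * \<kappa> * p S * exp (- ((1 - \<rho>) * s S))) < cr (insert x A)"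
    by (rule subcritical[OF assms(1,2) _ B]) (rule assms(3))
  ultimately have "\<rho> * \<kappa> * p x * exp (- ((1 - \<rho>) * s x)) / cr (insert x A) > 0"
    by (intro divide_pos_pos) blast+
  moreover have "1 - (\<Sum>S\<in>insert x A. \<rho> * \<kappa> * p S * exp (- ((1 - \<rho>) * s S))) / cr (insert x A) > 0"
    using sc by (simp only: diff_gt_0_iff_gt divide_less_eq_1_pos)
  ultimately show ?thesis
    unfolding order_factor_def by (rule mult_pos_pos[OF _ divide_pos_pos[OF zero_less_one]])
qed

lemma line_mass_pos:
  assumes "0 < \<rho>" "\<rho> < 1" "\<And>S. s S \<ge> 0" and h: "\<And>A. A \<subseteq> \<S> \<Longrightarrow> h A > 0"
  shows "line_mass h \<rho> s > 0"
  unfolding line_mass_def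
proof (rule sum_pos[OF finite_ordered_vectors])
  have "[] \<in> ordered_vectors \<S>" by (simp add: ordered_vectors_def)
  then show "ordered_vectors \<S> \<noteq> {}" by blast
  fix T assume T: "T \<in> ordered_vectors \<S>"
  have "prefix_prod (order_factor (\<lambda>S. \<rho> * \<kappa> * p S * exp (- ((1 - \<rho>) * s S))) cr) {} T > 0"
  proof (rule prefix_prod_pos)
    fix B x assume "B \<subseteq> {} \<union> set T" "x \<in> set T"
    then have "B \<subseteq> \<S>" "x \<in> \<S>" using T by (auto simp: ordered_vectors_def)
    then show "order_factor (\<lambda>S. \<rho> * \<kappa> * p S * exp (- ((1 - \<rho>) * s S))) cr B x > 0"
      by (intro order_factor_pos[OF assms(1,2)]) (rule assms(3))
  qed
  then show "h (set T) * prefix_prod (order_factor (\<lambda>S. \<rho> * \<kappa> * p S * exp (- ((1 - \<rho>) * s S))) cr) {} T > 0"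
    using T h by (intro mult_pos_pos) (auto simp: ordered_vectors_def)
qed

lemma line_mass_has_sum:
  assumes "0 < \<rho>" "\<rho> < 1" "\<And>S. s S \<ge> 0"
  shows "((\<lambda>c. h (set c) * oi_weight (\<lambda>S. \<rho> * \<kappa> * p S * exp (- ((1 - \<rho>) * s S))) cr c)
            has_sum line_mass h \<rho> s) (lists \<S>)"
  unfolding line_mass_def ordered_vectors_def
proof (rule oi_weight_has_sum)
  show "\<rho> * \<kappa> * p S * exp (- ((1 - \<rho>) * s S)) \<ge> 0" if "S \<in> \<S>" for S
    using that assms critical_rate_pos p_pos[OF that] by (intro mult_nonneg_nonneg) auto
  show "cr A > 0 \<and> (\<Sum>S\<in>A. \<rho> * \<kappa> * p S * exp (- ((1 - \<rho>) * s S))) < cr A" if "A \<noteq> {}" "A \<subseteq> \<S>" for A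
    by (rule subcritical[OF assms(1,2) _ that]) (rule assms(3))
qed simp_all

text \<open>Exponential tilting: the factor is multiplicative over the jobs and is absorbed into the
  arrival rates, which makes the Laplace transform of the line law a quotient of line
  masses.\<close>

lemma oi_weight_exp:
  "oi_weight (\<lambda>S. a S * exp (- (e * s S))) m c = oi_weight a m c * exp (- (e * (\<Sum>S\<in>UNIV. s S * real (count_list c S))))"
  for a :: "'n set \<Rightarrow> real"
proof (induction c rule: rev_induct)
  case (snoc x c)
  have "(\<Sum>S\<in>UNIV. s S * real (count_list (c @ [x]) S)) = (\<Sum>S\<in>UNIV. s S * real (count_list c S)) + s x"
  proof -
    have "(\<Sum>S\<in>UNIV. s S * real (count_list (c @ [x]) S)) = (\<Sum>S\<in>UNIV. s S * real (count_list c S) + (if S = x then s S else 0))"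
      by (intro sum.cong) (auto simp: algebra_simps)
    then show ?thesis by (simp add: sum.distrib)
  qed
  moreover have "exp (- (e * (y + z))) = exp (- (e * y)) * exp (- (e * z))" for y z
    by (simp add: mult_exp_exp distrib_left)
  ultimately show ?case unfolding oi_weight_snoc snoc.IH by simp
qed simp

lemma line_law_exists:
  assumes \<rho>: "0 < \<rho>" "\<rho> < 1" and h: "\<And>A. A \<subseteq> \<S> \<Longrightarrow> h A > 0"
  obtains \<alpha> where "\<And>c. pmf \<alpha> c = of_bool (c \<in> lists \<S>) * (h (set c) * oi_weight (\<lambda>S. \<rho> * \<kappa> * p S) cr c) / line_mass h \<rho> (\<lambda>_. 0)"
proof -
  have hs: "((\<lambda>c. h (set c) * oi_weight (\<lambda>S. \<rho> * \<kappa> * p S) cr c) has_sum line_mass h \<rho> (\<lambda>_. 0)) (lists \<S>)"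
    using line_mass_has_sum[OF \<rho>, of "\<lambda>_. 0" h] by simp
  have nn: "h (set c) * oi_weight (\<lambda>S. \<rho> * \<kappa> * p S) cr c \<ge> 0" if "c \<in> lists \<S>" for c
  proof (rule mult_nonneg_nonneg)
    show "h (set c) \<ge> 0" using that h[of "set c"] by (auto intro: less_imp_le)
    show "oi_weight (\<lambda>S. \<rho> * \<kappa> * p S) cr c \<ge> 0"
    proof (rule oi_weight_nonneg)
    show "\<rho> * \<kappa> * p x \<ge> 0" if "x \<in> set c" for x
      using that \<open>c \<in> lists \<S>\<close> \<rho> critical_rate_pos p_pos[of x] by (intro mult_nonneg_nonneg) (auto intro: less_imp_le)
    show "cr A \<ge> 0" for A
      unfolding covered_rate_eq using \<mu>_pos by (intro sum_nonneg) (auto intro: less_imp_le)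
    qed
  qed
  from pmf_of_has_sum[OF hs nn line_mass_pos[OF \<rho> _ h]] that show thesis by auto
qed

lemma line_law_transform:
  assumes \<rho>: "0 < \<rho>" "\<rho> < 1" and s: "\<And>S. s S \<ge> 0"
    and h: "\<And>A. A \<subseteq> \<S> \<Longrightarrow> h A > 0"
    and \<alpha>: "\<And>c. pmf \<alpha> c = of_bool (c \<in> lists \<S>) * (h (set c) * oi_weight (\<lambda>S. \<rho> * \<kappa> * p S) cr c) / line_mass h \<rho> (\<lambda>_. 0)"
  shows "measure_pmf.expectation \<alpha> (\<lambda>c. exp (- ((1 - \<rho>) * (\<Sum>S\<in>UNIV. s S * real (count_list c S)))))
     = line_mass h \<rho> s / line_mass h \<rho> (\<lambda>_. 0)"
proof (rule expectation_has_sum)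
  let ?e = "\<lambda>c. exp (- ((1 - \<rho>) * (\<Sum>S\<in>UNIV. s S * real (count_list c S))))"
  have "((\<lambda>c. h (set c) * oi_weight (\<lambda>S. \<rho> * \<kappa> * p S * exp (- ((1 - \<rho>) * s S))) cr c * (1 / line_mass h \<rho> (\<lambda>_. 0)))
      has_sum line_mass h \<rho> s * (1 / line_mass h \<rho> (\<lambda>_. 0))) (lists \<S>)"
    by (intro has_sum_cmult_left line_mass_has_sum assms)
  also have "?this \<longleftrightarrow> ((\<lambda>c. pmf \<alpha> c * ?e c) has_sum line_mass h \<rho> s * (1 / line_mass h \<rho> (\<lambda>_. 0))) UNIV"
    by (rule has_sum_cong_neutral) (auto simp: \<alpha> oi_weight_exp)
  finally show "((\<lambda>c. pmf \<alpha> c * ?e c) has_sum line_mass h \<rho> s / line_mass h \<rho> (\<lambda>_. 0)) UNIV" by simp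
qed simp

definition limit_transform :: "('n set \<Rightarrow> real) \<Rightarrow> real" where
  "limit_transform s = (\<Sum>T\<in>max_vectors \<mu> p \<S>. vector_weight \<mu> p \<S> T * prefix_prod (share_factor s) {} T)
     / (\<Sum>T\<in>max_vectors \<mu> p \<S>. vector_weight \<mu> p \<S> T)"

lemma line_mass_limit:
  assumes s: "\<And>S. s S \<ge> 0" and lim: "\<And>A. A \<subseteq> \<S> \<Longrightarrow> ((\<lambda>\<rho>. h \<rho> A) \<longlongrightarrow> h' A) (at_left 1)"
  shows "((\<lambda>\<rho>. (1 - \<rho>) ^ K * line_mass (h \<rho>) \<rho> s) \<longlongrightarrow>
     (\<Sum>T\<in>max_vectors \<mu> p \<S>. h' (set T) * (vector_weight \<mu> p \<S> T * prefix_prod (share_factor s) {} T))) (at_left 1)"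
proof -
  let ?P = "\<lambda>\<rho> T. (1 - \<rho>) ^ K * prefix_prod (order_factor (\<lambda>S. \<rho> * \<kappa> * p S * exp (- ((1 - \<rho>) * s S))) cr) {} T"
  have "((\<lambda>\<rho>. \<Sum>T\<in>ordered_vectors \<S>. h \<rho> (set T) * ?P \<rho> T) \<longlongrightarrow>
      (\<Sum>T\<in>ordered_vectors \<S>. h' (set T) * (of_bool (T \<in> max_vectors \<mu> p \<S>) *
         (vector_weight \<mu> p \<S> T * prefix_prod (share_factor s) {} T)))) (at_left 1)"
    by (intro tendsto_sum tendsto_mult[OF lim prefix_prod_limit[OF _ s]]) (auto simp: ordered_vectors_def)
  also have "(\<lambda>\<rho>. \<Sum>T\<in>ordered_vectors \<S>. h \<rho> (set T) * ?P \<rho> T) = (\<lambda>\<rho>. (1 - \<rho>) ^ K * line_mass (h \<rho>) \<rho> s)"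
    by (simp add: line_mass_def sum_distrib_left mult_ac)
  also have "(\<Sum>T\<in>ordered_vectors \<S>. h' (set T) * (of_bool (T \<in> max_vectors \<mu> p \<S>) *
         (vector_weight \<mu> p \<S> T * prefix_prod (share_factor s) {} T)))
    = (\<Sum>T\<in>max_vectors \<mu> p \<S>. h' (set T) * (vector_weight \<mu> p \<S> T * prefix_prod (share_factor s) {} T))"
    by (rule sum.mono_neutral_cong_right) (use finite_ordered_vectors in \<open>auto simp: vectors_with_def\<close>)
  finally show ?thesis .
qed

text \<open>\<open>h\<close> may vary with \<rho>, as the idle-server weight depends on the arrival
  rate. Scaling numerator and denominator by \<open>(1 - \<rho>) ^ K\<close> gives both a finite
  limit, the second one positive.\<close>

lemma line_transform_limit:
  assumes s: "\<And>S. s S \<ge> 0" and ne: "max_vectors \<mu> p \<S> \<noteq> {}"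
    and lim: "\<And>A. A \<subseteq> \<S> \<Longrightarrow> ((\<lambda>\<rho>. h \<rho> A) \<longlongrightarrow> h' A) (at_left 1)"
    and h': "\<And>A. A \<subseteq> \<S> \<Longrightarrow> h' A > 0"
  shows "((\<lambda>\<rho>. line_mass (h \<rho>) \<rho> s / line_mass (h \<rho>) \<rho> (\<lambda>_. 0)) \<longlongrightarrow> limit_transform s) (at_left 1)"
proof -
  have sh0: "prefix_prod (share_factor (\<lambda>_. 0)) {} T = 1" for T
  proof -
    have "prefix_prod (share_factor (\<lambda>_. 0)) A T = 1" for A
      by (induction T arbitrary: A) (simp_all add: share_factor_def)
    then show ?thesis .
  qed
  have pos: "(\<Sum>T\<in>max_vectors \<mu> p \<S>. h' (set T) * vector_weight \<mu> p \<S> T) > 0"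
    by (rule sum_pos[OF finite_max_vectors ne], intro mult_pos_pos h' vector_weight_pos)
       (auto simp: vectors_with_def ordered_vectors_def)
  have "((\<lambda>\<rho>. ((1 - \<rho>) ^ K * line_mass (h \<rho>) \<rho> s) / ((1 - \<rho>) ^ K * line_mass (h \<rho>) \<rho> (\<lambda>_. 0))) \<longlongrightarrow>
     (\<Sum>T\<in>max_vectors \<mu> p \<S>. h' (set T) * (vector_weight \<mu> p \<S> T * prefix_prod (share_factor s) {} T))
     / (\<Sum>T\<in>max_vectors \<mu> p \<S>. h' (set T) * vector_weight \<mu> p \<S> T)) (at_left 1)"
    using line_mass_limit[of "\<lambda>_. 0" h h', OF _ lim] pos
    by (intro tendsto_divide line_mass_limit[OF s lim]) (simp_all add: sh0)
  also have "(\<Sum>T\<in>max_vectors \<mu> p \<S>. h' (set T) * (vector_weight \<mu> p \<S> T * prefix_prod (share_factor s) {} T))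
     / (\<Sum>T\<in>max_vectors \<mu> p \<S>. h' (set T) * vector_weight \<mu> p \<S> T) = limit_transform s"
    unfolding limit_transform_def by (rule max_vectors_factor[OF h' ne])
  finally show ?thesis
  proof (rule Lim_transform_eventually)
    show "\<forall>\<^sub>F \<rho> in at_left 1. (1 - \<rho>) ^ K * line_mass (h \<rho>) \<rho> s / ((1 - \<rho>) ^ K * line_mass (h \<rho>) \<rho> (\<lambda>_. 0))
        = line_mass (h \<rho>) \<rho> s / line_mass (h \<rho>) \<rho> (\<lambda>_. 0)"
      by (auto simp: eventually_at_filter)
  qed
qed

end

section \<open>Convergence of Laplace transforms implies weak convergence\<close>

text \<open>Turns Laplace transforms at natural arguments into moments of a law on the cube.\<close>

definition exp_neg :: "real ^ 'k \<Rightarrow> real ^ 'k" where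
  "exp_neg x = (\<chi> i. exp (- (x $ i)))"

definition unit_cube :: "(real ^ 'k) set" where
  "unit_cube = {y. \<forall>i. 0 \<le> y $ i \<and> y $ i \<le> 1}"

text \<open>For \<open>d > 0\<close> continuous everywhere, and inverse to \<open>exp_neg\<close>
  where all coordinates are at least \<open>d\<close>.\<close>

definition clip :: "real \<Rightarrow> real ^ 'k \<Rightarrow> real ^ 'k" where
  "clip d y = (\<chi> i. - ln (max (y $ i) d))"

text \<open>For \<open>d > 0\<close> it vanishes once some coordinate is at most \<open>d\<close>
  and equals 1 when all are at least \<open>2 * d\<close>.\<close>

definition cutoff :: "real \<Rightarrow> real ^ 'k \<Rightarrow> real" where
  "cutoff d y = (\<Prod>i\<in>UNIV. min 1 (max 0 (y $ i / d - 1)))"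

lemma unit_cube_eq_cbox: "unit_cube = cbox 0 (\<chi> i. 1)"
  by (auto simp: unit_cube_def mem_box_cart)

lemma compact_unit_cube: "compact (unit_cube :: (real ^ 'k::finite) set)"
  by (simp add: unit_cube_eq_cbox)

lemma exp_neg_in_unit_cube: "(\<And>i. x $ i \<ge> 0) \<Longrightarrow> exp_neg x \<in> unit_cube"
  by (simp add: unit_cube_def exp_neg_def)

lemma continuous_exp_neg: "continuous_on UNIV (exp_neg :: real ^ 'k::finite \<Rightarrow> _)"
  unfolding exp_neg_def by (intro continuous_intros)

lemma continuous_clip: "d > 0 \<Longrightarrow> continuous_on UNIV (clip d :: real ^ 'k::finite \<Rightarrow> _)"
  unfolding clip_def by (intro continuous_intros) (auto simp: max_def)

lemma continuous_cutoff: "continuous_on UNIV (cutoff d :: real ^ 'k::finite \<Rightarrow> _)"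
  unfolding cutoff_def by (cases "d = 0") (auto intro!: continuous_intros)

lemma cutoff_bounds: "0 \<le> cutoff d y" "cutoff d y \<le> 1"
  unfolding cutoff_def by (auto intro!: prod_nonneg prod_le_1)

lemma clip_exp_neg:
  assumes "d > 0" "cutoff d (exp_neg x) \<noteq> 0"
  shows "clip d (exp_neg x) = x"
proof -
  have "max (exp (- (x $ i))) d = exp (- (x $ i))" for i
  proof -
    have "min 1 (max 0 (exp_neg x $ i / d - 1)) \<noteq> 0"
      using assms(2) unfolding cutoff_def by auto
    then have "exp_neg x $ i / d > 1" by auto
    then show ?thesis using assms(1) by (simp add: exp_neg_def pos_less_divide_eq max_def)
  qed
  then show ?thesis by (simp add: clip_def exp_neg_def vec_eq_iff)
qed

lemma cutoff_exp_neg_tendsto: "(\<lambda>n. cutoff (1 / real (Suc n)) (exp_neg x)) \<longlonglongrightarrow> 1" for x :: "real ^ 'k::finite"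
proof -
  have "(\<lambda>n. min 1 (max 0 (exp_neg x $ i / (1 / real (Suc n)) - 1))) \<longlonglongrightarrow> 1" for i
  proof (rule tendsto_eventually)
    have "\<forall>\<^sub>F n in sequentially. real n \<ge> 2 / exp_neg x $ i"
      using filterlim_real_sequentially by (simp add: filterlim_at_top)
    then show "\<forall>\<^sub>F n in sequentially. min 1 (max 0 (exp_neg x $ i / (1 / real (Suc n)) - 1)) = 1"
    proof eventually_elim
      case (elim n)
      have "exp_neg x $ i > 0" by (simp add: exp_neg_def)
      with elim have "exp_neg x $ i * real n \<ge> 2" by (simp add: pos_divide_le_eq mult.commute)
      with \<open>exp_neg x $ i > 0\<close> have "exp_neg x $ i * real (Suc n) \<ge> 2" by (simp add: distrib_left)
      then show ?case by simp
    qed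
  qed
  then have "(\<lambda>n. \<Prod>i\<in>UNIV. min 1 (max 0 (exp_neg x $ i / (1 / real (Suc n)) - 1))) \<longlonglongrightarrow> (\<Prod>i\<in>(UNIV::'k set). 1)"
    by (intro tendsto_prod)
  then show ?thesis by (simp add: cutoff_def)
qed

section \<open>From transforms at natural arguments to continuous test functions\<close>

context
  fixes D :: "'i \<Rightarrow> (real ^ 'k::finite) measure" and D' :: "(real ^ 'k) measure" and F :: "'i filter"
  assumes prob: "\<And>i. prob_space (D i)" "prob_space D'"
    and sets: "\<And>i. sets (D i) = sets borel" "sets D' = sets borel"
    and nonneg: "\<And>i. AE x in D i. \<forall>j. x $ j \<ge> 0" "AE x in D'. \<forall>j. x $ j \<ge> 0"
    and laplace: "\<And>a :: 'k \<Rightarrow> nat.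
      ((\<lambda>i. \<integral>x. exp (- (\<Sum>j\<in>UNIV. real (a j) * x $ j)) \<partial>D i) \<longlongrightarrow> (\<integral>x. exp (- (\<Sum>j\<in>UNIV. real (a j) * x $ j)) \<partial>D')) F"
begin

definition converging :: "(real ^ 'k \<Rightarrow> real) \<Rightarrow> bool" where
  "converging g \<longleftrightarrow> ((\<lambda>i. \<integral>x. g (exp_neg x) \<partial>D i) \<longlongrightarrow> (\<integral>x. g (exp_neg x) \<partial>D')) F"

lemma borel_exp_neg:
  fixes g :: "real ^ 'k \<Rightarrow> real"
  assumes "continuous_on UNIV g"
  shows "(\<lambda>x. g (exp_neg x)) \<in> borel_measurable borel"
  using continuous_on_compose2[OF assms continuous_exp_neg] by (simp add: borel_measurable_continuous_onI)

lemma integrable_exp_neg: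
  fixes g :: "real ^ 'k \<Rightarrow> real"
  assumes g: "continuous_on UNIV g" and N: "prob_space N" "sets N = sets borel" "AE x in N. \<forall>j. x $ j \<ge> 0"
  shows "integrable N (\<lambda>x. g (exp_neg x))"
proof -
  have "compact (g ` unit_cube)"
    by (intro compact_continuous_image compact_unit_cube continuous_on_subset[OF g]) simp
  then have "\<exists>B. \<forall>z\<in>g ` unit_cube. norm z \<le> B"
    by (simp only: compact_imp_bounded flip: bounded_iff)
  then obtain B where B: "\<And>y. y \<in> unit_cube \<Longrightarrow> \<bar>g y\<bar> \<le> B"
    by auto
  interpret prob_space N by (rule N)
  show ?thesis
  proof (rule integrable_const_bound)
    show "AE x in N. norm (g (exp_neg x)) \<le> B"
      using N(3) by eventually_elim (auto intro!: B exp_neg_in_unit_cube)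
    show "(\<lambda>x. g (exp_neg x)) \<in> borel_measurable N"
      using borel_exp_neg[OF g] by (simp cong: measurable_cong_sets add: N(2))
  qed
qed

lemmas integrable_D = integrable_exp_neg[OF _ prob(1) sets(1) nonneg(1)]
lemmas integrable_D' = integrable_exp_neg[OF _ prob(2) sets(2) nonneg(2)]

text \<open>Convergence of integrals is not preserved by products. Quantifying over an additional
  monomial makes the property stable under multiplication by a coordinate, hence by any
  polynomial.\<close>

definition monomial_stable :: "(real ^ 'k \<Rightarrow> real) \<Rightarrow> bool" where
  "monomial_stable h \<longleftrightarrow> continuous_on UNIV h \<and> (\<forall>a. converging (\<lambda>y. h y * (\<Prod>j\<in>UNIV. y $ j ^ a j)))"

lemma monomial_stable_one: "monomial_stable (\<lambda>_. 1)"
proof -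
  have "(\<Prod>j\<in>UNIV. exp_neg x $ j ^ a j) = exp (- (\<Sum>j\<in>UNIV. real (a j) * x $ j))" for x :: "real ^ 'k" and a
    by (simp add: exp_neg_def exp_of_nat_mult[symmetric] exp_sum[symmetric] sum_negf[symmetric])
  then show ?thesis using laplace by (simp add: monomial_stable_def converging_def)
qed

lemma monomial_stable_add:
  assumes "monomial_stable g" "monomial_stable h"
  shows "monomial_stable (\<lambda>y. g y + h y)"
proof -
  have cg: "continuous_on UNIV g" and ch: "continuous_on UNIV h"
    using assms by (auto simp: monomial_stable_def)
  have "converging (\<lambda>y. (g y + h y) * (\<Prod>j\<in>UNIV. y $ j ^ a j))" for a :: "'k \<Rightarrow> nat"
  proof -
    let ?m = "\<lambda>y::real^'k. \<Prod>j\<in>UNIV. y $ j ^ a j"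
    have c: "continuous_on UNIV (\<lambda>y. g y * ?m y)" "continuous_on UNIV (\<lambda>y. h y * ?m y)"
      by (intro continuous_intros cg ch)+
    have "converging (\<lambda>y. g y * ?m y)" "converging (\<lambda>y. h y * ?m y)"
      using assms by (auto simp: monomial_stable_def)
    then show ?thesis
      unfolding converging_def distrib_right
      using integrable_D[OF c(1)] integrable_D[OF c(2)] integrable_D'[OF c(1)] integrable_D'[OF c(2)]
      by (simp add: tendsto_add)
  qed
  then show ?thesis using cg ch by (auto simp: monomial_stable_def intro: continuous_on_add)
qed

lemma monomial_stable_cmult:
  assumes "monomial_stable h"
  shows "monomial_stable (\<lambda>y. c * h y)"
  using assms unfolding monomial_stable_def converging_def mult.assoc
  by (auto intro!: continuous_intros tendsto_mult)

lemma monomial_stable_component: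
  assumes "monomial_stable h"
  shows "monomial_stable (\<lambda>y. y $ k * h y)"
proof -
  have ch: "continuous_on UNIV h" using assms by (simp add: monomial_stable_def)
  have "converging (\<lambda>y. y $ k * h y * (\<Prod>j\<in>UNIV. y $ j ^ a j))" for a
  proof -
    have "y $ k * h y * (\<Prod>j\<in>UNIV. y $ j ^ a j) = h y * (\<Prod>j\<in>UNIV. y $ j ^ (a(k := Suc (a k))) j)" for y :: "real ^ 'k"
    proof -
      have "(\<Prod>j\<in>UNIV. y $ j ^ (a(k := Suc (a k))) j) = y $ k * (\<Prod>j\<in>UNIV. y $ j ^ a j)"
        by (simp add: prod.remove[of UNIV k])
      then show ?thesis by simp
    qed
    then have "(\<lambda>y. y $ k * h y * (\<Prod>j\<in>UNIV. y $ j ^ a j)) = (\<lambda>y. h y * (\<Prod>j\<in>UNIV. y $ j ^ (a(k := Suc (a k))) j))"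
      by (rule ext)
    then show ?thesis using assms unfolding monomial_stable_def by (simp only:)
  qed
  moreover have "continuous_on UNIV (\<lambda>y. y $ k * h y)" by (intro continuous_intros ch)
  ultimately show ?thesis by (simp add: monomial_stable_def)
qed

text \<open>\<open>h\<close> is generalized so that the product case is mere reassociation. The
  generators are linear functionals, which are expanded in the coordinates.\<close>

lemma monomial_stable_polynomial:
  assumes "real_polynomial_function g" "monomial_stable h"
  shows "monomial_stable (\<lambda>y. g y * h y)"
  using assms
proof (induction arbitrary: h rule: real_polynomial_function.induct)
  case (linear f)
  have f: "f y = (\<Sum>k\<in>UNIV. f (axis k 1) * y $ k)" for y
  proof -
    have "(\<Sum>k\<in>UNIV. y $ k *\<^sub>R axis k 1) = y"
      using basis_expansion[of y] by (simp add: scalar_mult_eq_scaleR)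
    then have "f y = f (\<Sum>k\<in>UNIV. y $ k *\<^sub>R axis k 1)" by simp
    also have "\<dots> = (\<Sum>k\<in>UNIV. f (axis k 1) * y $ k)"
      using linear(1) by (simp add: linear_sum linear_cmul bounded_linear.linear mult.commute)
    finally show ?thesis .
  qed
  have "monomial_stable (\<lambda>y. \<Sum>k\<in>I. f (axis k 1) * (y $ k * h y))" if "finite I" for I
    using that
  proof (induction I rule: finite_induct)
    case empty
    show ?case using monomial_stable_cmult[OF linear(2), of 0] by simp
  next
    case (insert k I)
    then show ?case
      by (simp add: monomial_stable_add monomial_stable_cmult monomial_stable_component linear(2))
  qed
  from this[of UNIV] show ?case by (subst f) (simp add: sum_distrib_right mult.assoc)
next
  case (const c)
  then show ?case by (rule monomial_stable_cmult)
next
  case (add f g)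
  then show ?case by (simp add: distrib_right monomial_stable_add)
next
  case (mult f g)
  then show ?case by (simp add: mult.assoc)
qed

text \<open>Almost every \<open>x\<close> has non-negative coordinates and is mapped into the
  compact cube, where a polynomial is uniformly close to \<open>g\<close>; the error bound is the
  same for all the laws involved.\<close>

lemma converging_continuous:
  assumes g: "continuous_on UNIV g"
  shows "converging g"
  unfolding converging_def tendsto_iff
proof (intro allI impI)
  fix e :: real assume e: "e > 0"
  obtain q where q: "real_polynomial_function q" "\<And>y. y \<in> unit_cube \<Longrightarrow> \<bar>g y - q y\<bar> < e / 3"
    using Stone_Weierstrass_real_polynomial_function[OF compact_unit_cube continuous_on_subset[OF g], of "e / 3"] e
    by auto
  have cq: "continuous_on UNIV q"
    using q(1) by (simp add: continuous_on_polymonial_function real_polynomial_function_eq)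
  have "monomial_stable (\<lambda>y. q y * 1)"
    by (rule monomial_stable_polynomial[OF q(1) monomial_stable_one])
  then have "converging (\<lambda>y. q y * 1 * (\<Prod>j\<in>UNIV. y $ j ^ a j))" for a
    by (simp add: monomial_stable_def)
  from this[of "\<lambda>_. 0"] have "converging q" by simp
  then have ev: "\<forall>\<^sub>F i in F. dist (\<integral>x. q (exp_neg x) \<partial>D i) (\<integral>x. q (exp_neg x) \<partial>D') < e / 3"
    unfolding converging_def tendsto_iff by (rule allE[of _ "e / 3"]) (use e in simp)
  have close: "\<bar>(\<integral>x. g (exp_neg x) \<partial>N) - (\<integral>x. q (exp_neg x) \<partial>N)\<bar> \<le> e / 3"
    if N: "prob_space N" "sets N = sets borel" "AE x in N. \<forall>j. x $ j \<ge> 0" for N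
  proof -
    interpret prob_space N by (rule N)
    have i: "integrable N (\<lambda>x. g (exp_neg x))" "integrable N (\<lambda>x. q (exp_neg x))"
      by (intro integrable_exp_neg g cq N)+
    have "\<bar>\<integral>x. g (exp_neg x) - q (exp_neg x) \<partial>N\<bar> \<le> (\<integral>x. \<bar>g (exp_neg x) - q (exp_neg x)\<bar> \<partial>N)"
      by (rule integral_abs_bound)
    also have "\<dots> \<le> (\<integral>x. e / 3 \<partial>N)"
    proof (rule integral_mono_AE)
      show "AE x in N. \<bar>g (exp_neg x) - q (exp_neg x)\<bar> \<le> e / 3"
        using N(3)
      proof eventually_elim
        case (elim x)
        then have "exp_neg x \<in> unit_cube" by (intro exp_neg_in_unit_cube) simp
        then show ?case using q(2) by (intro less_imp_le)
      qed
    qed (use i in auto)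
    finally show ?thesis using i by (simp add: prob_space)
  qed
  from ev show "\<forall>\<^sub>F i in F. dist (\<integral>x. g (exp_neg x) \<partial>D i) (\<integral>x. g (exp_neg x) \<partial>D') < e"
  proof eventually_elim
    case (elim i)
    then show ?case
      using close[OF prob(1) sets(1) nonneg(1), of i] close[OF prob(2) sets(2) nonneg(2)]
      unfolding dist_real_def by linarith
  qed
qed

text \<open>
  A test function is continuous in \<open>exp_neg x\<close> only away from the boundary of the cube; the cutoff
  controls the mass near the boundary, where some coordinate of \<open>x\<close> is large.
\<close>

lemma laplace_imp_weakly_converges: "weakly_converges D D' F"
  unfolding weakly_converges_def
proof (intro allI impI)
  fix f :: "real ^ 'k \<Rightarrow> real" assume f: "continuous_on UNIV f \<and> bounded (range f)"
  then obtain B where B: "\<And>x. \<bar>f x\<bar> \<le> B" by (auto simp: bounded_iff)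
  have B0: "B \<ge> 0" using B[of 0] by simp
  have cont: "continuous_on UNIV (\<lambda>y. f (clip d y))" if "d > 0" for d
    using continuous_on_compose2[OF _ continuous_clip[OF that], of UNIV f] f by auto
  have diff: "\<bar>(\<integral>x. f x \<partial>N) - (\<integral>x. f (clip d (exp_neg x)) \<partial>N)\<bar> \<le> 2 * B * (1 - (\<integral>x. cutoff d (exp_neg x) \<partial>N))"
    if N: "prob_space N" "sets N = sets borel" "AE x in N. \<forall>j. x $ j \<ge> 0" and d: "d > 0" for N d
  proof -
    interpret prob_space N by (rule N)
    have i: "integrable N (\<lambda>x. f (clip d (exp_neg x)))" "integrable N (\<lambda>x. cutoff d (exp_neg x))"
      by (intro integrable_exp_neg cont continuous_cutoff N d)+
    have "f \<in> borel_measurable borel" using f by (auto intro: borel_measurable_continuous_onI)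
    then have "f \<in> borel_measurable N" by (simp cong: measurable_cong_sets add: N(2))
    then have fi: "integrable N f" by (intro integrable_const_bound[where B=B]) (auto simp: B)
    \<comment> \<open>Where the cutoff is nonzero, clipping recovers \<open>x\<close> and the left
      side is 0; elsewhere the two values of \<open>f\<close> differ by at most
      \<open>2 * B\<close>.\<close>
    have pt: "\<bar>f x - f (clip d (exp_neg x))\<bar> \<le> 2 * B * (1 - cutoff d (exp_neg x))" for x
    proof (cases "cutoff d (exp_neg x) = 0")
      case True
      then show ?thesis using B[of x] B[of "clip d (exp_neg x)"] by simp
    next
      case False
      then show ?thesis using clip_exp_neg[OF d False] B0 cutoff_bounds(2)[of d "exp_neg x"] by simp
    qed
    have "\<bar>\<integral>x. f x - f (clip d (exp_neg x)) \<partial>N\<bar> \<le> (\<integral>x. \<bar>f x - f (clip d (exp_neg x))\<bar> \<partial>N)"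
      by (rule integral_abs_bound)
    also have "\<dots> \<le> (\<integral>x. 2 * B * (1 - cutoff d (exp_neg x)) \<partial>N)"
      by (rule integral_mono) (use fi i pt in auto)
    finally show ?thesis using fi i by (simp add: prob_space)
  qed
  show "((\<lambda>i. \<integral>x. f x \<partial>D i) \<longlongrightarrow> (\<integral>x. f x \<partial>D')) F"
    unfolding tendsto_iff
  proof (intro allI impI)
    fix e :: real assume e: "e > 0"
    interpret D': prob_space D' by (rule prob)
    \<comment> \<open>\<open>d\<close> is chosen from the limit law alone. Since the cutoff is a
      continuous function of \<open>exp_neg x\<close>, the smallness of the lost mass passes to the
      laws \<open>D i\<close>; this is the source of tightness.\<close>
    have "(\<lambda>n. \<integral>x. cutoff (1 / real (Suc n)) (exp_neg x) \<partial>D') \<longlonglongrightarrow> (\<integral>x. 1 \<partial>D')"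
    proof (rule integral_dominated_convergence[where w="\<lambda>_. 1"])
      show "(\<lambda>x. cutoff (1 / real (Suc n)) (exp_neg x)) \<in> borel_measurable D'" for n
        using integrable_D'[OF continuous_cutoff] by blast
      show "AE x in D'. (\<lambda>n. cutoff (1 / real (Suc n)) (exp_neg x)) \<longlonglongrightarrow> 1"
        by (intro AE_I2 cutoff_exp_neg_tendsto)
    qed (auto simp: cutoff_bounds)
    then have "(\<lambda>n. 2 * B * (1 - (\<integral>x. cutoff (1 / real (Suc n)) (exp_neg x) \<partial>D'))) \<longlonglongrightarrow> 2 * B * (1 - 1)"
      by (intro tendsto_intros) (simp add: D'.prob_space)
    then have "\<forall>\<^sub>F n in sequentially. 2 * B * (1 - (\<integral>x. cutoff (1 / real (Suc n)) (exp_neg x) \<partial>D')) < e / 4"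
      by (rule order_tendstoD) (use e in simp)
    then obtain n where "2 * B * (1 - (\<integral>x. cutoff (1 / real (Suc n)) (exp_neg x) \<partial>D')) < e / 4"
      by (auto simp: eventually_sequentially)
    then obtain d where d: "d > 0" "2 * B * (1 - (\<integral>x. cutoff d (exp_neg x) \<partial>D')) < e / 4"
      by (metis of_nat_0_less_iff zero_less_Suc zero_less_divide_1_iff)
    have "((\<lambda>i. 2 * B * (1 - (\<integral>x. cutoff d (exp_neg x) \<partial>D i))) \<longlongrightarrow> 2 * B * (1 - (\<integral>x. cutoff d (exp_neg x) \<partial>D'))) F"
      using converging_continuous[OF continuous_cutoff[of d]] unfolding converging_def by (intro tendsto_intros)
    then have ev1: "\<forall>\<^sub>F i in F. 2 * B * (1 - (\<integral>x. cutoff d (exp_neg x) \<partial>D i)) < e / 4"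
      by (rule order_tendstoD) (rule d)
    have "\<forall>\<^sub>F i in F. dist (\<integral>x. f (clip d (exp_neg x)) \<partial>D i) (\<integral>x. f (clip d (exp_neg x)) \<partial>D') < e / 4"
      using converging_continuous[OF cont[OF d(1)]] unfolding converging_def tendsto_iff
      by (rule allE[of _ "e / 4"]) (use e in simp)
    with ev1 show "\<forall>\<^sub>F i in F. dist (\<integral>x. f x \<partial>D i) (\<integral>x. f x \<partial>D') < e"
    proof eventually_elim
      case (elim i)
      then show ?case
        using diff[OF prob(1) sets(1) nonneg(1) d(1), of i] diff[OF prob(2) sets(2) nonneg(2) d(1)] d(2) e
        unfolding dist_real_def by linarith
    qed
  qed
qed

end

section \<open>Transform of the limiting vector\<close>

text \<open>Tilting the unit exponential density gives the density of rate \<open>1 + b\<close>, up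
  to the factor \<open>1 / (1 + b)\<close>.\<close>

lemma (in prob_space) exponential_transform:
  assumes X: "distributed M lborel X (exponential_density 1)" and b: "b \<ge> (0::real)"
  shows "expectation (\<lambda>\<omega>. exp (- (b * X \<omega>))) = 1 / (1 + b)"
proof -
  have "expectation (\<lambda>\<omega>. exp (- (b * X \<omega>))) = (\<integral>x. exponential_density 1 x * exp (- (b * x)) \<partial>lborel)"
    by (rule distributed_integral[OF X, symmetric]) (auto simp: exponential_density_nonneg)
  also have "\<dots> = (\<integral>x. 1 / (1 + b) * exponential_density (1 + b) x \<partial>lborel)"
    using b by (intro Bochner_Integration.integral_cong)
      (auto simp: exponential_density_def exp_add[symmetric] field_simps)
  also have "\<dots> = 1 / (1 + b) * (\<integral>x. exponential_density (1 + b) x \<partial>lborel)"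
    by simp
  also have "(\<integral>x. exponential_density (1 + b) x \<partial>lborel) = 1"
  proof -
    have "prob_space (density lborel (exponential_density (1 + b)))"
      using b by (intro prob_space_exponential_density) simp
    then have "emeasure (density lborel (exponential_density (1 + b))) UNIV = 1"
      using prob_space.emeasure_space_1 by fastforce
    then have "(\<integral>\<^sup>+x. ennreal (exponential_density (1 + b) x) \<partial>lborel) = 1"
      by (simp add: emeasure_density)
    then show ?thesis
      using b by (subst integral_eq_nn_integral) (auto simp: exponential_density_nonneg)
  qed
  finally show ?thesis by simp
qed

text \<open>A nonempty set of extended naturals attains its infimum, and the empty set has infimum
  \<infinity>, so an absent type satisfies neither side.\<close>

lemma position_le_iff:
  assumes "i \<in> {1..length T}"
  shows "position S T \<le> enat i \<longleftrightarrow> S \<in> set (take i T)"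
proof -
  let ?X = "{enat j | j. j \<in> {1..length T} \<and> T ! (j - 1) = S}"
  have "position S T \<le> enat i \<longleftrightarrow> (\<exists>j\<in>{1..length T}. T ! (j - 1) = S \<and> j \<le> i)"
  proof
    assume *: "position S T \<le> enat i"
    have "?X \<noteq> {}"
    proof
      assume "?X = {}"
      then have "position S T = \<infinity>" unfolding position_def by (simp only: Inf_empty top_enat_def)
      with * show False by simp
    qed
    then have "Inf ?X \<in> ?X" by (rule wellorder_InfI[OF ex_in_conv[THEN iffD2, THEN someI_ex]])
    with * show "\<exists>j\<in>{1..length T}. T ! (j - 1) = S \<and> j \<le> i"
      unfolding position_def by auto
  next
    assume "\<exists>j\<in>{1..length T}. T ! (j - 1) = S \<and> j \<le> i"
    then obtain j where j: "enat j \<in> ?X" "enat j \<le> enat i" by auto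
    from Inf_lower[OF j(1)] j(2) show "position S T \<le> enat i"
      unfolding position_def by (rule order_trans)
  qed
  also have "\<dots> \<longleftrightarrow> S \<in> set (take i T)"
  proof
    assume "\<exists>j\<in>{1..length T}. T ! (j - 1) = S \<and> j \<le> i"
    then obtain j where "j \<in> {1..length T}" "T ! (j - 1) = S" "j \<le> i" by auto
    then show "S \<in> set (take i T)"
      by (auto simp: in_set_conv_nth intro!: exI[of _ "j - 1"])
  next
    assume "S \<in> set (take i T)"
    then obtain k where "k < length T" "k < i" "T ! k = S" by (auto simp: in_set_conv_nth)
    then show "\<exists>j\<in>{1..length T}. T ! (j - 1) = S \<and> j \<le> i"
      by (intro bexI[of _ "Suc k"]) auto
  qed
  finally show ?thesis .
qed

context parallel_servers
begin

lemma critical_position_in: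
  assumes T: "T \<in> max_vectors \<mu> p \<S>" and k: "k \<in> {1..K}"
  shows "critical_position \<mu> p \<S> T k \<in> critical_positions \<mu> p \<S> T"
proof -
  have "card (critical_positions \<mu> p \<S> T) = K" using T by (simp add: vectors_with_def)
  then have "k - 1 < length (sorted_list_of_set (critical_positions \<mu> p \<S> T))" using k by auto
  then have "critical_position \<mu> p \<S> T k \<in> set (sorted_list_of_set (critical_positions \<mu> p \<S> T))"
    unfolding critical_position_def by (rule nth_mem)
  then show ?thesis by (simp add: critical_positions_def)
qed

lemma prod_critical_position:
  assumes T: "T \<in> max_vectors \<mu> p \<S>"
  shows "(\<Prod>k\<in>{1..K}. f (critical_position \<mu> p \<S> T k)) = (\<Prod>i\<in>critical_positions \<mu> p \<S> T. f i)"
proof -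
  let ?C = "critical_positions \<mu> p \<S> T"
  let ?l = "sorted_list_of_set ?C"
  have fin: "finite ?C" by (simp add: critical_positions_def)
  have len: "length ?l = K" using T by (simp add: vectors_with_def)
  have "(\<Prod>k\<in>{1..K}. f (critical_position \<mu> p \<S> T k)) = (\<Prod>j<length ?l. f (?l ! j))"
    unfolding critical_position_def len by (rule prod.reindex_bij_witness[of _ Suc "\<lambda>k. k - 1"]) auto
  also have "\<dots> = (\<Prod>i\<in>set ?l. f i)"
    by (rule prod.reindex_bij_betw[OF bij_betw_nth]) auto
  finally show ?thesis using fin by simp
qed

lemma limit_share_eq:
  assumes T: "T \<in> max_vectors \<mu> p \<S>" and k: "k \<in> {1..K}"
  shows "limit_share \<mu> p \<S> k S T = (let A = set (take (critical_position \<mu> p \<S> T k) T)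
           in p S * of_bool (S \<in> A) / sum p A)"
proof -
  let ?i = "critical_position \<mu> p \<S> T k"
  have i: "?i \<in> {1..length T}"
    using critical_position_in[OF T k] by (simp add: critical_positions_def)
  have dist: "distinct T" using T by (simp add: vectors_with_def ordered_vectors_def)
  have "limit_share \<mu> p \<S> k S T = p S / p_upto p T ?i * of_bool (position S T \<le> enat ?i)"
    unfolding limit_share_def using T finite_max_vectors
    by (subst sum.mono_neutral_right[of _ "{T}"]) auto
  also have "\<dots> = p S * of_bool (S \<in> set (take ?i T)) / sum p (set (take ?i T))"
    using i by (simp only: position_le_iff[OF i] p_upto_eq[OF dist] atLeastAtMost_iff) simp
  finally show ?thesis by (simp add: Let_def)
qed

lemma limit_share_nonneg:
  assumes T: "T \<in> max_vectors \<mu> p \<S>" and k: "k \<in> {1..K}"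
  shows "limit_share \<mu> p \<S> k S T \<ge> 0"
proof -
  have sub: "set (take i T) \<subseteq> \<S>" for i
    using T set_take_subset[of i T] by (auto simp: vectors_with_def ordered_vectors_def)
  have "sum p (set (take i T)) \<ge> 0" for i
    using sub[of i] p_pos by (intro sum_nonneg) (auto intro: less_imp_le)
  moreover have "p S * of_bool (S \<in> set (take i T)) \<ge> 0" for i
    using sub[of i] p_pos[of S] by (cases "S \<in> set (take i T)") (auto intro: less_imp_le)
  ultimately show ?thesis
    unfolding limit_share_eq[OF T k] Let_def by (intro divide_nonneg_nonneg)
qed

text \<open>Given \<open>\<tau> = T\<close>, the coefficient of the \<open>k\<close>-th exponential
  variable in the \<open>s\<close>-combination of the limit is the \<open>p\<close>-weighted mean of
  \<open>s\<close> over the \<open>k\<close>-th critical prefix.\<close>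

lemma prod_limit_share:
  assumes T: "T \<in> max_vectors \<mu> p \<S>"
  shows "(\<Prod>k\<in>{1..K}. 1 / (1 + (\<Sum>S\<in>UNIV. s S * limit_share \<mu> p \<S> k S T))) = prefix_prod (share_factor s) {} T"
proof -
  have "(\<Sum>S\<in>UNIV. s S * limit_share \<mu> p \<S> k S T)
      = (\<Sum>S\<in>set (take (critical_position \<mu> p \<S> T k) T). s S * p S) / sum p (set (take (critical_position \<mu> p \<S> T k) T))"
    if k: "k \<in> {1..K}" for k
  proof -
    let ?A = "set (take (critical_position \<mu> p \<S> T k) T)"
    have "(\<Sum>S\<in>UNIV. s S * limit_share \<mu> p \<S> k S T) = (\<Sum>S\<in>?A. s S * p S / sum p ?A)"
      unfolding limit_share_eq[OF T k] Let_def by (rule sum.mono_neutral_cong_right) auto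
    then show ?thesis by (simp add: sum_divide_distrib)
  qed
  then have "(\<Prod>k\<in>{1..K}. 1 / (1 + (\<Sum>S\<in>UNIV. s S * limit_share \<mu> p \<S> k S T)))
      = (\<Prod>k\<in>{1..K}. 1 / (1 + (\<Sum>S\<in>set (take (critical_position \<mu> p \<S> T k) T). s S * p S)
           / sum p (set (take (critical_position \<mu> p \<S> T k) T))))"
    by (intro prod.cong refl) (simp only:)
  also have "\<dots> = (\<Prod>i\<in>critical_positions \<mu> p \<S> T. 1 / (1 + (\<Sum>S\<in>set (take i T). s S * p S) / sum p (set (take i T))))"
    by (rule prod_critical_position[OF T])
  also have "\<dots> = prefix_prod (share_factor s) {} T"
    unfolding prod_critical_positions[where f="\<lambda>A. 1 / (1 + (\<Sum>S\<in>A. s S * p S) / sum p A)"]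
    by (simp only: share_factor_def[abs_def])
  finally show ?thesis .
qed

context
  fixes M :: "'w measure" and \<tau> :: "'w \<Rightarrow> 'n set list" and U :: "nat \<Rightarrow> 'w \<Rightarrow> real"
  assumes M: "prob_space M"
    and \<tau>: "\<tau> \<in> measurable M (count_space (max_vectors \<mu> p \<S>))"
    and law: "\<And>T. T \<in> max_vectors \<mu> p \<S> \<Longrightarrow>
           measure M {\<omega> \<in> space M. \<tau> \<omega> = T} =
             vector_weight \<mu> p \<S> T / (\<Sum>T'\<in>max_vectors \<mu> p \<S>. vector_weight \<mu> p \<S> T')"
    and U: "\<And>k. k \<in> {1..K} \<Longrightarrow> distributed M lborel (U k) (exponential_density 1)"
    and indep_U: "prob_space.indep_vars M (\<lambda>_. borel) U {1..K}"
    and indep: "independent_variables M (count_space (max_vectors \<mu> p \<S>)) \<tau> (Pi\<^sub>M {1..K} (\<lambda>_. borel))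
           (\<lambda>\<omega>. restrict (\<lambda>k. U k \<omega>) {1..K})"
begin

interpretation prob_space M by (rule M)

lemma \<tau>_in: "\<omega> \<in> space M \<Longrightarrow> \<tau> \<omega> \<in> max_vectors \<mu> p \<S>"
  using measurable_space[OF \<tau>] by simp

text \<open>Read off from \<tau>: a random element on a nonempty space has a value, which spares the
  extension of a longest chain to a vector.\<close>

lemma max_vectors_nonempty: "max_vectors \<mu> p \<S> \<noteq> {}"
  using \<tau>_in not_empty by blast

lemma \<tau>_event: "T \<in> max_vectors \<mu> p \<S> \<Longrightarrow> {\<omega> \<in> space M. \<tau> \<omega> = T} \<in> events"
  using measurable_sets[OF \<tau>, of "{T}"] by (auto simp: vimage_def Int_def conj_commute)

lemma U_measurable: "k \<in> {1..K} \<Longrightarrow> U k \<in> borel_measurable M"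
  using distributed_measurable[OF U] by simp

text \<open>A finite sum of indicators times linear combinations of the \<open>U k\<close>, the form
  in which measurability is visible.\<close>

lemma limit_vector_decomp:
  assumes \<omega>: "\<omega> \<in> space M"
  shows "limit_vector \<mu> p \<S> (\<tau> \<omega>) (\<lambda>k. U k \<omega>) =
    (\<Sum>T\<in>max_vectors \<mu> p \<S>. indicator {\<omega> \<in> space M. \<tau> \<omega> = T} \<omega> *\<^sub>R (\<chi> S. \<Sum>k\<in>{1..K}. limit_share \<mu> p \<S> k S T * U k \<omega>))"
proof -
  have "(\<Sum>T\<in>max_vectors \<mu> p \<S>. indicator {\<omega> \<in> space M. \<tau> \<omega> = T} \<omega> *\<^sub>R (\<chi> S. \<Sum>k\<in>{1..K}. limit_share \<mu> p \<S> k S T * U k \<omega>))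
     = (\<Sum>T\<in>{\<tau> \<omega>}. indicator {\<omega> \<in> space M. \<tau> \<omega> = T} \<omega> *\<^sub>R (\<chi> S. \<Sum>k\<in>{1..K}. limit_share \<mu> p \<S> k S T * U k \<omega>))"
    by (rule sum.mono_neutral_right) (use \<tau>_in[OF \<omega>] finite_max_vectors in auto)
  then show ?thesis using \<omega> by (simp add: limit_vector_def)
qed

lemma limit_vector_measurable:
  "(\<lambda>\<omega>. limit_vector \<mu> p \<S> (\<tau> \<omega>) (\<lambda>k. U k \<omega>)) \<in> borel_measurable M"
proof -
  have "(\<lambda>\<omega>. \<Sum>T\<in>max_vectors \<mu> p \<S>. indicator {\<omega> \<in> space M. \<tau> \<omega> = T} \<omega> *\<^sub>R
      (\<chi> S. \<Sum>k\<in>{1..K}. limit_share \<mu> p \<S> k S T * U k \<omega>) :: real ^ 'n set) \<in> borel_measurable M"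
  proof (intro borel_measurable_sum borel_measurable_scaleR borel_measurable_indicator \<tau>_event)
    fix T
    have eq: "(\<chi> S. \<Sum>k\<in>{1..K}. limit_share \<mu> p \<S> k S T * U k \<omega>) =
        (\<Sum>k\<in>{1..K}. U k \<omega> *\<^sub>R (\<chi> S. limit_share \<mu> p \<S> k S T))" for \<omega>
      by (simp add: vec_eq_iff mult.commute)
    show "(\<lambda>\<omega>. \<chi> S. \<Sum>k\<in>{1..K}. limit_share \<mu> p \<S> k S T * U k \<omega> :: real ^ 'n set) \<in> borel_measurable M"
      unfolding eq by (intro borel_measurable_sum borel_measurable_scaleR borel_measurable_const U_measurable)
  qed
  then show ?thesis
    by (rule measurable_cong[THEN iffD1, rotated]) (simp only: limit_vector_decomp)
qed

lemma limit_vector_nonneg: "AE \<omega> in M. \<forall>S. limit_vector \<mu> p \<S> (\<tau> \<omega>) (\<lambda>k. U k \<omega>) $ S \<ge> 0"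
proof -
  have "AE \<omega> in M. 0 < U k \<omega>" if k: "k \<in> {1..K}" for k
    using exponential_distributedD_gt[OF U[OF k], of 0] prob_Collect_eq_1[of "\<lambda>\<omega>. 0 < U k \<omega>"] U_measurable[OF k]
    by simp
  then have "AE \<omega> in M. \<forall>k\<in>{1..K}. 0 < U k \<omega>" by (intro AE_finite_allI) auto
  then show ?thesis
  proof (rule AE_mp, intro AE_I2 impI allI)
    fix \<omega> S assume \<omega>: "\<omega> \<in> space M" and pos: "\<forall>k\<in>{1..K}. 0 < U k \<omega>"
    show "limit_vector \<mu> p \<S> (\<tau> \<omega>) (\<lambda>k. U k \<omega>) $ S \<ge> 0"
      unfolding limit_vector_def vec_lambda_beta
    proof (rule sum_nonneg)
      fix k assume k: "k \<in> {1..K}"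
      then have "U k \<omega> > 0" using pos by blast
      with limit_share_nonneg[OF \<tau>_in[OF \<omega>] k] show "limit_share \<mu> p \<S> k S (\<tau> \<omega>) * U k \<omega> \<ge> 0"
        by (intro mult_nonneg_nonneg) auto
    qed
  qed
qed

lemma expectation_indicator_times:
  assumes T: "T \<in> max_vectors \<mu> p \<S>" and b: "\<And>k. k \<in> {1..K} \<Longrightarrow> b k \<ge> 0"
  shows "expectation (\<lambda>\<omega>. indicator {\<omega> \<in> space M. \<tau> \<omega> = T} \<omega> * exp (- (\<Sum>k\<in>{1..K}. b k * U k \<omega>)))
     = prob {\<omega> \<in> space M. \<tau> \<omega> = T} * (\<Prod>k\<in>{1..K}. 1 / (1 + b k))"
    and "integrable M (\<lambda>\<omega>. indicator {\<omega> \<in> space M. \<tau> \<omega> = T} \<omega> * exp (- (\<Sum>k\<in>{1..K}. b k * U k \<omega>)))"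
proof -
  let ?R = "\<lambda>\<omega>. restrict (\<lambda>k. U k \<omega>) {1..K}"
  let ?I = "\<lambda>\<omega>. indicator {\<omega> \<in> space M. \<tau> \<omega> = T} \<omega> :: real"
  let ?Y = "\<lambda>\<omega>. exp (- (\<Sum>k\<in>{1..K}. b k * U k \<omega>))"
  let ?P = "Pi\<^sub>M {1..K} (\<lambda>_. borel :: real measure)"
  have R: "?R \<in> measurable M ?P" using indep by (simp add: independent_variables_def)
  have g: "(\<lambda>f. exp (- (\<Sum>k\<in>{1..K}. b k * f k))) \<in> borel_measurable ?P"
    by measurable
  have Y: "?Y = (\<lambda>f. exp (- (\<Sum>k\<in>{1..K}. b k * f k))) \<circ> ?R" by (auto simp: fun_eq_iff)
  have mY: "?Y \<in> borel_measurable M" unfolding Y by (rule measurable_comp[OF R g])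
  have mI: "?I \<in> borel_measurable M" by (intro borel_measurable_indicator \<tau>_event T)
  \<comment> \<open>Independence is given for \<tau> and the restricted family in their own spaces.
    Events of the two real variables are pulled back to events of these, and both families of events
    are closed under intersection, so the generated sigma-algebras are independent.\<close>
  have ind: "indep_var borel ?I borel ?Y"
    unfolding indep_var_eq
  proof (intro conjI mI mY indep_set_sigma_sets)
    show "indep_set {?I -` A \<inter> space M | A. A \<in> sets borel} {?Y -` A \<inter> space M | A. A \<in> sets borel}"
    proof (rule indep_setI)
      show "{?I -` A \<inter> space M | A. A \<in> sets borel} \<subseteq> events" using measurable_sets[OF mI] by auto
      show "{?Y -` A \<inter> space M | A. A \<in> sets borel} \<subseteq> events" using measurable_sets[OF mY] by auto
      fix a b' assume a: "a \<in> {?I -` A \<inter> space M | A. A \<in> sets borel}" and b': "b' \<in> {?Y -` A \<inter> space M | A. A \<in> sets borel}"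
      from a obtain A where A: "a = ?I -` A \<inter> space M" by blast
      have "a = \<tau> -` {t \<in> max_vectors \<mu> p \<S>. of_bool (t = T) \<in> A} \<inter> space M"
        using \<tau>_in by (auto simp: A indicator_def of_bool_def)
      moreover have "{t \<in> max_vectors \<mu> p \<S>. of_bool (t = T) \<in> A} \<in> sets (count_space (max_vectors \<mu> p \<S>))"
        by auto
      ultimately have a': "a \<in> {\<tau> -` E \<inter> space M | E. E \<in> sets (count_space (max_vectors \<mu> p \<S>))}" by blast
      from b' obtain B where B: "b' = ?Y -` B \<inter> space M" "B \<in> sets borel" by blast
      have "b' = ?R -` ((\<lambda>f. exp (- (\<Sum>k\<in>{1..K}. b k * f k))) -` B \<inter> space ?P) \<inter> space M"
        using measurable_space[OF R] by (auto simp: B(1))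
      moreover have "(\<lambda>f. exp (- (\<Sum>k\<in>{1..K}. b k * f k))) -` B \<inter> space ?P \<in> sets ?P"
        by (rule measurable_sets[OF g B(2)])
      ultimately have b'': "b' \<in> {?R -` E \<inter> space M | E. E \<in> sets ?P}" by blast
      show "prob (a \<inter> b') = prob a * prob b'"
        using indep unfolding independent_variables_def by (blast intro: indep_setD[OF _ a' b''])
    qed
    show "Int_stable {?I -` A \<inter> space M | A. A \<in> sets borel}"
      unfolding Int_stable_def by clarify (metis (no_types, lifting) sets.Int vimage_Int Int_assoc Int_commute Int_left_commute Int_absorb)
    show "Int_stable {?Y -` A \<inter> space M | A. A \<in> sets borel}"
      unfolding Int_stable_def by clarify (metis (no_types, lifting) sets.Int vimage_Int Int_assoc Int_commute Int_left_commute Int_absorb)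
  qed
  have AE_pos: "AE \<omega> in M. 0 < U k \<omega>" if k: "k \<in> {1..K}" for k
    using exponential_distributedD_gt[OF U[OF k], of 0] prob_Collect_eq_1[of "\<lambda>\<omega>. 0 < U k \<omega>"] U_measurable[OF k]
    by simp
  have int_k: "integrable M (\<lambda>\<omega>. exp (- (b k * U k \<omega>)))" if k: "k \<in> {1..K}" for k
  proof (rule integrable_const_bound[where B=1])
    show "AE \<omega> in M. norm (exp (- (b k * U k \<omega>))) \<le> 1"
      using AE_pos[OF k] by eventually_elim (use b[OF k] in simp)
    show "(\<lambda>\<omega>. exp (- (b k * U k \<omega>))) \<in> borel_measurable M"
      using U_measurable[OF k] by measurable
  qed
  have ind_k: "indep_vars (\<lambda>_. borel) (\<lambda>k \<omega>. exp (- (b k * U k \<omega>))) {1..K}"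
    by (rule indep_vars_compose2[OF indep_U]) measurable
  have Y_prod: "?Y = (\<lambda>\<omega>. \<Prod>k\<in>{1..K}. exp (- (b k * U k \<omega>)))"
    by (simp add: fun_eq_iff exp_sum[symmetric] sum_negf)
  have intY: "integrable M ?Y"
    unfolding Y_prod by (rule indep_vars_integrable[OF _ ind_k int_k]) auto
  have "expectation ?Y = (\<Prod>k\<in>{1..K}. expectation (\<lambda>\<omega>. exp (- (b k * U k \<omega>))))"
    unfolding Y_prod by (rule indep_vars_lebesgue_integral[OF _ ind_k int_k]) auto
  also have "\<dots> = (\<Prod>k\<in>{1..K}. 1 / (1 + b k))"
    by (intro prod.cong refl exponential_transform U b)
  finally have EY: "expectation ?Y = (\<Prod>k\<in>{1..K}. 1 / (1 + b k))" .
  have intI: "integrable M ?I" using \<tau>_event[OF T] by (simp add: integrable_indicator_iff emeasure_eq_measure)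
  show "integrable M (\<lambda>\<omega>. ?I \<omega> * ?Y \<omega>)"
    by (rule indep_var_integrable[OF ind intI intY])
  show "expectation (\<lambda>\<omega>. ?I \<omega> * ?Y \<omega>) = prob {\<omega> \<in> space M. \<tau> \<omega> = T} * (\<Prod>k\<in>{1..K}. 1 / (1 + b k))"
    using indep_var_lebesgue_integral[OF ind intI intY] EY \<tau>_event[OF T] by simp
qed

text \<open>Splitting over the finitely many values of \<tau> reduces the transform to products of
  exponential transforms.\<close>

lemma limit_vector_transform:
  assumes s: "\<And>S. s S \<ge> 0"
  shows "expectation (\<lambda>\<omega>. exp (- (\<Sum>S\<in>UNIV. s S * limit_vector \<mu> p \<S> (\<tau> \<omega>) (\<lambda>k. U k \<omega>) $ S))) = limit_transform s"
proof -
  let ?b = "\<lambda>T k. \<Sum>S\<in>UNIV. s S * limit_share \<mu> p \<S> k S T"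
  have b: "?b T k \<ge> 0" if "T \<in> max_vectors \<mu> p \<S>" "k \<in> {1..K}" for T k
    using s limit_share_nonneg[OF that] by (intro sum_nonneg mult_nonneg_nonneg)
  have "expectation (\<lambda>\<omega>. exp (- (\<Sum>S\<in>UNIV. s S * limit_vector \<mu> p \<S> (\<tau> \<omega>) (\<lambda>k. U k \<omega>) $ S)))
      = expectation (\<lambda>\<omega>. \<Sum>T\<in>max_vectors \<mu> p \<S>. indicator {\<omega> \<in> space M. \<tau> \<omega> = T} \<omega> * exp (- (\<Sum>k\<in>{1..K}. ?b T k * U k \<omega>)))"
  proof (rule Bochner_Integration.integral_cong[OF refl])
    fix \<omega> assume \<omega>: "\<omega> \<in> space M"
    have "(\<Sum>S\<in>UNIV. s S * limit_vector \<mu> p \<S> (\<tau> \<omega>) (\<lambda>k. U k \<omega>) $ S) = (\<Sum>k\<in>{1..K}. ?b (\<tau> \<omega>) k * U k \<omega>)"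
      unfolding limit_vector_def vec_lambda_beta sum_distrib_left sum_distrib_right
      by (subst sum.swap) (simp only: mult.assoc)
    moreover have "(\<Sum>T\<in>max_vectors \<mu> p \<S>. indicator {\<omega> \<in> space M. \<tau> \<omega> = T} \<omega> * exp (- (\<Sum>k\<in>{1..K}. ?b T k * U k \<omega>)))
        = (\<Sum>T\<in>{\<tau> \<omega>}. indicator {\<omega> \<in> space M. \<tau> \<omega> = T} \<omega> * exp (- (\<Sum>k\<in>{1..K}. ?b T k * U k \<omega>)))"
      by (rule sum.mono_neutral_right) (use \<tau>_in[OF \<omega>] finite_max_vectors in \<open>auto simp: indicator_def split: if_splits\<close>)
    ultimately show "exp (- (\<Sum>S\<in>UNIV. s S * limit_vector \<mu> p \<S> (\<tau> \<omega>) (\<lambda>k. U k \<omega>) $ S)) =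
        (\<Sum>T\<in>max_vectors \<mu> p \<S>. indicator {\<omega> \<in> space M. \<tau> \<omega> = T} \<omega> * exp (- (\<Sum>k\<in>{1..K}. ?b T k * U k \<omega>)))"
      using \<omega> by simp
  qed
  also have "\<dots> = (\<Sum>T\<in>max_vectors \<mu> p \<S>. prob {\<omega> \<in> space M. \<tau> \<omega> = T} * (\<Prod>k\<in>{1..K}. 1 / (1 + ?b T k)))"
  proof (subst Bochner_Integration.integral_sum)
    show "integrable M (\<lambda>\<omega>. indicator {\<omega> \<in> space M. \<tau> \<omega> = T} \<omega> * exp (- (\<Sum>k\<in>{1..K}. ?b T k * U k \<omega>)))"
      if "T \<in> max_vectors \<mu> p \<S>" for T
      by (rule expectation_indicator_times(2)[OF that b[OF that]])
    show "(\<Sum>T\<in>max_vectors \<mu> p \<S>. expectation (\<lambda>\<omega>. indicator {\<omega> \<in> space M. \<tau> \<omega> = T} \<omega> * exp (- (\<Sum>k\<in>{1..K}. ?b T k * U k \<omega>))))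
        = (\<Sum>T\<in>max_vectors \<mu> p \<S>. prob {\<omega> \<in> space M. \<tau> \<omega> = T} * (\<Prod>k\<in>{1..K}. 1 / (1 + ?b T k)))"
      by (rule sum.cong[OF refl], rule expectation_indicator_times(1), assumption, rule b)
  qed
  also have "\<dots> = limit_transform s"
    unfolding limit_transform_def sum_divide_distrib
    by (intro sum.cong refl) (simp only: prod_limit_share law times_divide_eq_left)
  finally show ?thesis .
qed

end

end

section \<open>Convergence of the queue lengths\<close>

definition idle_weight ::
    "('n::finite \<Rightarrow> real) \<Rightarrow> ('n set \<Rightarrow> real) \<Rightarrow> 'n set set \<Rightarrow> real \<Rightarrow> 'n set set \<Rightarrow> real" where
  "idle_weight \<mu> p \<S> lam A =
     (\<Sum>u | distinct u \<and> set u \<subseteq> \<Union>\<S> \<and> (\<forall>S\<in>A. S \<inter> set u = {}).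
        oi_weight \<mu> (idle_rate (\<lambda>S. real CARD('n) * lam * p S) \<S>) u)"

lemma pmf_bind_Pair:
  "pmf (bind_pmf \<alpha> (\<lambda>c. map_pmf (Pair c) (\<beta> c))) (c, u) = pmf \<alpha> c * pmf (\<beta> c) u"
proof -
  have "pmf (map_pmf (Pair c') (\<beta> c')) (c, u) = (if c' = c then pmf (\<beta> c) u else 0)" for c'
  proof (cases "c' = c")
    case True
    then show ?thesis by (simp add: pmf_map_inj' inj_def)
  next
    case False
    then have "(c, u) \<notin> Pair c' ` set_pmf (\<beta> c')" by auto
    with False show ?thesis by (simp add: pmf_map_outside)
  qed
  then have "pmf (bind_pmf \<alpha> (\<lambda>c. map_pmf (Pair c) (\<beta> c))) (c, u)
      = measure_pmf.expectation \<alpha> (\<lambda>c'. if c' = c then pmf (\<beta> c) u else 0)"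
    by (simp add: pmf_bind)
  also have "\<dots> = pmf \<alpha> c * pmf (\<beta> c) u"
    by (subst integral_measure_pmf[of "{c}"]) (auto split: if_splits)
  finally show ?thesis .
qed

lemma map_fst_bind_Pair: "map_pmf fst (bind_pmf \<alpha> (\<lambda>c. map_pmf (Pair c) (\<beta> c))) = \<alpha>"
  by (simp add: map_bind_pmf map_pmf_comp map_pmf_const bind_return_pmf')

context parallel_servers
begin

lemma finite_idle_orders: "finite {u. distinct u \<and> set u \<subseteq> \<Union>\<S> \<and> (\<forall>S\<in>A. S \<inter> set u = {})}"
  by (rule finite_subset[OF _ finite_subset_distinct[of "UNIV :: 'n set"]]) auto

lemma idle_oi_weight_pos:
  assumes lam: "lam > 0" and u: "set u \<subseteq> \<Union>\<S>"
  shows "oi_weight \<mu> (idle_rate (\<lambda>S. real CARD('n) * lam * p S) \<S>) u > 0"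
  unfolding oi_weight_def
proof (rule prefix_prod_pos)
  fix B x assume "x \<in> set u"
  then have "x \<in> \<Union>\<S>" using u by blast
  then have "idle_rate (\<lambda>S. real CARD('n) * lam * p S) \<S> (insert x B) > 0"
    by (intro idle_rate_pos[where \<mu> = \<mu> and p = p and \<S> = \<S> and lam = lam, OF \<mu>_pos S_nonempty p_pos lam])
  then show "\<mu> x / idle_rate (\<lambda>S. real CARD('n) * lam * p S) \<S> (insert x B) > 0"
    by (intro divide_pos_pos \<mu>_pos)
qed

lemma idle_weight_pos:
  assumes lam: "lam > 0"
  shows "idle_weight \<mu> p \<S> lam A > 0"
  unfolding idle_weight_def
proof (rule sum_pos[OF finite_idle_orders])
  have "[] \<in> {u. distinct u \<and> set u \<subseteq> \<Union>\<S> \<and> (\<forall>S\<in>A. S \<inter> set u = {})}" by simp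
  then show "{u. distinct u \<and> set u \<subseteq> \<Union>\<S> \<and> (\<forall>S\<in>A. S \<inter> set u = {})} \<noteq> {}" by blast
qed (use idle_oi_weight_pos[OF lam] in auto)

lemma idle_weight_tendsto:
  assumes lam: "((\<lambda>i. lam i) \<longlongrightarrow> lam') F" "lam' > 0"
  shows "((\<lambda>i. idle_weight \<mu> p \<S> (lam i) A) \<longlongrightarrow> idle_weight \<mu> p \<S> lam' A) F"
  unfolding idle_weight_def oi_weight_def
proof (intro tendsto_sum tendsto_prefix_prod)
  fix u :: "'n list" and B x
  assume "u \<in> {u. distinct u \<and> set u \<subseteq> \<Union>\<S> \<and> (\<forall>S\<in>A. S \<inter> set u = {})}" "x \<in> set u"
  then have "x \<in> \<Union>\<S>" by auto
  then have "idle_rate (\<lambda>S. real CARD('n) * lam' * p S) \<S> (insert x B) > 0"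
    by (intro idle_rate_pos[where \<mu> = \<mu> and p = p and \<S> = \<S> and lam = lam', OF \<mu>_pos S_nonempty p_pos lam(2)])
  then show "((\<lambda>i. \<mu> x / idle_rate (\<lambda>S. real CARD('n) * lam i * p S) \<S> (insert x B)) \<longlongrightarrow>
      \<mu> x / idle_rate (\<lambda>S. real CARD('n) * lam' * p S) \<S> (insert x B)) F"
    by (intro tendsto_divide tendsto_const) (auto simp: idle_rate_def intro!: tendsto_intros lam(1))
qed

abbreviation (input) "crate \<equiv> critical_rate \<mu> p \<S>"

lemma arrival_rate_eq: "(\<lambda>S. lam / crate * \<kappa> * p S) = (\<lambda>S. real CARD('n) * lam * p S)"
  using critical_rate_pos by auto

lemma coc_transform:
  assumes lam: "0 < lam" "lam < crate" and st: "coc_stationary \<mu> p \<S> lam \<pi>" and s: "\<And>S. s S \<ge> 0"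
  shows "measure_pmf.expectation \<pi> (\<lambda>x. exp (- ((1 - lam / crate) * (\<Sum>S\<in>UNIV. s S * real (coc_number x S)))))
     = line_mass (\<lambda>_. 1) (lam / crate) s / line_mass (\<lambda>_. 1) (lam / crate) (\<lambda>_. 0)"
proof -
  have \<rho>: "0 < lam / crate" "lam / crate < 1" using lam critical_rate_pos by simp_all
  obtain \<alpha> where \<alpha>: "\<And>c. pmf \<alpha> c = of_bool (c \<in> lists \<S>) * (1 * oi_weight (\<lambda>S. lam / crate * \<kappa> * p S) cr c)
      / line_mass (\<lambda>_. 1) (lam / crate) (\<lambda>_. 0)"
    using line_law_exists[OF \<rho>, of "\<lambda>_. 1"] by auto
  have \<alpha>': "pmf \<alpha> c = of_bool (c \<in> lists \<S>) * (1 / line_mass (\<lambda>_. 1) (lam / crate) (\<lambda>_. 0)) *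
      oi_weight (\<lambda>S. real CARD('n) * lam * p S) cr c" for c
    unfolding \<alpha> arrival_rate_eq by simp
  have "\<pi> = \<alpha>"
    by (rule coc_stationary_eq[where \<mu> = \<mu> and p = p and \<S> = \<S> and lam = lam, OF \<mu>_pos S_nonempty p_pos lam(1) st])
       (assumption, rule \<alpha>')
  then show ?thesis
    unfolding coc_number_def using line_law_transform[OF \<rho> s, of "\<lambda>_. 1" \<alpha>] \<alpha> by simp
qed

lemma cos_waiting_transform:
  assumes lam: "0 < lam" "lam < crate" and st: "cos_stationary \<mu> p \<S> lam \<pi>" and s: "\<And>S. s S \<ge> 0"
  shows "measure_pmf.expectation \<pi> (\<lambda>x. exp (- ((1 - lam / crate) * (\<Sum>S\<in>UNIV. s S * real (count_list (waiting x) S)))))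
     = line_mass (idle_weight \<mu> p \<S> lam) (lam / crate) s / line_mass (idle_weight \<mu> p \<S> lam) (lam / crate) (\<lambda>_. 0)"
proof -
  let ?h = "idle_weight \<mu> p \<S> lam"
  let ?w = "oi_weight \<mu> (idle_rate (\<lambda>S. real CARD('n) * lam * p S) \<S>)"
  let ?Z = "line_mass ?h (lam / crate) (\<lambda>_. 0)"
  let ?U = "\<lambda>A. {u. distinct u \<and> set u \<subseteq> \<Union>\<S> \<and> (\<forall>S\<in>A. S \<inter> set u = {})}"
  have \<rho>: "0 < lam / crate" "lam / crate < 1" using lam critical_rate_pos by simp_all
  have h: "?h A > 0" for A by (rule idle_weight_pos[OF lam(1)])
  obtain \<alpha> where \<alpha>: "\<And>c. pmf \<alpha> c = of_bool (c \<in> lists \<S>) * (?h (set c) * oi_weight (\<lambda>S. lam / crate * \<kappa> * p S) cr c) / ?Z"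
    using line_law_exists[OF \<rho>, of ?h] h by auto
  have "\<exists>\<beta>. \<forall>u. pmf \<beta> u = of_bool (u \<in> ?U A) * ?w u / ?h A" for A
  proof -
    have "(?w has_sum ?h A) (?U A)"
      unfolding idle_weight_def by (rule has_sum_finite[OF finite_idle_orders])
    moreover have "?w u \<ge> 0" if "u \<in> ?U A" for u
      using idle_oi_weight_pos[OF lam(1), of u] that by simp
    ultimately obtain \<beta> where "\<And>u. pmf \<beta> u = of_bool (u \<in> ?U A) * ?w u / ?h A"
      using pmf_of_has_sum[OF _ _ h, of ?w "?U A" A] by blast
    then show ?thesis by blast
  qed
  then obtain \<beta> where \<beta>: "\<And>A u. pmf (\<beta> A) u = of_bool (u \<in> ?U A) * ?w u / ?h A" by metis
  \<comment> \<open>Built in two stages: the line from \<alpha>, then the idle order given the types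
    in the line. The normalization of the second stage cancels the factor \<open>?h (set c)\<close>
    of the first, which leaves the product form, while the marginal of the line is \<alpha> by
    construction.\<close>
  define \<nu> where "\<nu> = bind_pmf \<alpha> (\<lambda>c. map_pmf (Pair c) (\<beta> (set c)))"
  have \<nu>: "pmf \<nu> (c, u) = of_bool ((c, u) \<in> waiting_idle_states \<S>) * (1 / ?Z) *
      oi_weight (\<lambda>S. real CARD('n) * lam * p S) cr c * ?w u" for c u
  proof -
    have "pmf \<nu> (c, u) = pmf \<alpha> c * pmf (\<beta> (set c)) u"
      unfolding \<nu>_def by (rule pmf_bind_Pair)
    moreover have "?h (set c) \<noteq> 0" using h[of "set c"] by simp
    moreover have "(c, u) \<in> waiting_idle_states \<S> \<longleftrightarrow> c \<in> lists \<S> \<and> u \<in> ?U (set c)"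
      by (auto simp: waiting_idle_states_def)
    ultimately show ?thesis unfolding \<alpha> \<beta> arrival_rate_eq by simp
  qed
  have "map_pmf (\<lambda>x. (waiting x, idle x)) \<pi> = \<nu>"
    by (rule cos_stationary_map_eq[where \<mu> = \<mu> and p = p and \<S> = \<S> and lam = lam, OF \<mu>_pos S_nonempty p_pos lam(1) st])
       (assumption, rule \<nu>)
  then have "map_pmf fst (map_pmf (\<lambda>x. (waiting x, idle x)) \<pi>) = \<alpha>"
    by (simp only: \<nu>_def map_fst_bind_Pair)
  then have "map_pmf waiting \<pi> = \<alpha>" by (simp add: map_pmf_comp)
  moreover have "measure_pmf.expectation \<alpha> (\<lambda>c. exp (- ((1 - lam / crate) * (\<Sum>S\<in>UNIV. s S * real (count_list c S)))))
     = line_mass ?h (lam / crate) s / ?Z"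
    by (rule line_law_transform[OF \<rho> s h \<alpha>])
  ultimately show ?thesis by (auto simp: integral_map_pmf)
qed

lemma rate_filterlim: "filterlim (\<lambda>lam. lam / crate) (at_left 1) (at_left crate)"
proof (rule filterlim_at[THEN iffD2], intro conjI)
  have "((\<lambda>lam. lam / crate) \<longlongrightarrow> crate / crate) (at_left crate)"
    using critical_rate_pos by (intro tendsto_intros) simp
  then show "((\<lambda>lam. lam / crate) \<longlongrightarrow> 1) (at_left crate)" using critical_rate_pos by simp
  show "\<forall>\<^sub>F lam in at_left crate. lam / crate \<in> {..<1} \<and> lam / crate \<noteq> 1"
    using critical_rate_pos by (auto simp: eventually_at_filter)
qed

lemma eventually_subcritical: "\<forall>\<^sub>F lam in at_left crate. 0 < lam \<and> lam < crate"
  using critical_rate_pos eventually_at_left_real[OF critical_rate_pos] by simp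

lemma coc_transform_limit:
  assumes ne: "max_vectors \<mu> p \<S> \<noteq> {}" and s: "\<And>S. s S \<ge> 0"
    and st: "\<And>lam. 0 < lam \<Longrightarrow> lam < crate \<Longrightarrow> coc_stationary \<mu> p \<S> lam (\<pi> lam)"
  shows "((\<lambda>lam. measure_pmf.expectation (\<pi> lam)
       (\<lambda>x. exp (- ((1 - lam / crate) * (\<Sum>S\<in>UNIV. s S * real (coc_number x S))))))
     \<longlongrightarrow> limit_transform s) (at_left crate)"
proof -
  have "((\<lambda>\<rho>. line_mass (\<lambda>_. 1) \<rho> s / line_mass (\<lambda>_. 1) \<rho> (\<lambda>_. 0)) \<longlongrightarrow> limit_transform s) (at_left 1)"
    by (rule line_transform_limit[OF s ne, where h = "\<lambda>_ _. 1" and h' = "\<lambda>_. 1"]) auto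
  from filterlim_compose[OF this rate_filterlim] show ?thesis
  proof (rule Lim_transform_eventually)
    show "\<forall>\<^sub>F lam in at_left crate. line_mass (\<lambda>_. 1) (lam / crate) s / line_mass (\<lambda>_. 1) (lam / crate) (\<lambda>_. 0)
        = measure_pmf.expectation (\<pi> lam)
           (\<lambda>x. exp (- ((1 - lam / crate) * (\<Sum>S\<in>UNIV. s S * real (coc_number x S)))))"
      using eventually_subcritical by eventually_elim (use coc_transform[OF _ _ st s] in simp)
  qed
qed

text \<open>The at most \<open>CARD('n)\<close> jobs in service vanish in the scaling limit.\<close>

lemma cos_transform_limit:
  assumes ne: "max_vectors \<mu> p \<S> \<noteq> {}" and s: "\<And>S. s S \<ge> 0"
    and st: "\<And>lam. 0 < lam \<Longrightarrow> lam < crate \<Longrightarrow> cos_stationary \<mu> p \<S> lam (\<pi> lam)"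
  shows "((\<lambda>lam. measure_pmf.expectation (\<pi> lam)
       (\<lambda>x. exp (- ((1 - lam / crate) * (\<Sum>S\<in>UNIV. s S * real (cos_number x S))))))
     \<longlongrightarrow> limit_transform s) (at_left crate)"
proof -
  let ?W = "\<lambda>lam. measure_pmf.expectation (\<pi> lam)
       (\<lambda>x. exp (- ((1 - lam / crate) * (\<Sum>S\<in>UNIV. s S * real (count_list (waiting x) S)))))"
  let ?Q = "\<lambda>lam. measure_pmf.expectation (\<pi> lam)
       (\<lambda>x. exp (- ((1 - lam / crate) * (\<Sum>S\<in>UNIV. s S * real (cos_number x S)))))"
  let ?B = "(\<Sum>S\<in>UNIV. s S * real CARD('n))"
  have tend: "((\<lambda>\<rho>. \<rho> * crate) \<longlongrightarrow> crate) (at_left 1)"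
  proof -
    have "((\<lambda>\<rho>. \<rho> * crate) \<longlongrightarrow> 1 * crate) (at_left 1)" by (intro tendsto_intros)
    then show ?thesis by simp
  qed
  \<comment> \<open>The arrival rate is rewritten as \<open>\<rho> * crate\<close>, so that the
    idle-server weight becomes a function of \<rho>; its limit, the weight at the critical rate, is
    positive.\<close>
  have "((\<lambda>\<rho>. line_mass (idle_weight \<mu> p \<S> (\<rho> * crate)) \<rho> s / line_mass (idle_weight \<mu> p \<S> (\<rho> * crate)) \<rho> (\<lambda>_. 0))
      \<longlongrightarrow> limit_transform s) (at_left 1)"
    by (rule line_transform_limit[OF s ne, where h = "\<lambda>\<rho>. idle_weight \<mu> p \<S> (\<rho> * crate)" and h' = "idle_weight \<mu> p \<S> crate"])
       (intro idle_weight_tendsto tend critical_rate_pos idle_weight_pos)+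
  from filterlim_compose[OF this rate_filterlim] have W: "(?W \<longlongrightarrow> limit_transform s) (at_left crate)"
  proof (rule Lim_transform_eventually)
    show "\<forall>\<^sub>F lam in at_left crate. line_mass (idle_weight \<mu> p \<S> (lam / crate * crate)) (lam / crate) s
        / line_mass (idle_weight \<mu> p \<S> (lam / crate * crate)) (lam / crate) (\<lambda>_. 0) = ?W lam"
      using eventually_subcritical
    proof eventually_elim
      case (elim lam)
      have "lam / crate * crate = lam" using critical_rate_pos by simp
      then show ?case using elim cos_waiting_transform[OF _ _ st s, of lam] by simp
    qed
  qed
  have close: "\<bar>?Q lam - ?W lam\<bar> \<le> (1 - lam / crate) * ?B" if lam: "0 < lam" "lam < crate" for lam
  proof -
    define e where "e = 1 - lam / crate"
    have e: "e \<ge> 0" using lam critical_rate_pos by (simp add: e_def)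
    let ?q = "\<lambda>x. \<Sum>S\<in>UNIV. s S * real (cos_number x S)"
    let ?w = "\<lambda>x. \<Sum>S\<in>UNIV. s S * real (count_list (waiting x) S)"
    have nn: "?q x \<ge> 0" "?w x \<ge> 0" for x by (intro sum_nonneg mult_nonneg_nonneg s; simp)+
    have q: "?w x \<le> ?q x \<and> ?q x \<le> ?w x + ?B" for x :: "'n cos_state"
    proof -
      have "s S * real (count_list (waiting x) S) \<le> s S * real (cos_number x S)" for S
        using s by (intro mult_left_mono) (simp_all add: cos_number_def)
      moreover have "s S * real (cos_number x S) \<le> s S * real (count_list (waiting x) S) + s S * real CARD('n)" for S
        using mult_left_mono[OF of_nat_mono[OF card_mono[of UNIV "{n. serving x n = Some S}"]], of "s S"] s
        by (simp add: cos_number_def distrib_left)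
      ultimately show ?thesis
        by (auto simp only: sum.distrib[symmetric] intro!: sum_mono)
    qed
    \<comment> \<open>\<open>exp (- z)\<close> is 1-Lipschitz in \<open>z\<close> on the
      non-negative reals, and every type has at most \<open>CARD('n)\<close> jobs in
      service.\<close>
    have pt: "\<bar>exp (- (e * ?q x)) - exp (- (e * ?w x))\<bar> \<le> e * ?B" for x :: "'n cos_state"
    proof -
      have d: "e * ?w x \<le> e * ?q x" "e * ?q x \<le> e * ?w x + e * ?B"
        using q[of x] mult_left_mono[OF _ e] by (simp_all add: distrib_left[symmetric])
      have "exp (- (e * ?w x)) - exp (- (e * ?q x)) = exp (- (e * ?w x)) * (1 - exp (- (e * ?q x - e * ?w x)))"
        by (simp add: right_diff_distrib mult_exp_exp)
      also have "\<dots> \<le> 1 * (e * ?q x - e * ?w x)"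
      proof (rule mult_mono)
        show "1 - exp (- (e * ?q x - e * ?w x)) \<le> e * ?q x - e * ?w x"
          using exp_ge_add_one_self[of "- (e * ?q x - e * ?w x)"] by linarith
      qed (use d e nn(2)[of x] in auto)
      finally show ?thesis using d by simp
    qed
    have int: "integrable (measure_pmf (\<pi> lam)) (\<lambda>x. exp (- (e * ?q x)))" "integrable (measure_pmf (\<pi> lam)) (\<lambda>x. exp (- (e * ?w x)))"
      using e nn by (auto intro!: measure_pmf.integrable_const_bound[where B = 1])
    have "\<bar>?Q lam - ?W lam\<bar> = \<bar>\<integral>x. exp (- (e * ?q x)) - exp (- (e * ?w x)) \<partial>measure_pmf (\<pi> lam)\<bar>"
      using int by (simp add: e_def)
    also have "\<dots> \<le> (\<integral>x. \<bar>exp (- (e * ?q x)) - exp (- (e * ?w x))\<bar> \<partial>measure_pmf (\<pi> lam))"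
      by (rule integral_abs_bound)
    also have "\<dots> \<le> (\<integral>x. e * ?B \<partial>measure_pmf (\<pi> lam))"
      by (rule integral_mono) (use int pt in auto)
    finally show ?thesis by (simp add: e_def)
  qed
  have "((\<lambda>lam. (1 - lam / crate) * ?B) \<longlongrightarrow> (1 - crate / crate) * ?B) (at_left crate)"
    using critical_rate_pos by (intro tendsto_intros) simp
  then have z: "((\<lambda>lam. (1 - lam / crate) * ?B) \<longlongrightarrow> 0) (at_left crate)"
    using critical_rate_pos by simp
  have "((\<lambda>lam. ?Q lam - ?W lam) \<longlongrightarrow> 0) (at_left crate)"
    by (rule Lim_null_comparison[OF _ z]) (use eventually_subcritical in eventually_elim, use close in auto)
  from tendsto_add[OF this W] show ?thesis by simp
qed

lemma weak_limit:
  fixes Q :: "'s \<Rightarrow> 'n set \<Rightarrow> nat" and \<pi> :: "real \<Rightarrow> 's pmf" and X :: "'w \<Rightarrow> real ^ 'n set"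
  assumes M: "prob_space M" and X: "X \<in> borel_measurable M" and X_nonneg: "AE \<omega> in M. \<forall>S. X \<omega> $ S \<ge> 0"
    and X_transform: "\<And>s. (\<And>S. s S \<ge> 0) \<Longrightarrow> (\<integral>\<omega>. exp (- (\<Sum>S\<in>UNIV. s S * X \<omega> $ S)) \<partial>M) = limit_transform s"
    and Q: "\<And>s. (\<And>S. s S \<ge> 0) \<Longrightarrow> ((\<lambda>lam. measure_pmf.expectation (\<pi> lam)
       (\<lambda>x. exp (- ((1 - lam / crate) * (\<Sum>S\<in>UNIV. s S * real (Q x S)))))) \<longlongrightarrow> limit_transform s) (at_left crate)"
  shows "weakly_converges
     (\<lambda>lam. distr (measure_pmf (\<pi> lam)) borel (\<lambda>x. (1 - lam / crate) *\<^sub>R (\<chi> S. real (Q x S))))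
     (distr M borel X) (at_left crate)"
proof -
  \<comment> \<open>For \<open>lam\<close> above the critical rate the scaling factor is negative.
    Clipping it at 0 makes every \<open>D lam\<close> a law on the non-negative orthant, as the
    Laplace criterion demands for all indices; near the critical rate from below nothing
    changes.\<close>
  define D where "D lam = distr (measure_pmf (\<pi> lam)) borel (\<lambda>x. (max 0 (1 - lam / crate)) *\<^sub>R (\<chi> S. real (Q x S)) :: real ^ 'n set)" for lam
  have eq: "\<forall>\<^sub>F lam in at_left crate. max 0 (1 - lam / crate) = 1 - lam / crate"
    using eventually_subcritical
  proof eventually_elim
    case (elim lam)
    then have "lam / crate \<le> 1" using critical_rate_pos by simp
    then show ?case by simp
  qed
  have g: "(\<lambda>x :: real ^ 'n set. exp (- (\<Sum>S\<in>UNIV. a S * x $ S))) \<in> borel_measurable borel" for a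
    by (intro borel_measurable_continuous_onI continuous_intros)
  have "weakly_converges D (distr M borel X) (at_left crate)"
  proof (rule laplace_imp_weakly_converges)
    show "prob_space (D lam)" for lam
      unfolding D_def by (rule measure_pmf.prob_space_distr) simp
    show "prob_space (distr M borel X)"
      by (rule prob_space.prob_space_distr[OF M X])
    show "sets (D lam) = sets borel" for lam by (simp add: D_def)
    show "sets (distr M borel X) = sets borel" by simp
    have nn: "{x :: real ^ 'n set. \<forall>S. 0 \<le> x $ S} \<in> sets borel"
    proof -
      have "closed (\<Inter>S. {x :: real ^ 'n set. 0 \<le> x $ S})"
        by (intro closed_INT ballI closed_Collect_le continuous_intros)
      then show ?thesis by (simp add: Collect_all_eq)
    qed
    show "AE x in D lam. \<forall>S. x $ S \<ge> 0" for lam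
      unfolding D_def using nn by (subst AE_distr_iff) (auto intro!: AE_I2)
    show "AE x in distr M borel X. \<forall>S. x $ S \<ge> 0"
      using nn X X_nonneg by (subst AE_distr_iff) auto
    fix a :: "'n set \<Rightarrow> nat"
    let ?s = "\<lambda>S. real (a S)"
    have "(\<integral>x. exp (- (\<Sum>S\<in>UNIV. ?s S * x $ S)) \<partial>distr M borel X) = limit_transform ?s"
      by (subst integral_distr[OF X g]) (rule X_transform, simp)
    moreover have "((\<lambda>lam. \<integral>x. exp (- (\<Sum>S\<in>UNIV. ?s S * x $ S)) \<partial>D lam) \<longlongrightarrow> limit_transform ?s) (at_left crate)"
      using Q[of ?s, OF of_nat_0_le_iff]
    proof (rule Lim_transform_eventually)
      show "\<forall>\<^sub>F lam in at_left crate. measure_pmf.expectation (\<pi> lam)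
          (\<lambda>x. exp (- ((1 - lam / crate) * (\<Sum>S\<in>UNIV. ?s S * real (Q x S)))))
         = (\<integral>x. exp (- (\<Sum>S\<in>UNIV. ?s S * x $ S)) \<partial>D lam)"
        using eq
      proof eventually_elim
        case (elim lam)
        have m: "(\<lambda>x. max 0 (1 - lam / crate) *\<^sub>R (\<chi> S. real (Q x S)) :: real ^ 'n set) \<in> measurable (measure_pmf (\<pi> lam)) borel"
          by simp
        have pt: "(\<Sum>S\<in>UNIV. ?s S * (max 0 (1 - lam / crate) *\<^sub>R (\<chi> S. real (Q x S)) :: real ^ 'n set) $ S)
            = (1 - lam / crate) * (\<Sum>S\<in>UNIV. ?s S * real (Q x S))" for x
          unfolding elim sum_distrib_left by (simp add: mult.left_commute)
        show ?case unfolding D_def integral_distr[OF m g] pt ..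
      qed
    qed
    ultimately show "((\<lambda>lam. \<integral>x. exp (- (\<Sum>S\<in>UNIV. ?s S * x $ S)) \<partial>D lam)
        \<longlongrightarrow> (\<integral>x. exp (- (\<Sum>S\<in>UNIV. ?s S * x $ S)) \<partial>distr M borel X)) (at_left crate)"
      by (simp only:)
  qed
  then show ?thesis
    unfolding weakly_converges_def
  proof (intro allI impI)
    fix f :: "real ^ 'n set \<Rightarrow> real"
    assume *: "\<forall>f :: real ^ 'n set \<Rightarrow> real. continuous_on UNIV f \<and> bounded (range f) \<longrightarrow> ((\<lambda>i. \<integral>x. f x \<partial>D i) \<longlongrightarrow> (\<integral>x. f x \<partial>distr M borel X)) (at_left crate)"
      and f: "continuous_on UNIV f \<and> bounded (range f)"
    have "((\<lambda>i. \<integral>x. f x \<partial>D i) \<longlongrightarrow> (\<integral>x. f x \<partial>distr M borel X)) (at_left crate)"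
      by (rule *[THEN spec, THEN mp, OF f])
    then show "((\<lambda>lam. \<integral>x. f x \<partial>distr (measure_pmf (\<pi> lam)) borel (\<lambda>x. (1 - lam / crate) *\<^sub>R (\<chi> S. real (Q x S))))
        \<longlongrightarrow> (\<integral>x. f x \<partial>distr M borel X)) (at_left crate)"
    proof (rule Lim_transform_eventually)
      show "\<forall>\<^sub>F lam in at_left crate. (\<integral>x. f x \<partial>D lam)
          = (\<integral>x. f x \<partial>distr (measure_pmf (\<pi> lam)) borel (\<lambda>x. (1 - lam / crate) *\<^sub>R (\<chi> S. real (Q x S))))"
        using eq by eventually_elim (simp only: D_def)
    qed
  qed
qed

end

theorem theorem4p1:
  fixes \<mu> :: "'n::finite \<Rightarrow> real"
    and p :: "'n set \<Rightarrow> real"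
    and \<S> :: "'n set set"
    and M :: "'w measure"
    and \<tau> :: "'w \<Rightarrow> 'n set list"
    and U :: "nat \<Rightarrow> 'w \<Rightarrow> real"
  assumes "\<And>n. \<mu> n > 0"
    and "\<S> \<noteq> {}" and "{} \<notin> \<S>"
    and "\<And>S. S \<in> \<S> \<Longrightarrow> p S > 0"
    and "(\<Sum>S\<in>\<S>. p S) = 1"
    and "prob_space M"
    and "\<tau> \<in> measurable M (count_space (max_vectors \<mu> p \<S>))"
    and "\<And>T. T \<in> max_vectors \<mu> p \<S> \<Longrightarrow>
           measure M {\<omega> \<in> space M. \<tau> \<omega> = T} =
             vector_weight \<mu> p \<S> T / (\<Sum>T'\<in>max_vectors \<mu> p \<S>. vector_weight \<mu> p \<S> T')"
    and "\<And>k. k \<in> {1..chain_length \<mu> p \<S>} \<Longrightarrow>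
           distributed M lborel (U k) (exponential_density 1)"
    and "prob_space.indep_vars M (\<lambda>_. borel) U {1..chain_length \<mu> p \<S>}"
    and "independent_variables M
           (count_space (max_vectors \<mu> p \<S>)) \<tau>
           (Pi\<^sub>M {1..chain_length \<mu> p \<S>} (\<lambda>_. borel))
           (\<lambda>\<omega>. restrict (\<lambda>k. U k \<omega>) {1..chain_length \<mu> p \<S>})"
  shows "(\<forall>\<pi>. (\<forall>lam. 0 < lam \<and> lam < critical_rate \<mu> p \<S> \<longrightarrow> coc_stationary \<mu> p \<S> lam (\<pi> lam)) \<longrightarrow>
            weakly_converges
              (\<lambda>lam. distr (measure_pmf (\<pi> lam)) borel
                 (\<lambda>x. (1 - lam / critical_rate \<mu> p \<S>) *\<^sub>R (\<chi> S. real (coc_number x S))))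
              (distr M borel (\<lambda>\<omega>. limit_vector \<mu> p \<S> (\<tau> \<omega>) (\<lambda>k. U k \<omega>)))
              (at_left (critical_rate \<mu> p \<S>)))
       \<and> (\<forall>\<pi>. (\<forall>lam. 0 < lam \<and> lam < critical_rate \<mu> p \<S> \<longrightarrow> cos_stationary \<mu> p \<S> lam (\<pi> lam)) \<longrightarrow>
            weakly_converges
              (\<lambda>lam. distr (measure_pmf (\<pi> lam)) borel
                 (\<lambda>x. (1 - lam / critical_rate \<mu> p \<S>) *\<^sub>R (\<chi> S. real (cos_number x S))))
              (distr M borel (\<lambda>\<omega>. limit_vector \<mu> p \<S> (\<tau> \<omega>) (\<lambda>k. U k \<omega>)))
              (at_left (critical_rate \<mu> p \<S>)))"
proof -
  interpret parallel_servers \<mu> p \<S>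
    by unfold_locales (use assms in auto)
  note facts = assms(6-11)
  let ?X = "\<lambda>\<omega>. limit_vector \<mu> p \<S> (\<tau> \<omega>) (\<lambda>k. U k \<omega>)"
  have ne: "max_vectors \<mu> p \<S> \<noteq> {}"
    by (rule max_vectors_nonempty[OF facts])
  \<comment> \<open>Kept generic in the state type, so that both mechanisms are instances.\<close>
  have limit: "weakly_converges
     (\<lambda>lam. distr (measure_pmf (\<pi> lam)) borel (\<lambda>x. (1 - lam / critical_rate \<mu> p \<S>) *\<^sub>R (\<chi> S. real (Q x S))))
     (distr M borel ?X) (at_left (critical_rate \<mu> p \<S>))"
    if "\<And>s. (\<And>S. s S \<ge> 0) \<Longrightarrow> ((\<lambda>lam. measure_pmf.expectation (\<pi> lam)
       (\<lambda>x. exp (- ((1 - lam / critical_rate \<mu> p \<S>) * (\<Sum>S\<in>UNIV. s S * real (Q x S))))))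
        \<longlongrightarrow> limit_transform s) (at_left (critical_rate \<mu> p \<S>))"
    for Q :: "'s \<Rightarrow> 'n set \<Rightarrow> nat" and \<pi>
    by (rule weak_limit[OF assms(6) limit_vector_measurable[OF facts] limit_vector_nonneg[OF facts]
          limit_vector_transform[OF facts] that])
  show ?thesis
    by (intro conjI allI impI limit coc_transform_limit[OF ne] cos_transform_limit[OF ne]) auto
qed

end
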